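(* Let $Y(t)$, $t\ge 0$, be a critical Markov branching process with non-homogeneous Poisson immigration, with offspring p.g.f. $f(s)=s+(1-s)^{\gamma+1}L(1/(1-s))$, $s\in[0,1)$, $\gamma\in(0,1]$, immigrant p.g.f. $g(s)=1-(1-s)^{\alpha}l(1/(1-s))$, $\alpha\in(0,1]$, and Poisson intensity $r(t)=t^{-\theta}L_R(t)$, $\theta>0$, where $L,l,L_R$ are slowly varying at infinity. (i) If $\theta=1$ with $R(t)\to\infty$ as $t\to\infty$, and $\alpha/\gamma>1$, then for $s\in[0,1)$ $$\mathbf{E}[s^{Y(t)}\mid Y(t)>0]\to 1-\frac{\Delta(s)}{Q},\qquad t\to\infty .$$ (ii) If $\theta>1$ and $\alpha/\gamma=1$ with $Q(t)\to\infty$ as $t\to\infty$, then for every $x\ge0$ $$\mathbf{P}\{Y(t)/W(\mu t)\le x\mid Y(t)>0\}\to D(\alpha,\gamma;x),\qquad t\to\infty,$$ where $D(\alpha,\gamma;\cdot)$ is the distribution function on $[0,\infty)$ with Laplace transform $$\int_0^\infty e^{-\lambda x}\,\mathrm{d}D(\alpha,\gamma;x)=1-\frac{\lambda^{\alpha}}{(1+\lambda^{\gamma})^{\alpha/\gamma}},\qquad \lambda>0 .$$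
   Context: Model. In a Markov branching process each particle, independently of all others, lives an exponentially distributed time with parameter $\mu>0$ and at its death produces a random number $\xi\ge 0$ of new particles of the same type; $f(s)=\mathbf{E}[s^{\xi}]$ is the offspring p.g.f. Let $Z(t)$ be the number of particles at time $t$ and $F(t;s)=\mathbf{E}[s^{Z(t)}\mid Z(0)=1]$, so $\partial F(t;s)/\partial t=\mu[f(F(t;s))-F(t;s)]$, $F(0;s)=s$. Let $\nu(t)$ be a non-homogeneous Poisson process with intensity $r(t)$, mean measure $R(t)=\int_0^t r(u)\,du$ (finite for each $t$), and jump points $0=S_0<S_1<S_2<\cdots$. At each $S_k$, $k\ge1$, $I_k$ new particles immigrate, where $I_1,I_2,\dots$ are i.i.d. non-negative integer-valued with p.g.f. $g(s)=\mathbf{E}[s^{I_k}]$. The Markov branching process with non-homogeneous Poisson immigration is $$Y(t)=\sum_{k=1}^{\nu(t)}\sum_{j=1}^{I_k}Z^{(k,j)}(t-S_k),\qquad t\ge 0,$$ where $Z^{(k,j)}$ are i.i.d. copies of $Z$ started from one particle; the processes $Z^{(k,j)}$, the variables $I_k$ and the Poisson process $\nu$ are independent. Notation. $q(t;s)=1-g(F(t;s))$, $q(t)=q(t;0)$, $Q(t)=\int_0^t q(u)\,du$, $Q=\int_0^\infty q(u)\,du$, $\Delta(s)=\int_0^\infty q(u;s)\,du$ (the last two when they converge; they do when $\alpha/\gamma>1$). $V(x)=\int_0^{1-1/x}\frac{du}{f(u)-u}=\int_1^x\frac{u^{\gamma-1}}{L(u)}\,du$ for $x\ge1$, which is increasing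 from $[1,\infty)$ onto $[0,\infty)$, and $W:[0,\infty)\to[1,\infty)$ is the inverse function of $V$. *)

theory Defs
  imports "HOL-Probability.Probability"
begin

definition slowly_varying :: "(real \<Rightarrow> real) \<Rightarrow> bool" where
  "slowly_varying L \<longleftrightarrow>
     (\<exists>a. set_borel_measurable borel {a..} L \<and> (\<forall>x\<ge>a. 0 < L x)) \<and>
     (\<forall>c>0. ((\<lambda>x. L (c * x) / L x) \<longlongrightarrow> 1) at_top)"

definition pgf :: "nat pmf \<Rightarrow> real \<Rightarrow> real" where
  "pgf p s = measure_pmf.expectation p (\<lambda>n. s ^ n)"


text \<open>The genealogy of one initial particle assigns to every potential particle its lifetime and
  its number of children. Particles carry Ulam-Harris labels: \<open>[]\<close> is the initial particle and
  \<open>u @ [i]\<close> is the \<open>i\<close>-th child of \<open>u\<close>, counted from 0.\<close>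

type_synonym genealogy = "nat list \<Rightarrow> real \<times> nat"

definition is_born :: "genealogy \<Rightarrow> nat list \<Rightarrow> bool" where
  "is_born x u \<longleftrightarrow> (\<forall>m<length u. u ! m < snd (x (take m u)))"

definition birth_time :: "genealogy \<Rightarrow> nat list \<Rightarrow> real" where
  "birth_time x u = (\<Sum>m<length u. fst (x (take m u)))"

text \<open>\<open>card\<close> is 0 on infinite sets, so an exploded population would count as 0. For critical
  offspring laws explosion has probability 0.\<close>

definition population :: "genealogy \<Rightarrow> real \<Rightarrow> nat" where
  "population x t =
     card {u. is_born x u \<and> birth_time x u \<le> t \<and> t < birth_time x u + fst (x u)}"

definition genealogy_law :: "real \<Rightarrow> nat pmf \<Rightarrow> genealogy measure" where
  "genealogy_law \<mu> p =
     (\<Pi>\<^sub>M u\<in>UNIV. density lborel (exponential_density \<mu>) \<Otimes>\<^sub>M measure_pmf p)"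

definition branching_pgf :: "real \<Rightarrow> nat pmf \<Rightarrow> real \<Rightarrow> real \<Rightarrow> real" where
  "branching_pgf \<mu> p t s = (\<integral>x. s ^ population x t \<partial>genealogy_law \<mu> p)"


text \<open>Since the mean measure has a density, the jumps are almost surely of size 1.\<close>

locale poisson_process = prob_space M
  for M :: "'a measure" and r :: "real \<Rightarrow> real" and \<nu> :: "real \<Rightarrow> 'a \<Rightarrow> nat" +
  assumes intensity_nonneg: "\<And>t. 0 < t \<Longrightarrow> 0 \<le> r t"
    and intensity_integrable: "\<And>t. 0 \<le> t \<Longrightarrow> set_integrable lborel {0..t} r"
    and count_measurable: "\<And>t. 0 \<le> t \<Longrightarrow> random_variable (count_space UNIV) (\<nu> t)"
    and count_0: "\<And>\<omega>. \<omega> \<in> space M \<Longrightarrow> \<nu> 0 \<omega> = 0"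
    and count_mono: "\<And>\<omega> s t. \<omega> \<in> space M \<Longrightarrow> 0 \<le> s \<Longrightarrow> s \<le> t \<Longrightarrow> \<nu> s \<omega> \<le> \<nu> t \<omega>"
    and count_right_continuous:
      "\<And>\<omega> t. \<omega> \<in> space M \<Longrightarrow> 0 \<le> t \<Longrightarrow> \<forall>\<^sub>F u in at_right t. \<nu> u \<omega> = \<nu> t \<omega>"
    and count_increment: "\<And>s t. 0 \<le> s \<Longrightarrow> s \<le> t \<Longrightarrow>
      distr M (count_space UNIV) (\<lambda>\<omega>. \<nu> t \<omega> - \<nu> s \<omega>) =
        measure_pmf (poisson_pmf (LBINT u:{s..t}. r u))"
    and count_indep_increments: "\<And>\<tau>. mono \<tau> \<Longrightarrow> 0 \<le> \<tau> 0 \<Longrightarrow>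
      indep_vars (\<lambda>_. count_space UNIV) (\<lambda>i \<omega>. \<nu> (\<tau> (Suc i)) \<omega> - \<nu> (\<tau> i) \<omega>) (UNIV :: nat set)"

definition mean_measure :: "(real \<Rightarrow> real) \<Rightarrow> real \<Rightarrow> real" where
  "mean_measure r t = (LBINT u:{0..t}. r u)"

text \<open>Meaningful only if the path makes at least \<open>k\<close> jumps.\<close>

definition jump_point :: "(real \<Rightarrow> 'a \<Rightarrow> nat) \<Rightarrow> nat \<Rightarrow> 'a \<Rightarrow> real" where
  "jump_point \<nu> k \<omega> = Inf {t. 0 \<le> t \<and> k \<le> \<nu> t \<omega>}"


datatype source = Arrivals | Batch nat | Family nat nat

text \<open>\<open>p\<close> is the offspring law, \<open>h\<close> the law of the immigrant numbers \<open>I k\<close>, and \<open>G k j\<close> the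
  genealogy of the \<open>j\<close>-th immigrant of the \<open>k\<close>-th batch (\<open>k, j \<ge> 1\<close>). Independence is stated for
  the generated \<sigma>-algebras because the random elements have different types; the Poisson
  process enters with its whole path.\<close>

locale branching_immigration = poisson_process M r \<nu>
  for M :: "'a measure" and r :: "real \<Rightarrow> real" and \<nu> :: "real \<Rightarrow> 'a \<Rightarrow> nat" +
  fixes \<mu> :: real and p h :: "nat pmf"
    and I :: "nat \<Rightarrow> 'a \<Rightarrow> nat" and G :: "nat \<Rightarrow> nat \<Rightarrow> 'a \<Rightarrow> genealogy"
  assumes rate_pos: "0 < \<mu>"
    and batch_measurable: "\<And>k. 1 \<le> k \<Longrightarrow> random_variable (count_space UNIV) (I k)"
    and batch_law: "\<And>k. 1 \<le> k \<Longrightarrow> distr M (count_space UNIV) (I k) = measure_pmf h"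
    and family_measurable:
      "\<And>k j. 1 \<le> k \<Longrightarrow> 1 \<le> j \<Longrightarrow> random_variable (genealogy_law \<mu> p) (G k j)"
    and family_law:
      "\<And>k j. 1 \<le> k \<Longrightarrow> 1 \<le> j \<Longrightarrow> distr M (genealogy_law \<mu> p) (G k j) = genealogy_law \<mu> p"
    and sources_indep:
      "indep_sets
         (\<lambda>a. case a of
            Arrivals \<Rightarrow> sets (vimage_algebra (space M) (\<lambda>\<omega>. \<lambda>t\<in>{0..}. \<nu> t \<omega>)
                          (\<Pi>\<^sub>M t\<in>{0..}. count_space UNIV))
          | Batch k \<Rightarrow> sets (vimage_algebra (space M) (I k) (count_space UNIV))
          | Family k j \<Rightarrow> sets (vimage_algebra (space M) (G k j) (genealogy_law \<mu> p)))
         ({Arrivals} \<union> {Batch k | k. 1 \<le> k} \<union> {Family k j | k j. 1 \<le> k \<and> 1 \<le> j})"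

definition total_population ::
  "(real \<Rightarrow> 'a \<Rightarrow> nat) \<Rightarrow> (nat \<Rightarrow> 'a \<Rightarrow> nat) \<Rightarrow> (nat \<Rightarrow> nat \<Rightarrow> 'a \<Rightarrow> genealogy) \<Rightarrow> real \<Rightarrow> 'a \<Rightarrow> nat"
  where
  "total_population \<nu> I G t \<omega> =
     (\<Sum>k=1..\<nu> t \<omega>. \<Sum>j=1..I k \<omega>. population (G k j \<omega>) (t - jump_point \<nu> k \<omega>))"


definition q_fun :: "real \<Rightarrow> nat pmf \<Rightarrow> nat pmf \<Rightarrow> real \<Rightarrow> real \<Rightarrow> real" where
  "q_fun \<mu> p h t s = 1 - pgf h (branching_pgf \<mu> p t s)"

definition Q_fun :: "real \<Rightarrow> nat pmf \<Rightarrow> nat pmf \<Rightarrow> real \<Rightarrow> real" where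
  "Q_fun \<mu> p h t = (LBINT u:{0..t}. q_fun \<mu> p h u 0)"

definition Q_total :: "real \<Rightarrow> nat pmf \<Rightarrow> nat pmf \<Rightarrow> real" where
  "Q_total \<mu> p h = (LBINT u:{0..}. q_fun \<mu> p h u 0)"

definition Delta :: "real \<Rightarrow> nat pmf \<Rightarrow> nat pmf \<Rightarrow> real \<Rightarrow> real" where
  "Delta \<mu> p h s = (LBINT u:{0..}. q_fun \<mu> p h u s)"

definition V_fun :: "(real \<Rightarrow> real) \<Rightarrow> real \<Rightarrow> real" where
  "V_fun f x = (LBINT u:{0..1 - 1 / x}. 1 / (f u - u))"

definition W_fun :: "(real \<Rightarrow> real) \<Rightarrow> real \<Rightarrow> real" where
  "W_fun f = the_inv_into {1..} (V_fun f)"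

end

theory Submission
  imports Defs
begin

text \<open>Two facts about the model reduce the theorem to an analysis of integrals.

  Averaging first over the genealogies of the immigrants, then over the batch sizes and finally over
  the Poisson process gives \<open>E s\<^bsup>Y(t)\<^esup> = exp (- J(t;s))\<close> with
  \<open>J(t;s) = \<integral>\<^sub>0\<^sup>t r(u) q(t - u;s) du\<close> (\<open>total_population_pgf\<close>). Consequently
  \<open>E[s\<^bsup>Y(t)\<^esup> | Y(t) > 0] = 1 - (1 - exp (- J(t;s))) / (1 - exp (- J(t;0)))\<close>, which is close to
  \<open>1 - J(t;s) / J(t;0)\<close> when both integrals are small.

  Decomposing a genealogy at its root gives a renewal equation for \<open>F(t;s)\<close>, from which
  \<open>dF/dt = \<mu> (f(F) - F)\<close> and, after separating variables, \<open>1 - F(t;s) = 1 / W(\<mu>t + V(1/(1 - s)))\<close>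
  (\<open>survival\<close>). By l'Hospital's rule \<open>V\<close> is regularly varying with index \<open>\<gamma>\<close>, hence \<open>W\<close> with index
  \<open>1/\<gamma>\<close> and \<open>q(t;0)\<close> with index \<open>- \<alpha>/\<gamma>\<close>.

  In part (i) the function \<open>q\<close> is integrable and \<open>r\<close> is flat on the scale of \<open>t\<close>, so recent
  immigrants dominate and \<open>J(t;s)\<close> is asymptotic to \<open>r(t) \<Delta>(s)\<close>. In part (ii) the roles are
  exchanged: \<open>r\<close> is integrable, the earliest immigrants dominate, and \<open>J(t;s\<^sub>t)\<close> is asymptotic to
  \<open>q(t;s\<^sub>t) \<integral>\<^sub>0\<^sup>\<infinity> r(u) du\<close>, where \<open>s\<^sub>t = exp (- z / W(\<mu>t))\<close>. Both statements are instances of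
  \<open>convolution_asymptotic\<close>. In part (ii) the conditional Laplace transforms at \<open>z\<close> converge to
  \<open>1 / (1 + z\<^sup>\<alpha>)\<close>, since \<open>q(t;s\<^sub>t) / q(t;0)\<close> tends to \<open>(1 + z\<^bsup>-\<gamma>\<^esup>)\<^bsup>-\<alpha>/\<gamma>\<^esup>\<close> and \<open>\<alpha> = \<gamma>\<close>. The
  continuity theorem \<open>laplace_continuity\<close> provides the limit law, and as this law has no atoms
  (\<open>linnik_atomless\<close>) the distribution functions converge at every point.\<close>

section \<open>Laplace transforms of laws on the half-line\<close>

text \<open>Weierstrass approximation: on the unit interval a continuous integrand is uniformly close to a
  polynomial.\<close>

lemma integral_continuous_eq_of_moments:
  fixes U\<^sub>1 U\<^sub>2 :: "real measure" and f :: "real \<Rightarrow> real"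
  assumes "real_distribution U\<^sub>1" "real_distribution U\<^sub>2"
    and AE: "AE x in U\<^sub>1. x \<in> {0..1}" "AE x in U\<^sub>2. x \<in> {0..1}"
    and moments: "\<And>n. (\<integral>x. x ^ n \<partial>U\<^sub>1) = (\<integral>x. x ^ n \<partial>U\<^sub>2)"
    and f: "continuous_on UNIV f" "\<And>x. \<bar>f x\<bar> \<le> 1"
  shows "(\<integral>x. f x \<partial>U\<^sub>1) = (\<integral>x. f x \<partial>U\<^sub>2)"
proof -
  interpret U1: real_distribution U\<^sub>1 by fact
  interpret U2: real_distribution U\<^sub>2 by fact
  have f_meas[measurable]: "f \<in> borel_measurable borel"
    using f(1) by (rule borel_measurable_continuous_onI)
  have int_f1: "integrable U\<^sub>1 f"
    by (rule U1.integrable_const_bound[where B=1]) (use f(2) in auto)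
  have int_f2: "integrable U\<^sub>2 f"
    by (rule U2.integrable_const_bound[where B=1]) (use f(2) in auto)
  note int_f = int_f1 int_f2
  have pow_AE: "AE x in U\<^sub>1. norm (x ^ n) \<le> 1" "AE x in U\<^sub>2. norm (x ^ n) \<le> 1" for n :: nat
    using AE(1) apply eventually_elim apply (simp add: power_abs power_le_one)
    using AE(2) apply eventually_elim apply (simp add: power_abs power_le_one)
    done
  have int_pow: "integrable U\<^sub>1 (\<lambda>x. x ^ n)" "integrable U\<^sub>2 (\<lambda>x. x ^ n)" for n :: nat
    by (rule U1.integrable_const_bound[OF pow_AE(1)], simp)
       (rule U2.integrable_const_bound[OF pow_AE(2)], simp)
  have "\<bar>(\<integral>x. f x \<partial>U\<^sub>1) - (\<integral>x. f x \<partial>U\<^sub>2)\<bar> \<le> e" if "e > 0" for e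
  proof -
    have "continuous_on {0..1} f" using f(1) by (rule continuous_on_subset) simp
    from Stone_Weierstrass_real_polynomial_function[OF compact_Icc this half_gt_zero[OF that]]
    obtain P where P: "real_polynomial_function P" "\<And>x. x \<in> {0..1} \<Longrightarrow> \<bar>f x - P x\<bar> < e / 2"
      by blast
    then obtain a n where a: "P = (\<lambda>x. \<Sum>i\<le>n. a i * x ^ i)"
      by (auto simp: real_polynomial_function_iff_sum)
    have int_P: "integrable U\<^sub>1 P" "integrable U\<^sub>2 P"
      unfolding a using int_pow by (auto intro!: Bochner_Integration.integrable_sum)
    have eq: "(\<integral>x. P x \<partial>U\<^sub>1) = (\<integral>x. P x \<partial>U\<^sub>2)"
      unfolding a using int_pow moments by (simp add: Bochner_Integration.integral_sum)
    have "\<bar>(\<integral>x. f x \<partial>U\<^sub>1) - (\<integral>x. P x \<partial>U\<^sub>1)\<bar> \<le> e / 2"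
    proof -
      have "\<bar>\<integral>x. f x - P x \<partial>U\<^sub>1\<bar> \<le> (\<integral>x. \<bar>f x - P x\<bar> \<partial>U\<^sub>1)"
        by (rule integral_abs_bound)
      also have "\<dots> \<le> (\<integral>x. e / 2 \<partial>U\<^sub>1)"
      proof (rule integral_mono_AE)
        show "AE x in U\<^sub>1. \<bar>f x - P x\<bar> \<le> e / 2"
          using AE(1) by eventually_elim (rule less_imp_le[OF P(2)])
      qed (use int_f int_P in auto)
      finally show ?thesis using int_f int_P U1.prob_space by simp
    qed
    moreover have "\<bar>(\<integral>x. f x \<partial>U\<^sub>2) - (\<integral>x. P x \<partial>U\<^sub>2)\<bar> \<le> e / 2"
    proof -
      have "\<bar>\<integral>x. f x - P x \<partial>U\<^sub>2\<bar> \<le> (\<integral>x. \<bar>f x - P x\<bar> \<partial>U\<^sub>2)"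
        by (rule integral_abs_bound)
      also have "\<dots> \<le> (\<integral>x. e / 2 \<partial>U\<^sub>2)"
      proof (rule integral_mono_AE)
        show "AE x in U\<^sub>2. \<bar>f x - P x\<bar> \<le> e / 2"
          using AE(2) by eventually_elim (rule less_imp_le[OF P(2)])
      qed (use int_f int_P in auto)
      finally show ?thesis using int_f int_P U2.prob_space by simp
    qed
    ultimately show ?thesis using eq by linarith
  qed
  then have "\<bar>(\<integral>x. f x \<partial>U\<^sub>1) - (\<integral>x. f x \<partial>U\<^sub>2)\<bar> \<le> 0"
    by (rule field_le_epsilon) (simp only: add_0)
  then show ?thesis by simp
qed

lemma moments_determine_unit_law:
  fixes U\<^sub>1 U\<^sub>2 :: "real measure"
  assumes U: "real_distribution U\<^sub>1" "real_distribution U\<^sub>2"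
    and AE: "AE x in U\<^sub>1. x \<in> {0..1}" "AE x in U\<^sub>2. x \<in> {0..1}"
    and moments: "\<And>n. (\<integral>x. x ^ n \<partial>U\<^sub>1) = (\<integral>x. x ^ n \<partial>U\<^sub>2)"
  shows "U\<^sub>1 = U\<^sub>2"
proof (rule Levy_uniqueness[OF U ext])
  fix t
  interpret U1: real_distribution U\<^sub>1 by fact
  interpret U2: real_distribution U\<^sub>2 by fact
  have "(\<integral>x. cos (t * x) \<partial>U\<^sub>1) = (\<integral>x. cos (t * x) \<partial>U\<^sub>2)"
       "(\<integral>x. sin (t * x) \<partial>U\<^sub>1) = (\<integral>x. sin (t * x) \<partial>U\<^sub>2)"
    by (intro integral_continuous_eq_of_moments[OF assms] continuous_intros; simp)+
  moreover have "char U t = Complex (\<integral>x. cos (t * x) \<partial>U) (\<integral>x. sin (t * x) \<partial>U)"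
    if "real_distribution U" for U
  proof -
    interpret real_distribution U by fact
    have int: "integrable U (\<lambda>x. iexp (t * x))"
      by (rule integrable_const_bound[where B=1]) auto
    have "Re (char U t) = (\<integral>x. Re (iexp (t * x)) \<partial>U)" "Im (char U t) = (\<integral>x. Im (iexp (t * x)) \<partial>U)"
      unfolding char_def using int by (auto intro: integral_Re[symmetric] integral_Im[symmetric])
    then show ?thesis
      by (simp add: complex_eq_iff Re_exp Im_exp)
  qed
  ultimately show "char U\<^sub>1 t = char U\<^sub>2 t" using U by simp
qed


text \<open>Clamping turns functions on the unit interval into bounded continuous functions on the line, the
  test functions of weak convergence.\<close>

definition unit_clamp :: "real \<Rightarrow> real" where
  "unit_clamp x = max 0 (min 1 x)"

lemma unit_clamp_bounds: "0 \<le> unit_clamp x" "unit_clamp x \<le> 1"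
  and unit_clamp_id: "x \<in> {0..1} \<Longrightarrow> unit_clamp x = x"
  by (auto simp: unit_clamp_def)

lemma isCont_unit_clamp_powr: "0 < z \<Longrightarrow> isCont (\<lambda>x. unit_clamp x powr z) x"
  unfolding unit_clamp_def by (intro continuous_intros) auto

lemma weak_limit_unit_law:
  fixes U :: "nat \<Rightarrow> real measure"
  assumes U: "\<And>n. real_distribution (U n)" "real_distribution U'" "weak_conv_m U U'"
    and AE: "\<And>n. AE x in U n. x \<in> {0..1}"
  shows "AE x in U'. x \<in> {0..1}"
proof -
  interpret real_distribution U' by fact
  define d :: "real \<Rightarrow> real" where "d x = min 1 (\<bar>x - unit_clamp x\<bar>)" for x
  have d: "isCont d x" "\<bar>d x\<bar> \<le> 1" "0 \<le> d x" for x
    unfolding d_def unit_clamp_def by (auto intro!: continuous_intros)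
  then have [measurable]: "d \<in> borel_measurable borel"
    by (auto intro!: borel_measurable_continuous_onI continuous_at_imp_continuous_on)
  have "(\<lambda>n. \<integral>x. d x \<partial>U n) \<longlonglongrightarrow> (\<integral>x. d x \<partial>U')"
    by (rule weak_conv_imp_integral_bdd_continuous_conv[OF U, where B=1]) (use d in auto)
  moreover have "(\<integral>x. d x \<partial>U n) = 0" for n
  proof (rule integral_eq_zero_AE)
    show "AE x in U n. d x = 0"
      using AE[of n] by eventually_elim (simp add: d_def unit_clamp_def)
  qed
  ultimately have "(\<integral>x. d x \<partial>U') = 0"
    by (simp add: LIMSEQ_const_iff)
  moreover have "integrable U' d"
    using d by (intro integrable_const_bound[where B=1]) auto
  ultimately have "AE x in U'. d x = 0"
    using d by (subst (asm) integral_nonneg_eq_0_iff_AE) auto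
  then show ?thesis
    by eventually_elim (auto simp: d_def unit_clamp_def min_def max_def split: if_splits)
qed

text \<open>Laws on the unit interval are tight, and all subsequential limits have the moments \<open>m\<close>, hence
  coincide.\<close>

lemma unit_law_convergence:
  fixes U :: "nat \<Rightarrow> real measure"
  assumes U: "\<And>n. real_distribution (U n)"
    and AE: "\<And>n. AE x in U n. x \<in> {0..1}"
    and moments: "\<And>k. (\<lambda>n. \<integral>x. x ^ k \<partial>U n) \<longlonglongrightarrow> m k"
  obtains U' where "real_distribution U'" "AE x in U'. x \<in> {0..1}" "weak_conv_m U U'"
proof -
  have pow: "(\<integral>x. x ^ k \<partial>W) = (\<integral>x. unit_clamp x ^ k \<partial>W)"
    if "real_distribution W" "AE x in W. x \<in> {0..1}" for W k
  proof -
    interpret real_distribution W by fact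
    have "AE x in W. x ^ k = unit_clamp x ^ k" using that(2) by eventually_elim (simp add: unit_clamp_id)
    then show ?thesis unfolding unit_clamp_def by (intro integral_cong_AE) auto
  qed
  have lim: "(\<integral>x. x ^ k \<partial>W) = m k"
    if s: "strict_mono s" and W: "real_distribution W" "weak_conv_m (U \<circ> s) W" for s W k
  proof -
    have W_AE: "AE x in W. x \<in> {0..1}"
      by (rule weak_limit_unit_law[of "\<lambda>n. U (s n)", OF U W(1) W(2)[unfolded o_def] AE])
    have "(\<lambda>n. \<integral>x. unit_clamp x ^ k \<partial>(U (s n))) \<longlonglongrightarrow> (\<integral>x. unit_clamp x ^ k \<partial>W)"
      using U W[unfolded o_def]
      by (intro weak_conv_imp_integral_bdd_continuous_conv[where B=1])
         (auto simp: unit_clamp_def intro!: continuous_intros power_le_one)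
    then have "(\<lambda>n. \<integral>x. x ^ k \<partial>U (s n)) \<longlonglongrightarrow> (\<integral>x. x ^ k \<partial>W)"
      using pow[OF U AE] pow[OF W(1) W_AE] by simp
    from LIMSEQ_unique[OF this LIMSEQ_subseq_LIMSEQ[OF moments s, unfolded o_def]]
    show ?thesis .
  qed
  have tight: "tight U"
    unfolding tight_def
  proof (intro conjI allI impI U)
    fix e :: real assume "0 < e"
    have "measure (U n) {- 1<..1} = 1" for n
    proof -
      interpret real_distribution "U n" by (rule U)
      show ?thesis
        using AE[of n] by (subst prob_eq_1) (auto elim!: eventually_mono)
    qed
    then show "\<exists>a b. a < b \<and> (\<forall>n. 1 - e < measure (U n) {a<..b})"
      using \<open>0 < e\<close> by (intro exI[of _ "-1"] exI[of _ 1]) auto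
  qed
  then obtain r U' where r: "strict_mono r" "real_distribution U'" "weak_conv_m (U \<circ> id \<circ> r) U'"
    using tight_imp_convergent_subsubsequence[of U id] strict_mono_id by (auto simp: id_def)
  have U'_AE: "AE x in U'. x \<in> {0..1}"
    by (rule weak_limit_unit_law[of "\<lambda>n. U (r n)", OF U r(2) _ AE]) (use r(3) in \<open>simp add: o_def\<close>)
  have "weak_conv_m U U'"
  proof (rule tight_subseq_weak_converge[OF U r(2) tight])
    fix s W
    assume W: "strict_mono s" "real_distribution W" "weak_conv_m (U \<circ> s) W"
    have W_AE: "AE x in W. x \<in> {0..1}"
      by (rule weak_limit_unit_law[of "\<lambda>n. U (s n)", OF U W(2) W(3)[unfolded o_def] AE])
    have "W = U'"
    proof (rule moments_determine_unit_law[OF W(2) r(2) W_AE U'_AE])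
      fix k
      show "(\<integral>x. x ^ k \<partial>W) = (\<integral>x. x ^ k \<partial>U')"
        using lim[OF W] lim[OF r(1,2)] r(3) by simp
    qed
    with W show "weak_conv_m (U \<circ> s) U'" by simp
  qed
  with that r(2) U'_AE show ?thesis by blast
qed

text \<open>Under \<open>x \<mapsto> exp (- x)\<close> the values of the Laplace transform at the natural numbers become the
  moments of a law on the unit interval.\<close>

lemma laplace_determines_law:
  fixes D\<^sub>1 D\<^sub>2 :: "real measure"
  assumes D: "real_distribution D\<^sub>1" "real_distribution D\<^sub>2"
    and AE: "AE x in D\<^sub>1. 0 \<le> x" "AE x in D\<^sub>2. 0 \<le> x"
    and laplace: "\<And>z. 0 < z \<Longrightarrow> (\<integral>x. exp (- z * x) \<partial>D\<^sub>1) = (\<integral>x. exp (- z * x) \<partial>D\<^sub>2)"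
  shows "D\<^sub>1 = D\<^sub>2"
proof -
  interpret D1: real_distribution D\<^sub>1 by fact
  interpret D2: real_distribution D\<^sub>2 by fact
  let ?U = "\<lambda>D. distr D borel (\<lambda>x. exp (- x) :: real)"
  have "?U D\<^sub>1 = ?U D\<^sub>2"
  proof (rule moments_determine_unit_law)
    fix n :: nat
    have pow: "exp (- x) ^ n = exp (- real n * x)" for x :: real
      by (simp add: exp_of_nat_mult[symmetric])
    show "(\<integral>x. x ^ n \<partial>?U D\<^sub>1) = (\<integral>x. x ^ n \<partial>?U D\<^sub>2)"
    proof (cases "n = 0")
      case False
      then show ?thesis
        using laplace[of "real n"] by (simp add: integral_distr pow del: exp_of_nat_mult)
    qed (use D1.prob_space D2.prob_space in \<open>simp add: measure_distr\<close>)
  qed (use AE in \<open>auto simp: AE_distr_iff\<close>)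
  then have "distr (?U D\<^sub>1) borel (\<lambda>u. - ln u) = distr (?U D\<^sub>2) borel (\<lambda>u. - ln u)" by simp
  then have "distr D\<^sub>1 borel (\<lambda>x. x) = distr D\<^sub>2 borel (\<lambda>x. x)"
    by (simp add: distr_distr o_def)
  then show ?thesis
    by (simp add: distr_id2)
qed

text \<open>The limit is found among the laws of \<open>exp (- X)\<close>, where compactness is free. The condition on \<open>\<phi>\<close>
  at 0 excludes mass at \<open>exp (- \<infinity>) = 0\<close>.\<close>

lemma laplace_continuity:
  fixes D :: "nat \<Rightarrow> real measure"
  assumes D: "\<And>n. real_distribution (D n)" "\<And>n. AE x in D n. 0 \<le> x"
    and laplace: "\<And>z. 0 < z \<Longrightarrow> (\<lambda>n. \<integral>x. exp (- z * x) \<partial>D n) \<longlonglongrightarrow> \<phi> z"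
    and tends_1: "(\<phi> \<longlongrightarrow> 1) (at_right 0)"
  obtains D' where "real_distribution D'" "AE x in D'. 0 \<le> x"
    "\<And>z. 0 < z \<Longrightarrow> (\<integral>x. exp (- z * x) \<partial>D') = \<phi> z"
    "\<And>x. measure D' {x} = 0 \<Longrightarrow> (\<lambda>n. cdf (D n) x) \<longlonglongrightarrow> cdf D' x"
proof -
  define U where "U n = distr (D n) borel (\<lambda>x. exp (- x) :: real)" for n
  have U: "real_distribution (U n)" for n
  proof -
    interpret real_distribution "D n" by (rule D)
    show ?thesis unfolding U_def by (rule real_distribution_distr) simp
  qed
  have U_AE: "AE x in U n. x \<in> {0..1}" for n
  proof -
    interpret real_distribution "D n" by (rule D)
    show ?thesis unfolding U_def using D(2) by (auto simp: AE_distr_iff)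
  qed
  have U_powr: "(\<integral>x. unit_clamp x powr z \<partial>U n) = (\<integral>x. exp (- z * x) \<partial>D n)" if "0 < z" for z n
  proof -
    interpret real_distribution "D n" by (rule D)
    have "(\<integral>x. unit_clamp x powr z \<partial>U n) = (\<integral>x. unit_clamp (exp (- x)) powr z \<partial>D n)"
      unfolding U_def unit_clamp_def by (subst integral_distr) auto
    also have "AE x in D n. unit_clamp (exp (- x)) powr z = exp (- z * x)"
      using D(2)[of n] by eventually_elim (simp add: unit_clamp_id powr_def)
    then have "(\<integral>x. unit_clamp (exp (- x)) powr z \<partial>D n) = (\<integral>x. exp (- z * x) \<partial>D n)"
      unfolding unit_clamp_def by (intro integral_cong_AE) auto
    finally show ?thesis .
  qed
  have U_moments: "(\<lambda>n. \<integral>x. x ^ k \<partial>U n) \<longlonglongrightarrow> (if k = 0 then 1 else \<phi> (real k))" for k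
  proof (cases "k = 0")
    case True
    have "measure (U n) (space (U n)) = 1" for n
      using U[of n] unfolding real_distribution_def by (simp add: prob_space.prob_space)
    with True show ?thesis by simp
  next
    case False
    have "(\<integral>x. x ^ k \<partial>U n) = (\<integral>x. exp (- real k * x) \<partial>D n)" for n
    proof -
      interpret real_distribution "D n" by (rule D)
      show ?thesis unfolding U_def
        by (subst integral_distr) (auto simp: exp_of_nat_mult[symmetric])
    qed
    with False laplace[of "real k"] show ?thesis by simp
  qed
  obtain U' where U': "real_distribution U'" "AE x in U'. x \<in> {0..1}" "weak_conv_m U U'"
    using unit_law_convergence[OF U U_AE U_moments] .
  interpret U': real_distribution U' by (rule U')
  have U'_powr: "(\<integral>x. unit_clamp x powr z \<partial>U') = \<phi> z" if "0 < z" for z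
  proof (rule LIMSEQ_unique)
    show "(\<lambda>n. \<integral>x. unit_clamp x powr z \<partial>U n) \<longlonglongrightarrow> (\<integral>x. unit_clamp x powr z \<partial>U')"
      using that unit_clamp_bounds
      by (intro weak_conv_imp_integral_bdd_continuous_conv[where B=1] U U' isCont_unit_clamp_powr)
         (auto intro!: powr_le1)
    show "(\<lambda>n. \<integral>x. unit_clamp x powr z \<partial>U n) \<longlonglongrightarrow> \<phi> z"
      using laplace[OF that] that by (simp add: U_powr)
  qed
  \<comment> \<open>No mass escapes to infinity, i.e. to the point 0 of the unit interval.\<close>
  have "measure U' {x. 0 < unit_clamp x} \<ge> \<phi> z" if "0 < z" for z
  proof -
    have "(\<integral>x. unit_clamp x powr z \<partial>U') \<le> (\<integral>x. indicator {x. 0 < unit_clamp x} x \<partial>U')"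
      using that unit_clamp_bounds
      by (intro integral_mono U'.integrable_const_bound[where B=1])
         (auto simp: indicator_def unit_clamp_def intro!: powr_le1)
    with U'_powr[OF that] show ?thesis by (simp add: unit_clamp_def)
  qed
  then have "measure U' {x. 0 < unit_clamp x} \<ge> 1"
    using tends_1
    by (intro tendsto_upperbound[OF tends_1]) (auto simp: eventually_at_right_less intro!: eventually_at_rightI[of 0 1])
  then have "measure U' {x. 0 < unit_clamp x} = 1"
    using U'.prob_le_1[of "{x. 0 < unit_clamp x}"] by linarith
  moreover have "{x. 0 < unit_clamp x} \<in> sets borel" unfolding unit_clamp_def by measurable
  ultimately have "AE x in U'. 0 < unit_clamp x"
    by (subst (asm) U'.prob_eq_1) auto
  with U'(2) have U'_pos: "AE x in U'. 0 < x \<and> x \<le> 1"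
    by eventually_elim (auto simp: unit_clamp_def)
  define D' where "D' = distr U' borel (\<lambda>u. - ln u)"
  show thesis
  proof
    show D': "real_distribution D'"
      unfolding D'_def by (rule U'.real_distribution_distr) simp
    show "AE x in D'. 0 \<le> x"
      unfolding D'_def using U'_pos by (subst AE_distr_iff) auto
    show "(\<integral>x. exp (- z * x) \<partial>D') = \<phi> z" if "0 < z" for z
    proof -
      have "AE x in U'. exp (- z * (- ln x)) = unit_clamp x powr z"
        using U'_pos by eventually_elim (auto simp: unit_clamp_id powr_def)
      then have "(\<integral>x. exp (- z * (- ln x)) \<partial>U') = (\<integral>x. unit_clamp x powr z \<partial>U')"
        unfolding unit_clamp_def by (intro integral_cong_AE) auto
      with U'_powr[OF that] show ?thesis
        unfolding D'_def by (subst integral_distr) auto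
    qed
    show "(\<lambda>n. cdf (D n) x) \<longlonglongrightarrow> cdf D' x" if "measure D' {x} = 0" for x
    proof -
      have vimage_ln: "(\<lambda>u::real. - ln u) -` A \<in> sets borel" if "A \<in> sets borel" for A
        by (rule measurable_sets_borel[OF _ that]) simp
      have U'_measure: "measure D' A = measure U' ((\<lambda>u. - ln u) -` A)" if "A \<in> sets borel" for A
        unfolding D'_def using that by (subst measure_distr) auto
      have "cdf (D n) x = measure (U n) {exp (- x)..}" for n
      proof -
        interpret real_distribution "D n" by (rule D)
        have "(\<lambda>x. exp (- x)) -` {exp (- x)..} = {..x}" by auto
        then show ?thesis unfolding U_def cdf_def by (subst measure_distr) auto
      qed
      moreover have "cdf D' x = measure U' {exp (- x)..}"
      proof -
        have "AE u in U'. (u \<in> (\<lambda>u. - ln u) -` {..x}) = (u \<in> {exp (- x)..})"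
          using U'_pos
        proof eventually_elim
          fix u :: real assume "0 < u \<and> u \<le> 1"
          then show "(u \<in> (\<lambda>u. - ln u) -` {..x}) = (u \<in> {exp (- x)..})"
            using ln_ge_iff[of u "- x"] by auto
        qed
        then show ?thesis
          unfolding cdf_def U'_measure[OF atMost_borel]
          by (rule measure_eq_AE) (subst U'.events_eq_borel, intro vimage_ln atMost_borel atLeast_borel)+
      qed
      moreover have "(\<lambda>n. measure (U n) {exp (- x)..}) \<longlonglongrightarrow> measure U' {exp (- x)..}"
      proof (rule weak_conv_imp_continuity_set_conv[OF U U'(1,3)])
        have fr: "frontier {exp (- x)..} = {exp (- x)}"
          by (auto simp: frontier_def interior_real_atLeast)
        have "measure U' {exp (- x)} \<le> measure U' ((\<lambda>u. - ln u) -` {x})"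
          by (rule U'.finite_measure_mono, simp, subst U'.events_eq_borel, rule vimage_ln) simp
        also have "\<dots> = 0" using that U'_measure[of "{x}"] by simp
        finally show "emeasure U' (frontier {exp (- x)..}) = 0"
          by (simp add: U'.emeasure_eq_measure measure_le_0_iff fr)
      qed simp
      ultimately show ?thesis by simp
    qed
  qed
qed


text \<open>If \<open>X\<close> and \<open>X'\<close> are independent with law \<open>D\<close> and \<open>B\<close> is an independent Bernoulli variable with
  mean \<open>1 - c\<^sup>\<alpha>\<close>, then \<open>c X + B X'\<close> has law \<open>D\<close> again, because
  \<open>(c\<^sup>\<alpha> + (1 - c\<^sup>\<alpha>) / (1 + z\<^sup>\<alpha>)) / (1 + (c z)\<^sup>\<alpha>) = 1 / (1 + z\<^sup>\<alpha>)\<close>. An atom of nearly maximal mass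
  at \<open>x \<noteq> 0\<close> would therefore force atoms at \<open>x / c\<close> for uncountably many \<open>c\<close>. There is no atom at 0,
  because the Laplace transform vanishes at infinity.\<close>

lemma linnik_atomless:
  fixes D :: "real measure"
  assumes D: "real_distribution D" "AE x in D. 0 \<le> x"
    and \<alpha>: "0 < \<alpha>"
    and laplace: "\<And>z. 0 < z \<Longrightarrow> (\<integral>x. exp (- z * x) \<partial>D) = 1 / (1 + z powr \<alpha>)"
  shows "measure D {a} = 0"
proof -
  interpret D: real_distribution D by fact
  have nn_laplace: "(\<integral>\<^sup>+x. ennreal (exp (- z * x)) \<partial>D) = ennreal (1 / (1 + z powr \<alpha>))" if "0 < z" for z
  proof -
    have "1 / (1 + z powr \<alpha>) \<noteq> 0"
      by (metis add_nonneg_pos divide_eq_0_iff less_irrefl powr_ge_zero zero_less_one add.commute zero_neq_one)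
    then have "integrable D (\<lambda>x. exp (- z * x))"
      using not_integrable_integral_eq laplace[OF that] by metis
    with laplace[OF that] show ?thesis
      by (subst nn_integral_eq_integral) auto
  qed
  \<comment> \<open>The mass at \<open>a\<close> of \<open>c * X + B * X'\<close>, conditioned on \<open>B\<close> and, if \<open>B = 1\<close>, on \<open>X\<close>.\<close>
  have self: "measure D {a} \<le> c powr \<alpha> * measure D {a / c} + (1 - c powr \<alpha>) * m"
    if c: "0 < c" "c < 1" and m: "\<And>x. measure D {x} \<le> m" for c a m
  proof -
    define p where "p = 1 - c powr \<alpha>"
    have p: "0 \<le> p" "p \<le> 1" "1 - p = c powr \<alpha>"
      unfolding p_def using c \<alpha> by (auto intro!: powr_le1)
    define B where "B = measure_pmf (bernoulli_pmf p)"
    define P where "P = D \<Otimes>\<^sub>M (D \<Otimes>\<^sub>M B)"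
    interpret B: prob_space B unfolding B_def by (rule prob_space_measure_pmf)
    interpret DB: pair_prob_space D B ..
    interpret P: pair_prob_space D "D \<Otimes>\<^sub>M B" ..
    have sets_B[measurable_cong]: "sets B = sets (count_space UNIV)" by (simp add: B_def)
    define T where "T = (\<lambda>(x, y, b). c * x + (if b then y else 0 :: real))"
    have T[measurable]: "T \<in> borel_measurable P"
      unfolding T_def P_def by measurable
    define D' where "D' = distr P borel T"
    have D': "real_distribution D'"
      unfolding D'_def using T P.real_distribution_distr unfolding P_def by blast
    have nn_P: "(\<integral>\<^sup>+w. f (T w) \<partial>P) =
        (\<integral>\<^sup>+x. \<integral>\<^sup>+y. f (c * x + y) * ennreal p + f (c * x) * ennreal (c powr \<alpha>) \<partial>D \<partial>D)"
      if [measurable]: "f \<in> borel_measurable borel" for f :: "real \<Rightarrow> ennreal"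
    proof -
      have "(\<integral>\<^sup>+w. f (T w) \<partial>P) = (\<integral>\<^sup>+x. \<integral>\<^sup>+w. f (T (x, w)) \<partial>(D \<Otimes>\<^sub>M B) \<partial>D)"
        unfolding P_def by (rule DB.nn_integral_fst[symmetric]) (use T in \<open>simp add: P_def\<close>)
      also have "\<dots> = (\<integral>\<^sup>+x. \<integral>\<^sup>+y. \<integral>\<^sup>+b. f (T (x, y, b)) \<partial>B \<partial>D \<partial>D)"
      proof (intro nn_integral_cong)
        fix x
        have "(\<lambda>w. f (T (x, w))) \<in> borel_measurable (D \<Otimes>\<^sub>M B)"
          by (rule measurable_compose[OF measurable_Pair2[OF T[unfolded P_def]] that]) simp
        from B.nn_integral_fst[OF this]
        show "(\<integral>\<^sup>+w. f (T (x, w)) \<partial>(D \<Otimes>\<^sub>M B)) = (\<integral>\<^sup>+y. \<integral>\<^sup>+b. f (T (x, y, b)) \<partial>B \<partial>D)" by simp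
      qed
      finally show ?thesis
        using p by (simp add: B_def T_def nn_integral_bernoulli_pmf)
    qed
    have D'_emeasure: "emeasure D' A = (\<integral>\<^sup>+w. indicator A (T w) \<partial>P)"
      if [measurable]: "A \<in> sets borel" for A
    proof -
      have "emeasure D' A = (\<integral>\<^sup>+x. indicator A x \<partial>D')"
        by (rule nn_integral_indicator[symmetric]) (simp add: D'_def)
      also have "\<dots> = (\<integral>\<^sup>+w. indicator A (T w) \<partial>P)"
        unfolding D'_def by (rule nn_integral_distr) simp_all
      finally show ?thesis .
    qed
    have "D' = D"
    proof (rule laplace_determines_law[OF D' D(1) _ D(2)])
      have "emeasure D' {..<0} = (\<integral>\<^sup>+w. indicator {..<0} (T w) \<partial>P)"
        by (rule D'_emeasure) simp
      also have "\<dots> = (\<integral>\<^sup>+x. \<integral>\<^sup>+y. 0 \<partial>D \<partial>D)"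
        unfolding nn_P[OF borel_measurable_indicator[OF lessThan_borel]]
      proof (rule nn_integral_cong_AE)
        show "AE x in D. (\<integral>\<^sup>+y. indicator {..<0} (c * x + y) * ennreal p
            + indicator {..<0} (c * x) * ennreal (c powr \<alpha>) \<partial>D) = (\<integral>\<^sup>+y. 0 \<partial>D)"
          using D(2)
        proof eventually_elim
          case (elim x)
          then have "0 \<le> c * x" using c by simp
          from D(2) show ?case
            by (intro nn_integral_cong_AE, eventually_elim)
               (use \<open>0 \<le> c * x\<close> in \<open>auto simp: indicator_def\<close>)
        qed
      qed
      finally show "AE x in D'. 0 \<le> x"
        by (intro AE_I[of _ _ "{..<0}"]) (auto simp: D'_def)
      fix z :: real assume z: "0 < z"
      define u v where "u = 1 / (1 + (z * c) powr \<alpha>)" and "v = 1 / (1 + z powr \<alpha>)"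
      have uv: "0 \<le> u" "0 \<le> v"
        unfolding u_def v_def by (auto intro!: divide_nonneg_nonneg add_nonneg_nonneg)
      have "(\<integral>\<^sup>+x. ennreal (exp (- z * x)) \<partial>D') = (\<integral>\<^sup>+w. ennreal (exp (- z * T w)) \<partial>P)"
        unfolding D'_def by (subst nn_integral_distr) auto
      also have "\<dots> = (\<integral>\<^sup>+x. \<integral>\<^sup>+y. ennreal (exp (- (z * c) * x)) *
           (ennreal (exp (- z * y)) * ennreal p + ennreal (c powr \<alpha>)) \<partial>D \<partial>D)"
      proof (subst nn_P, simp, intro nn_integral_cong)
        fix x y
        have "exp (- z * (c * x + y)) = exp (- (z * c) * x) * exp (- z * y)"
          "exp (- z * (c * x)) = exp (- (z * c) * x)"
          by (simp_all add: exp_add[symmetric] algebra_simps)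
        then show "ennreal (exp (- z * (c * x + y))) * ennreal p + ennreal (exp (- z * (c * x))) * ennreal (c powr \<alpha>)
          = ennreal (exp (- (z * c) * x)) * (ennreal (exp (- z * y)) * ennreal p + ennreal (c powr \<alpha>))"
          by (simp only: ennreal_mult' exp_ge_zero distrib_left mult.assoc)
      qed
      also have "\<dots> = (\<integral>\<^sup>+x. ennreal (exp (- (z * c) * x)) * ennreal (v * p + c powr \<alpha>) \<partial>D)"
      proof (intro nn_integral_cong)
        fix x
        have "(\<integral>\<^sup>+y. ennreal (exp (- z * y)) * ennreal p + ennreal (c powr \<alpha>) \<partial>D)
            = ennreal v * ennreal p + ennreal (c powr \<alpha>)"
          by (subst nn_integral_add, simp, simp, subst nn_integral_multc, simp)
             (use nn_laplace[OF z] D.emeasure_space_1 in \<open>simp add: v_def\<close>)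
        also have "\<dots> = ennreal (v * p + c powr \<alpha>)"
          using uv p by (simp add: ennreal_mult' ennreal_plus)
        finally show "(\<integral>\<^sup>+y. ennreal (exp (- (z * c) * x)) *
           (ennreal (exp (- z * y)) * ennreal p + ennreal (c powr \<alpha>)) \<partial>D) =
           ennreal (exp (- (z * c) * x)) * ennreal (v * p + c powr \<alpha>)"
          by (subst nn_integral_cmult) auto
      qed
      also have "\<dots> = ennreal u * ennreal (v * p + c powr \<alpha>)"
        using nn_laplace[of "z * c"] z c by (subst nn_integral_multc) (auto simp: u_def)
      also have "\<dots> = ennreal (u * (v * p + c powr \<alpha>))"
        using uv by (simp add: ennreal_mult')
      also have "u * (v * p + c powr \<alpha>) = v"
      proof -
        have "0 < 1 + z powr \<alpha>" "0 < 1 + (z * c) powr \<alpha>" by (auto intro: add_pos_nonneg)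
        moreover have "(z * c) powr \<alpha> = z powr \<alpha> * c powr \<alpha>"
          using z c by (simp add: powr_mult)
        ultimately show ?thesis unfolding u_def v_def p_def
          by (simp add: divide_simps) (simp add: algebra_simps)
      qed
      finally have "(\<integral>x. exp (- z * x) \<partial>D') = v"
        using uv by (subst integral_eq_nn_integral) (auto simp: D'_def)
      then show "(\<integral>x. exp (- z * x) \<partial>D') = (\<integral>x. exp (- z * x) \<partial>D)"
        using laplace[OF z] by (simp add: v_def)
    qed
    then have "emeasure D {a} = emeasure D' {a}" by simp
    also have "\<dots> = (\<integral>\<^sup>+w. indicator {a} (T w) \<partial>P)"
      by (rule D'_emeasure) simp
    also have "\<dots> = (\<integral>\<^sup>+x. \<integral>\<^sup>+y. indicator {a - c * x} y * ennreal p
        + indicator {a / c} x * ennreal (c powr \<alpha>) \<partial>D \<partial>D)"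
    proof -
      have eq: "indicator {a} (c * x + y) = (indicator {a - c * x} y :: ennreal)"
        "indicator {a} (c * x) = (indicator {a / c} x :: ennreal)" for x y
        using c by (auto simp: indicator_def field_simps)
      show ?thesis by (subst nn_P, simp, simp only: eq)
    qed
    also have "\<dots> = (\<integral>\<^sup>+x. emeasure D {a - c * x} * ennreal p
        + indicator {a / c} x * ennreal (c powr \<alpha>) \<partial>D)"
    proof (intro nn_integral_cong)
      fix x
      show "(\<integral>\<^sup>+y. indicator {a - c * x} y * ennreal p
          + indicator {a / c} x * ennreal (c powr \<alpha>) \<partial>D)
        = emeasure D {a - c * x} * ennreal p + indicator {a / c} x * ennreal (c powr \<alpha>)"
        by (subst nn_integral_add, simp, simp, subst nn_integral_multc, simp)
           (use D.emeasure_space_1 in simp)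
    qed
    also have "\<dots> \<le> (\<integral>\<^sup>+x. ennreal (m * p)
        + indicator {a / c} x * ennreal (c powr \<alpha>) \<partial>D)"
      using m p by (intro nn_integral_mono add_mono order_refl)
        (auto simp: D.emeasure_eq_measure ennreal_mult'[symmetric] intro!: ennreal_leI mult_right_mono)
    also have "\<dots> = ennreal (m * p) + emeasure D {a / c} * ennreal (c powr \<alpha>)"
      by (subst nn_integral_add, simp, simp, subst nn_integral_multc, simp)
         (use D.emeasure_space_1 in simp)
    also have "\<dots> = ennreal (m * p + measure D {a / c} * c powr \<alpha>)"
      using order_trans[OF measure_nonneg m[of 0]] p
      by (simp add: D.emeasure_eq_measure ennreal_mult'' ennreal_plus)
    finally have "ennreal (measure D {a}) \<le> ennreal (m * p + measure D {a / c} * c powr \<alpha>)"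
      by (simp add: D.emeasure_eq_measure)
    moreover have "0 \<le> m * p + measure D {a / c} * c powr \<alpha>"
      using order_trans[OF measure_nonneg m[of 0]] p by simp
    ultimately show ?thesis
      by (simp add: p_def mult.commute add.commute)
  qed
  have zero: "measure D {0} = 0"
  proof -
    have "measure D {0} \<le> 1 / (1 + z powr \<alpha>)" if "0 < z" for z
    proof -
      have "emeasure D {0} = (\<integral>\<^sup>+x. indicator {0} x \<partial>D)" by simp
      also have "\<dots> \<le> (\<integral>\<^sup>+x. ennreal (exp (- z * x)) \<partial>D)"
        by (intro nn_integral_mono) (auto simp: indicator_def)
      finally show ?thesis
        unfolding nn_laplace[OF that] by (simp add: D.emeasure_eq_measure add_nonneg_nonneg)
    qed
    moreover have "((\<lambda>z. 1 / (1 + z powr \<alpha>)) \<longlongrightarrow> 0) at_top"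
      using \<alpha> by real_asymp
    ultimately have "measure D {0} \<le> 0"
      by (intro tendsto_lowerbound) (auto intro: eventually_mono[OF eventually_gt_at_top[of 0]])
    then show ?thesis by (simp add: measure_le_0_iff)
  qed
  show ?thesis
  proof (rule ccontr)
    assume a: "measure D {a} \<noteq> 0"
    \<comment> \<open>The atom \<open>x\<close> is so close to the supremum \<open>m\<close> that \<open>self\<close> leaves positive mass at \<open>x / c\<close> for
      every \<open>c > 1 / 2\<close>; the constant \<open>k\<close> is the smallest value of \<open>c\<^sup>\<alpha>\<close> there.\<close>
    define m where "m = (SUP x. measure D {x})"
    have bdd: "bdd_above (range (\<lambda>x. measure D {x}))"
      by (rule bdd_aboveI[of _ 1]) auto
    have m: "measure D {x} \<le> m" for x
      unfolding m_def by (rule cSUP_upper[OF _ bdd]) simp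
    have m_pos: "0 < m" using m[of a] a measure_nonneg[of D "{a}"] by linarith
    define k where "k = (1 / 2) powr \<alpha>"
    have k: "0 < k" by (simp add: k_def)
    have "m * (1 - k / 2) < m" using m_pos k by (simp add: algebra_simps)
    then obtain x where x: "m * (1 - k / 2) < measure D {x}"
      unfolding m_def by (subst (asm) less_cSUP_iff[OF _ bdd]) auto
    have k1: "k \<le> 1" unfolding k_def using \<alpha> by (intro powr_le1) auto
    have "0 < m * (1 - k / 2)" using m_pos k1 by simp
    with x zero have "x \<noteq> 0" by force
    have "0 < measure D {x / c}" if c: "c \<in> {1 / 2<..<1}" for c
    proof (rule ccontr)
      assume "\<not> ?thesis"
      then have "measure D {x / c} = 0" using measure_nonneg[of D "{x / c}"] by linarith
      with self[of c m x] c m have "measure D {x} \<le> (1 - c powr \<alpha>) * m" by simp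
      also have "\<dots> \<le> (1 - k) * m"
        unfolding k_def using c \<alpha> m_pos by (intro mult_right_mono diff_left_mono powr_mono2) auto
      also have "\<dots> \<le> m * (1 - k / 2)" using m_pos k by (simp add: algebra_simps)
      finally show False using x by simp
    qed
    then have "(\<lambda>c. x / c) ` {1 / 2<..<1} \<subseteq> {y. 0 < measure D {y}}" by auto
    then have "countable ((\<lambda>c. x / c) ` {1 / 2<..<1})"
      using D.countable_atoms countable_subset by blast
    then have "countable {1 / 2<..<1::real}"
      using \<open>x \<noteq> 0\<close> by (elim countable_image_inj_on) (auto simp: inj_on_def)
    then show False using uncountable_open_interval[of "1 / 2 :: real" 1] by simp
  qed
qed

section \<open>Slow and regular variation\<close>

text \<open>The uniform convergence theorem in additive form. By continuity of Lebesgue measure, the shifts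
  \<open>v\<close> for which the increments from \<open>x\<^sub>n\<close> are small eventually fill most of \<open>{0..2}\<close>, and so do those
  for the increments from \<open>x\<^sub>n + u\<^sub>n\<close>; a common point of both sets bounds the increment from \<open>x\<^sub>n\<close>
  to \<open>x\<^sub>n + u\<^sub>n\<close>.\<close>

lemma uniform_increments:
  fixes h :: "real \<Rightarrow> real"
  assumes h[measurable]: "h \<in> borel_measurable borel"
    and lim: "\<And>u. ((\<lambda>x. h (x + u) - h x) \<longlongrightarrow> 0) at_top"
    and e: "0 < e"
  shows "\<exists>X. \<forall>x\<ge>X. \<forall>u\<in>{0..1}. \<bar>h (x + u) - h x\<bar> < e"
proof (rule ccontr)
  assume "\<not> ?thesis"
  then have "\<forall>n::nat. \<exists>x u. real n \<le> x \<and> u \<in> {0..1} \<and> e \<le> \<bar>h (x + u) - h x\<bar>"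
    by (meson not_less)
  then obtain x u where xu: "\<And>n::nat. real n \<le> x n" "\<And>n. u n \<in> {0..1}"
    "\<And>n. e \<le> \<bar>h (x n + u n) - h (x n)\<bar>"
    by metis
  define A where "A y n = {v\<in>{0..2}. \<forall>m\<ge>n. \<bar>h (y m + v) - h (y m)\<bar> < e / 2}" for y :: "nat \<Rightarrow> real" and n
  have A_sets[measurable]: "A y n \<in> sets borel" for y n
    unfolding A_def by measurable
  have A_lim: "\<forall>\<^sub>F n in sequentially. 3 / 2 < measure lborel (A y n)" if y: "\<And>n. real n \<le> y n" for y
  proof -
    have y_top: "filterlim y at_top sequentially"
      by (rule filterlim_at_top_mono[OF filterlim_real_sequentially]) (simp add: y)
    have "(\<Union>n. A y n) = {0..2}"
    proof safe
      fix v :: real assume v: "v \<in> {0..2}"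
      have "((\<lambda>m. h (y m + v) - h (y m)) \<longlongrightarrow> 0) sequentially"
        by (rule filterlim_compose[OF lim y_top])
      from tendstoD[OF this, of "e / 2"] e
      have "\<forall>\<^sub>F m in sequentially. \<bar>h (y m + v) - h (y m)\<bar> < e / 2"
        by (simp add: dist_real_def)
      then show "v \<in> (\<Union>n. A y n)"
        using v by (auto simp: A_def eventually_sequentially)
    qed (auto simp: A_def)
    moreover have "(\<lambda>n. measure lborel (A y n)) \<longlonglongrightarrow> measure lborel (\<Union>n. A y n)"
    proof (rule Lim_measure_incseq)
      show "incseq (A y)" by (auto simp: A_def incseq_def)
      show "emeasure lborel (\<Union>n. A y n) \<noteq> \<infinity>" unfolding calculation by simp
    qed auto
    ultimately have "(\<lambda>n. measure lborel (A y n)) \<longlonglongrightarrow> 2" by simp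
    from order_tendstoD(1)[OF this, of "3/2"] show ?thesis by simp
  qed
  have "\<forall>\<^sub>F n in sequentially. 3 / 2 < measure lborel (A x n) \<and> 3 / 2 < measure lborel (A (\<lambda>n. x n + u n) n)"
  proof (intro eventually_conj A_lim)
    show "real n \<le> x n + u n" for n using xu(1,2)[of n] by auto
  qed (rule xu)
  then obtain n where n: "3 / 2 < measure lborel (A x n)" "3 / 2 < measure lborel (A (\<lambda>n. x n + u n) n)"
    by (auto simp: eventually_sequentially)
  \<comment> \<open>Both sets have measure above \<open>3 / 2\<close> and, after the shift, lie in \<open>{0..3}\<close>; hence they meet.\<close>
  define B where "B = A (\<lambda>n. x n + u n) n"
  define C where "C = {w. w - u n \<in> B}"
  have [measurable]: "B \<in> sets borel" unfolding B_def by measurable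
  have C[measurable]: "C \<in> sets borel"
  proof -
    have "C = (\<lambda>w. w - u n) -` B" by (auto simp: C_def)
    also have "\<dots> \<in> sets borel" by (rule measurable_sets_borel[of _ borel]) auto
    finally show ?thesis .
  qed
  have "measure lborel C = measure (distr lborel borel ((+) (u n))) C"
    by (subst lborel_distr_plus) (rule refl)
  also have "\<dots> = measure lborel ((+) (u n) -` C)"
    by (subst measure_distr) auto
  also have "(+) (u n) -` C = B" by (auto simp: C_def)
  finally have meas_C: "3 / 2 < measure lborel C" using n(2) by (simp add: B_def)
  have sub: "A x n \<subseteq> {0..3}" "C \<subseteq> {0..3}"
    using xu(2)[of n] by (auto simp: A_def C_def B_def)
  have "A x n \<inter> C \<noteq> {}"
  proof
    assume disj: "A x n \<inter> C = {}"
    have I: "{0..3::real} \<in> fmeasurable lborel" by (rule fmeasurableI) auto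
    have fin: "A x n \<in> fmeasurable lborel" "C \<in> fmeasurable lborel"
      by (rule fmeasurableI2[OF I sub(1)], simp) (rule fmeasurableI2[OF I sub(2)], simp)
    have "measure lborel (A x n \<union> C) = measure lborel (A x n) + measure lborel C"
      using fin disj by (intro measure_Union) (simp_all add: fmeasurable_def)
    moreover have "measure lborel (A x n \<union> C) \<le> measure lborel {0..3::real}"
      using sub fin I by (intro measure_mono_fmeasurable) simp_all
    ultimately show False using n(1) meas_C by simp
  qed
  then obtain w where "w \<in> A x n" "w - u n \<in> B" by (auto simp: C_def)
  then have "\<bar>h (x n + w) - h (x n)\<bar> < e / 2" "\<bar>h (x n + w) - h (x n + u n)\<bar> < e / 2"
    by (auto simp: A_def B_def)
  with xu(3)[of n] show False by linarith
qed

lemma slowly_varying_uniform: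
  assumes L: "slowly_varying L" and k: "1 < k"
  obtains X where "0 < X" "\<And>x. X \<le> x \<Longrightarrow> 0 < L x"
    "\<And>x y. X \<le> x \<Longrightarrow> x \<le> y \<Longrightarrow> y \<le> 2 * x \<Longrightarrow> L y \<le> k * L x \<and> L x \<le> k * L y"
proof -
  obtain a where a: "set_borel_measurable borel {a..} L" "\<And>x. a \<le> x \<Longrightarrow> 0 < L x"
    and lim: "\<And>c. 0 < c \<Longrightarrow> ((\<lambda>x. L (c * x) / L x) \<longlongrightarrow> 1) at_top"
    using L by (auto simp: slowly_varying_def)
  define L' where "L' x = indicator {a..} x * L x" for x
  have [measurable]: "L' \<in> borel_measurable borel"
    using a(1) by (simp add: L'_def[abs_def] set_borel_measurable_def)
  define h where "h x = ln (L' (exp x))" for x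
  have "h \<in> borel_measurable borel" unfolding h_def by measurable
  moreover have "((\<lambda>x. h (x + u) - h x) \<longlongrightarrow> 0) at_top" for u
  proof -
    have "((\<lambda>x. ln (L (exp u * exp x) / L (exp x))) \<longlongrightarrow> ln 1) at_top"
      by (intro tendsto_ln filterlim_compose[OF lim exp_at_top]) auto
    moreover have "\<forall>\<^sub>F x in at_top. a \<le> exp x \<and> a \<le> exp (x + u)"
    proof (rule eventually_conj)
      show "\<forall>\<^sub>F x in at_top. a \<le> exp x"
        using exp_at_top by (simp add: filterlim_at_top)
      have "filterlim (\<lambda>x. exp (x + u)) at_top at_top"
        by (rule filterlim_compose[OF exp_at_top]) (simp add: filterlim_tendsto_add_at_top filterlim_at_top_add_at_top tendsto_const filterlim_ident add.commute[of _ u] filterlim_tendsto_add_at_top[OF tendsto_const filterlim_ident])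
      then show "\<forall>\<^sub>F x in at_top. a \<le> exp (x + u)"
        by (simp add: filterlim_at_top)
    qed
    then have "\<forall>\<^sub>F x in at_top. ln (L (exp u * exp x) / L (exp x)) = h (x + u) - h x"
    proof eventually_elim
      case (elim x)
      then show ?case
        using a(2)[of "exp x"] a(2)[of "exp (x + u)"]
        by (simp add: h_def L'_def ln_div exp_add[symmetric] add.commute)
    qed
    ultimately show ?thesis
      by (simp add: filterlim_cong[OF refl refl])
  qed
  ultimately obtain Y where Y: "\<And>x u. Y \<le> x \<Longrightarrow> u \<in> {0..1} \<Longrightarrow> \<bar>h (x + u) - h x\<bar> < ln k"
    using uniform_increments[of h "ln k"] k by (metis ln_gt_zero)
  show thesis
  proof
    define X where "X = max (exp Y) (max a 1)"
    show "0 < X" by (simp add: X_def)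
    show pos: "0 < L x" if "X \<le> x" for x using a(2) that by (simp add: X_def)
    fix x y assume xy: "X \<le> x" "x \<le> y" "y \<le> 2 * x"
    then have x0: "0 < x" "0 < y" and ax: "a \<le> x" "a \<le> y" using \<open>0 < X\<close> by (auto simp: X_def)
    have L0: "0 < L x" "0 < L y" using pos xy by auto
    have "x * 2 \<le> x * exp 1" using x0 exp_ge_add_one_self[of 1] by (intro mult_left_mono) auto
    with xy(3) have "y \<le> exp 1 * x" by (metis mult.commute order_trans)
    then have "y / x \<le> exp 1" using x0 by (simp only: pos_divide_le_eq)
    then have "ln (y / x) \<le> ln (exp 1)"
      using x0 by (subst ln_le_cancel_iff) auto
    moreover have "Y \<le> ln x" using xy x0 by (simp add: X_def ln_ge_iff)
    moreover have "0 \<le> ln (y / x)" using x0 xy by simp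
    ultimately have "\<bar>h (ln x + ln (y / x)) - h (ln x)\<bar> < ln k" by (intro Y) auto
    moreover have "ln x + ln (y / x) = ln y" using x0 by (simp add: ln_div)
    ultimately have "\<bar>ln (L y) - ln (L x)\<bar> < ln k" using x0 ax by (simp add: h_def L'_def)
    then have "ln (L y) \<le> ln (k * L x)" "ln (L x) \<le> ln (k * L y)"
      using k L0 by (auto simp: ln_mult)
    then show "L y \<le> k * L x \<and> L x \<le> k * L y" using k L0 by simp
  qed
qed

text \<open>Iterating the doubling inequality reaches every point from the first dyadic block.\<close>

lemma dyadic_power_bound:
  fixes G :: "real \<Rightarrow> real"
  assumes X: "0 < X" and B: "\<And>x. X \<le> x \<Longrightarrow> x \<le> 2 * X \<Longrightarrow> G x \<le> B"
    and double: "\<And>x. X \<le> x \<Longrightarrow> G (2 * x) \<le> 2 powr \<beta> * G x"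
  obtains C where "0 < C" "\<And>x. X \<le> x \<Longrightarrow> G x \<le> C * x powr \<beta>"
proof -
  \<comment> \<open>The sign of \<open>\<beta>\<close> is arbitrary, so the smallest value of \<open>x powr \<beta>\<close> on the first block lies at
    one of its ends.\<close>
  define m where "m = min (X powr \<beta>) ((2 * X) powr \<beta>)"
  define C where "C = (\<bar>B\<bar> + 1) / m"
  have m: "0 < m" using X by (simp add: m_def)
  have m_le: "m \<le> x powr \<beta>" if "X \<le> x" "x \<le> 2 * X" for x
  proof (cases "0 \<le> \<beta>")
    case True
    then have "X powr \<beta> \<le> x powr \<beta>" using X that by (intro powr_mono2) auto
    then show ?thesis by (simp add: m_def)
  next
    case False
    then have "(2 * X) powr \<beta> \<le> x powr \<beta>" using X that by (intro powr_mono2') auto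
    then show ?thesis by (simp add: m_def)
  qed
  have C: "0 < C" using m by (simp add: C_def)
  have "\<forall>x. X \<le> x \<and> x \<le> 2 ^ Suc n * X \<longrightarrow> G x \<le> C * x powr \<beta>" for n :: nat
  proof (induction n)
    case 0
    show ?case
    proof safe
      fix x assume x: "X \<le> x" "x \<le> 2 ^ Suc 0 * X"
      then have "G x \<le> C * m" using B[of x] m by (simp add: C_def)
      also have "\<dots> \<le> C * x powr \<beta>" using m_le[of x] x C by simp
      finally show "G x \<le> C * x powr \<beta>" .
    qed
  next
    case (Suc n)
    show ?case
    proof safe
      fix x assume x: "X \<le> x" "x \<le> 2 ^ Suc (Suc n) * X"
      show "G x \<le> C * x powr \<beta>"
      proof (cases "x \<le> 2 * X")
        case True
        have "2 * X \<le> 2 ^ Suc n * X" using X by simp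
        with True x Suc show ?thesis by auto
      next
        case False
        then have "G (2 * (x / 2)) \<le> 2 powr \<beta> * G (x / 2)" by (intro double) auto
        also have "\<dots> \<le> 2 powr \<beta> * (C * (x / 2) powr \<beta>)"
          using Suc x False by (intro mult_left_mono) auto
        also have "\<dots> = C * x powr \<beta>" using x X by (simp add: powr_divide)
        finally show ?thesis by simp
      qed
    qed
  qed
  moreover have "\<exists>n. x \<le> 2 ^ Suc n * X" for x
  proof -
    obtain n where "x / X < 2 ^ n" using real_arch_pow[of 2 "x / X"] by auto
    then have "x \<le> 2 ^ n * X" using X by (simp add: field_simps)
    moreover have "0 \<le> 2 ^ n * X" using X by simp
    ultimately have "x \<le> 2 ^ Suc n * X" by simp
    then show ?thesis ..
  qed
  ultimately show thesis using that[OF C] by blast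
qed

lemma slowly_varying_upper:
  assumes L: "slowly_varying L" and d: "0 < d"
  obtains X C where "0 < X" "0 < C" "\<And>x. X \<le> x \<Longrightarrow> 0 < L x"
    "\<And>x. X \<le> x \<Longrightarrow> L x \<le> C * x powr d"
proof -
  obtain X where X: "0 < X" "\<And>x. X \<le> x \<Longrightarrow> 0 < L x"
    "\<And>x y. X \<le> x \<Longrightarrow> x \<le> y \<Longrightarrow> y \<le> 2 * x \<Longrightarrow> L y \<le> 2 powr d * L x \<and> L x \<le> 2 powr d * L y"
    using slowly_varying_uniform[OF L, of "2 powr d"] d by (auto simp: powr_def)
  obtain C where "0 < C" "\<And>x. X \<le> x \<Longrightarrow> L x \<le> C * x powr d"
  proof (rule dyadic_power_bound[of X L "2 powr d * L X" d])
    show "L x \<le> 2 powr d * L X" if "X \<le> x" "x \<le> 2 * X" for x using X(3)[of X x] that by auto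
    show "L (2 * x) \<le> 2 powr d * L x" if "X \<le> x" for x using X(3)[of x "2 * x"] X(1) that by auto
  qed (use X that in auto)
  with X that show thesis by blast
qed

lemma slowly_varying_lower:
  assumes L: "slowly_varying L" and d: "0 < d"
  obtains X C where "0 < X" "0 < C" "\<And>x. X \<le> x \<Longrightarrow> 0 < L x"
    "\<And>x. X \<le> x \<Longrightarrow> C * x powr (- d) \<le> L x"
proof -
  obtain X where X: "0 < X" "\<And>x. X \<le> x \<Longrightarrow> 0 < L x"
    "\<And>x y. X \<le> x \<Longrightarrow> x \<le> y \<Longrightarrow> y \<le> 2 * x \<Longrightarrow> L y \<le> 2 powr d * L x \<and> L x \<le> 2 powr d * L y"
    using slowly_varying_uniform[OF L, of "2 powr d"] d by (auto simp: powr_def)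
  obtain C where C: "0 < C" "\<And>x. X \<le> x \<Longrightarrow> 1 / L x \<le> C * x powr d"
  proof (rule dyadic_power_bound[of X "\<lambda>x. 1 / L x" "2 powr d / L X" d])
    show "1 / L x \<le> 2 powr d / L X" if "X \<le> x" "x \<le> 2 * X" for x
      using X(3)[of X x] X(2)[of x] X(2)[of X] that by (auto simp: field_simps)
    show "1 / L (2 * x) \<le> 2 powr d * (1 / L x)" if "X \<le> x" for x
      using X(3)[of x "2 * x"] X(2)[of x] X(2)[of "2 * x"] X(1) that by (auto simp: field_simps)
  qed (use X that in auto)
  have "1 / C * x powr (- d) \<le> L x" if "X \<le> x" for x
    using C X(2)[OF that] X(1) that C(2)[OF that] by (simp add: powr_minus field_simps)
  with X C(1) that[of X "1 / C"] show thesis by simp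
qed

definition regularly_varying :: "(real \<Rightarrow> real) \<Rightarrow> real \<Rightarrow> bool" where
  "regularly_varying H \<rho> \<longleftrightarrow> (\<forall>\<^sub>F x in at_top. 0 < H x) \<and>
     (\<forall>c>0. ((\<lambda>x. H (c * x) / H x) \<longlongrightarrow> c powr \<rho>) at_top)"

lemma regularly_varying_inverse:
  assumes "regularly_varying H \<rho>" shows "regularly_varying (\<lambda>x. 1 / H x) (- \<rho>)"
proof -
  have "((\<lambda>x. 1 / H (c * x) / (1 / H x)) \<longlongrightarrow> c powr - \<rho>) at_top" if "0 < c" for c
  proof -
    have "((\<lambda>x. 1 / (H (c * x) / H x)) \<longlongrightarrow> 1 / c powr \<rho>) at_top"
      using assms that by (intro tendsto_intros) (auto simp: regularly_varying_def)
    then show ?thesis by (simp add: powr_minus field_simps)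
  qed
  then show ?thesis using assms by (auto simp: regularly_varying_def)
qed

lemma regularly_varying_power_bound:
  assumes rv: "regularly_varying H \<rho>" and \<beta>: "\<rho> < \<beta>"
    and bdd: "\<And>b. \<exists>B. \<forall>x\<in>{a..b}. H x \<le> B"
  obtains X C where "0 < X" "0 < C" "\<And>x. X \<le> x \<Longrightarrow> 0 < H x \<and> H x \<le> C * x powr \<beta>"
proof -
  have "((\<lambda>x. H (2 * x) / H x) \<longlongrightarrow> 2 powr \<rho>) at_top" using rv by (simp add: regularly_varying_def)
  from order_tendstoD(2)[OF this, of "2 powr \<beta>"] \<beta>
  have "\<forall>\<^sub>F x in at_top. H (2 * x) / H x < 2 powr \<beta>" by simp
  moreover have "\<forall>\<^sub>F x in at_top. 0 < H x" using rv by (simp add: regularly_varying_def)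
  ultimately have "\<forall>\<^sub>F x in at_top. H (2 * x) \<le> 2 powr \<beta> * H x \<and> 0 < H x"
    by eventually_elim (simp add: field_simps)
  then obtain X0 where X0: "\<And>x. X0 \<le> x \<Longrightarrow> H (2 * x) \<le> 2 powr \<beta> * H x \<and> 0 < H x"
    by (auto simp: eventually_at_top_linorder)
  define X where "X = max (max X0 a) 1"
  obtain B where B: "\<And>x. x \<in> {a..2 * X} \<Longrightarrow> H x \<le> B" using bdd[of "2 * X"] by blast
  obtain C where "0 < C" "\<And>x. X \<le> x \<Longrightarrow> H x \<le> C * x powr \<beta>"
  proof (rule dyadic_power_bound[of X H B \<beta>])
    show "H x \<le> B" if "X \<le> x" "x \<le> 2 * X" for x using B that by (auto simp: X_def)
    show "H (2 * x) \<le> 2 powr \<beta> * H x" if "X \<le> x" for x using X0[of x] that by (auto simp: X_def)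
  qed (use that in \<open>auto simp: X_def\<close>)
  then show thesis using X0 that[of X C] by (auto simp: X_def)
qed

text \<open>For monotone functions convergence at fixed multiples is automatically locally uniform in the
  multiple.\<close>

lemma regularly_varying_mono_limit:
  assumes rv: "regularly_varying H \<rho>" and \<rho>: "0 \<le> \<rho>" and mono: "mono_on {a..} H"
    and f: "(f \<longlongrightarrow> c) F" "0 < c" and g: "filterlim g at_top F"
  shows "((\<lambda>t. H (f t * g t) / H (g t)) \<longlongrightarrow> c powr \<rho>) F"
proof -
  have rv_lim: "((\<lambda>t. H (b * g t) / H (g t)) \<longlongrightarrow> b powr \<rho>) F" if "0 < b" for b
    using rv that by (auto simp: regularly_varying_def intro: filterlim_compose[OF _ g])
  have g_top: "\<forall>\<^sub>F t in F. y \<le> g t" "\<forall>\<^sub>F t in F. y < g t" for y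
    using g filterlim_at_top[of g F] filterlim_at_top_dense[of g F] by blast+
  have g_ev: "\<forall>\<^sub>F t in F. a / b \<le> g t \<and> 0 < g t \<and> 0 < H (g t)" if "0 < b" for b
  proof (intro eventually_conj)
    show "\<forall>\<^sub>F t in F. 0 < H (g t)"
      using rv by (auto simp: regularly_varying_def intro: eventually_compose_filterlim[OF _ g])
  qed (rule g_top)+
  have cont: "((\<lambda>b. b powr \<rho>) \<longlongrightarrow> c powr \<rho>) (at c within S)" for S
    using f(2) by (intro tendsto_intros) auto
  show ?thesis
  proof (rule order_tendstoI)
    fix y assume y: "y < c powr \<rho>"
    have "\<forall>\<^sub>F b in at_left c. y < b powr \<rho> \<and> 0 < b \<and> b < c"
      by (rule eventually_conj[OF order_tendstoD(1)[OF cont y]]) (rule eventually_at_leftI[of 0 c], use f(2) in auto)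
    then obtain b where b: "y < b powr \<rho>" "0 < b" "b < c"
      by (metis (mono_tags, lifting) eventually_happens trivial_limit_at_left_real)
    show "\<forall>\<^sub>F t in F. y < H (f t * g t) / H (g t)"
      using order_tendstoD(1)[OF rv_lim[OF b(2)] b(1)] g_ev[OF b(2)] order_tendstoD(1)[OF f(1) b(3)]
    proof eventually_elim
      case (elim t)
      have "H (b * g t) \<le> H (f t * g t)"
      proof (rule mono_onD[OF mono])
        show "b * g t \<in> {a..}" using elim b by (simp add: field_simps)
        show "b * g t \<le> f t * g t" using elim by simp
        with \<open>b * g t \<in> {a..}\<close> show "f t * g t \<in> {a..}" by simp
      qed
      then have "H (b * g t) / H (g t) \<le> H (f t * g t) / H (g t)"
        using elim by (intro divide_right_mono) auto
      with elim show ?case by simp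
    qed
  next
    fix y assume y: "c powr \<rho> < y"
    have "\<forall>\<^sub>F b in at_right c. b powr \<rho> < y \<and> c < b"
      by (rule eventually_conj[OF order_tendstoD(2)[OF cont y] eventually_at_right_less])
    then obtain b where b: "b powr \<rho> < y" "c < b"
      by (metis (mono_tags, lifting) eventually_happens trivial_limit_at_right_real)
    have b0: "0 < b" "0 < c / 2" "c / 2 < c" using b f(2) by auto
    show "\<forall>\<^sub>F t in F. H (f t * g t) / H (g t) < y"
      using order_tendstoD(2)[OF rv_lim[OF b0(1)] b(1)] g_ev[OF b0(2)] order_tendstoD(2)[OF f(1) b(2)]
        order_tendstoD(1)[OF f(1) b0(3)]
    proof eventually_elim
      case (elim t)
      have "H (f t * g t) \<le> H (b * g t)"
      proof (rule mono_onD[OF mono])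
        have "c / 2 * g t \<le> f t * g t" using elim by simp
        moreover have "a \<le> c / 2 * g t" using elim b0 by (simp add: field_simps)
        ultimately show "f t * g t \<in> {a..}" by simp
        show "f t * g t \<le> b * g t" using elim by simp
        with \<open>f t * g t \<in> {a..}\<close> show "b * g t \<in> {a..}" by simp
      qed
      then have "H (f t * g t) / H (g t) \<le> H (b * g t) / H (g t)"
        using elim by (intro divide_right_mono) auto
      with elim show ?case by simp
    qed
  qed
qed

lemma regularly_varying_compose:
  assumes H: "regularly_varying H \<rho>" "0 \<le> \<rho>" "mono_on {a..} H"
    and W: "regularly_varying W \<sigma>" "filterlim W at_top at_top"
  shows "regularly_varying (\<lambda>x. H (W x)) (\<rho> * \<sigma>)"
  unfolding regularly_varying_def
proof (intro conjI allI impI)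
  show "\<forall>\<^sub>F x in at_top. 0 < H (W x)"
    using H(1) by (auto simp: regularly_varying_def intro: eventually_compose_filterlim[OF _ W(2)])
  fix c :: real assume c: "0 < c"
  have "((\<lambda>t. H (W (c * t) / W t * W t) / H (W t)) \<longlongrightarrow> (c powr \<sigma>) powr \<rho>) at_top"
    using W c by (intro regularly_varying_mono_limit[OF H _ _ W(2)]) (auto simp: regularly_varying_def)
  moreover have "\<forall>\<^sub>F t in at_top. 0 < W t" using W(1) by (simp add: regularly_varying_def)
  then have "\<forall>\<^sub>F t in at_top. H (W (c * t) / W t * W t) / H (W t) = H (W (c * t)) / H (W t)"
    by eventually_elim simp
  ultimately have "((\<lambda>x. H (W (c * x)) / H (W x)) \<longlongrightarrow> (c powr \<sigma>) powr \<rho>) at_top"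
    by (rule Lim_transform_eventually)
  then show "((\<lambda>x. H (W (c * x)) / H (W x)) \<longlongrightarrow> c powr (\<rho> * \<sigma>)) at_top"
    by (simp add: powr_powr mult.commute)
qed

text \<open>For \<open>b < c\<^bsup>1/\<gamma>\<^esup>\<close> eventually \<open>V (b * W y) < c * y = V (W (c * y))\<close>, so that \<open>b * W y < W (c * y)\<close>;
  likewise above.\<close>

lemma regularly_varying_right_inverse:
  assumes V: "regularly_varying V \<gamma>" "0 < \<gamma>" "mono_on {a..} V"
    and W: "\<And>y. 0 \<le> y \<Longrightarrow> a \<le> W y \<and> V (W y) = y" "filterlim W at_top at_top"
  shows "regularly_varying W (1 / \<gamma>)"
  unfolding regularly_varying_def
proof (intro conjI allI impI)
  show W_pos: "\<forall>\<^sub>F x in at_top. 0 < W x" using W(2) by (auto simp: filterlim_at_top_dense)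
  fix c :: real assume c: "0 < c"
  have V_lim: "((\<lambda>y. V (b * W y) / V (W y)) \<longlongrightarrow> b powr \<gamma>) at_top" if "0 < b" for b
    using V(1) that by (auto simp: regularly_varying_def intro: filterlim_compose[OF _ W(2)])
  have W_ev: "\<forall>\<^sub>F y in at_top. a / b \<le> W y" for b using W(2) by (auto simp: filterlim_at_top)
  show "((\<lambda>x. W (c * x) / W x) \<longlongrightarrow> c powr (1 / \<gamma>)) at_top"
  proof (rule order_tendstoI)
    fix b assume b: "b < c powr (1 / \<gamma>)"
    show "\<forall>\<^sub>F x in at_top. b < W (c * x) / W x"
    proof (cases "0 < b")
      case False
      have "\<forall>\<^sub>F x in at_top. 0 < W (c * x)"
        using c W_pos eventually_compose_filterlim[of "\<lambda>x. 0 < W x" at_top "\<lambda>x. c * x" at_top]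
        by (simp add: filterlim_tendsto_pos_mult_at_top[OF tendsto_const _ filterlim_ident])
      with W_pos show ?thesis
      proof eventually_elim
        case (elim x)
        then have "0 < W (c * x) / W x" by simp
        with False show ?case by linarith
      qed
    next
      case True
      have "b powr \<gamma> < (c powr (1 / \<gamma>)) powr \<gamma>" using True b V(2) by (intro powr_less_mono2) auto
      then have "b powr \<gamma> < c" using c V(2) by (simp add: powr_powr)
      from order_tendstoD(2)[OF V_lim[OF True] this]
        eventually_gt_at_top[of 0] W_pos W_ev[of b]
      show ?thesis
      proof eventually_elim
        case (elim y)
        then have "V (b * W y) < c * y" using W(1)[of y] by (simp add: field_simps)
        also have "\<dots> = V (W (c * y))" using W(1)[of "c * y"] elim c by simp
        finally have "b * W y < W (c * y)"
          using mono_onD[OF V(3), of "W (c * y)" "b * W y"] W(1)[of "c * y"] elim c True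
          by (force simp: field_simps not_less)
        then show ?case using elim by (simp add: field_simps)
      qed
    qed
  next
    fix b assume b: "c powr (1 / \<gamma>) < b"
    have b0: "0 < b" using b c by (metis less_trans powr_gt_zero less_irrefl)
    have "(c powr (1 / \<gamma>)) powr \<gamma> < b powr \<gamma>" using b V(2) by (intro powr_less_mono2) auto
    then have "c < b powr \<gamma>" using c V(2) by (simp add: powr_powr)
    from order_tendstoD(1)[OF V_lim[OF b0] this]
      eventually_gt_at_top[of 0] W_pos W_ev[of b]
    show "\<forall>\<^sub>F x in at_top. W (c * x) / W x < b"
    proof eventually_elim
      case (elim y)
      then have "c * y < V (b * W y)" using W(1)[of y] by (simp add: field_simps)
      moreover have "c * y = V (W (c * y))" using W(1)[of "c * y"] elim c by simp
      ultimately have "W (c * y) < b * W y"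
        using mono_onD[OF V(3), of "b * W y" "W (c * y)"] W(1)[of "c * y"] elim c b0
        by (force simp: field_simps not_less)
      then show ?case using elim by (simp add: field_simps)
    qed
  qed
qed

section \<open>Expectations of products with independent factors\<close>

text \<open>Functions of independent variables may live on different spaces, where joint laws still
  factorise.\<close>

lemma (in prob_space) indep_var_distr_pair:
  assumes ind: "indep_var M\<^sub>1 X\<^sub>1 M\<^sub>2 X\<^sub>2"
    and f[measurable]: "f \<in> measurable M\<^sub>1 S" and g[measurable]: "g \<in> measurable M\<^sub>2 T"
  shows "distr M (S \<Otimes>\<^sub>M T) (\<lambda>\<omega>. (f (X\<^sub>1 \<omega>), g (X\<^sub>2 \<omega>))) =
    distr M S (\<lambda>\<omega>. f (X\<^sub>1 \<omega>)) \<Otimes>\<^sub>M distr M T (\<lambda>\<omega>. g (X\<^sub>2 \<omega>))"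
proof -
  have X[measurable]: "random_variable M\<^sub>1 X\<^sub>1" "random_variable M\<^sub>2 X\<^sub>2"
    using ind by (auto dest: indep_var_rv1 indep_var_rv2)
  have law: "distr M (M\<^sub>1 \<Otimes>\<^sub>M M\<^sub>2) (\<lambda>\<omega>. (X\<^sub>1 \<omega>, X\<^sub>2 \<omega>)) = distr M M\<^sub>1 X\<^sub>1 \<Otimes>\<^sub>M distr M M\<^sub>2 X\<^sub>2"
    using ind by (simp add: indep_var_distribution_eq)
  have "prob_space (distr (distr M M\<^sub>2 X\<^sub>2) T g)"
    by (intro prob_space.prob_space_distr prob_space_distr) auto
  then have "distr (distr M M\<^sub>1 X\<^sub>1) S f \<Otimes>\<^sub>M distr (distr M M\<^sub>2 X\<^sub>2) T g =
      distr (distr M M\<^sub>1 X\<^sub>1 \<Otimes>\<^sub>M distr M M\<^sub>2 X\<^sub>2) (S \<Otimes>\<^sub>M T) (\<lambda>(x, y). (f x, g y))"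
    by (intro pair_measure_distr) (auto dest: prob_space_imp_sigma_finite)
  then show ?thesis
    unfolding law[symmetric] by (simp add: distr_distr o_def)
qed

text \<open>The common step behind all conditioning arguments below: given \<open>X\<close>, the independent \<open>Z i\<close> may be
  averaged one by one. It is Fubini's theorem on the product of the law of \<open>X\<close> and the laws of the
  \<open>Z i\<close>.\<close>

lemma (in prob_space) expectation_prod_indep:
  fixes a :: "'x \<Rightarrow> real" and b :: "'i \<Rightarrow> 'x \<Rightarrow> 'z \<Rightarrow> real"
  assumes B: "finite B"
    and X[measurable]: "random_variable S X"
    and ind: "distr M (S \<Otimes>\<^sub>M PiM B (\<lambda>_. T)) (\<lambda>\<omega>. (X \<omega>, \<lambda>i\<in>B. Z i \<omega>)) =
      distr M S X \<Otimes>\<^sub>M distr M (PiM B (\<lambda>_. T)) (\<lambda>\<omega>. \<lambda>i\<in>B. Z i \<omega>)"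
    and ind_Z: "indep_vars (\<lambda>_. T) Z B"
    and a[measurable]: "a \<in> borel_measurable S" and a_bound: "\<And>x. \<bar>a x\<bar> \<le> 1"
    and b: "\<And>i. i \<in> B \<Longrightarrow> case_prod (b i) \<in> borel_measurable (S \<Otimes>\<^sub>M T)"
    and b_bound: "\<And>i x z. i \<in> B \<Longrightarrow> \<bar>b i x z\<bar> \<le> 1"
  shows "expectation (\<lambda>\<omega>. a (X \<omega>) * (\<Prod>i\<in>B. b i (X \<omega>) (Z i \<omega>))) =
    expectation (\<lambda>\<omega>. a (X \<omega>) * (\<Prod>i\<in>B. \<integral>z. b i (X \<omega>) z \<partial>distr M T (Z i)))"
proof (cases "B = {}")
  case False
  define ZB where "ZB \<omega> = (\<lambda>i\<in>B. Z i \<omega>)" for \<omega>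
  have Z[measurable]: "random_variable T (Z i)" if "i \<in> B" for i
    using ind_Z that by (simp add: indep_vars_def)
  have ZB[measurable]: "random_variable (PiM B (\<lambda>_. T)) ZB"
    unfolding ZB_def by (rule measurable_restrict) (rule Z)
  define D where "D i = (if i \<in> B then distr M T (Z i) else return (count_space UNIV) undefined)" for i
  have D: "prob_space (D i)" for i
    unfolding D_def using Z[of i] by (auto intro!: prob_space_distr prob_space_return)
  interpret D: product_prob_space D B
    using D by (intro product_prob_spaceI) auto
  interpret DX: prob_space "distr M S X" by (rule prob_space_distr) simp
  interpret P: prob_space "PiM B D" by (rule prob_space_PiM) (rule D)
  interpret PP: pair_prob_space "distr M S X" "PiM B D" ..
  have sets_D: "sets (PiM B D) = sets (PiM B (\<lambda>_. T))"
    by (intro sets_PiM_cong) (auto simp: D_def)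
  have law_ZB: "distr M (PiM B (\<lambda>_. T)) ZB = PiM B D"
  proof -
    have "distr M (PiM B (\<lambda>_. T)) ZB = PiM B (\<lambda>i. distr M T (Z i))"
      unfolding ZB_def by (rule indep_vars_iff_distr_eq_PiM'[THEN iffD1, OF False Z ind_Z])
    also have "\<dots> = PiM B D" by (rule PiM_cong) (auto simp: D_def)
    finally show ?thesis .
  qed
  have law: "distr M (S \<Otimes>\<^sub>M PiM B (\<lambda>_. T)) (\<lambda>\<omega>. (X \<omega>, ZB \<omega>)) = distr M S X \<Otimes>\<^sub>M PiM B D"
    using ind unfolding ZB_def[symmetric] law_ZB .
  define h where "h x z = a x * (\<Prod>i\<in>B. b i x (z i))" for x z
  have h_meas: "case_prod h \<in> borel_measurable (S \<Otimes>\<^sub>M PiM B (\<lambda>_. T))"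
  proof -
    have "(\<lambda>w. b i (fst w) (snd w i)) \<in> borel_measurable (S \<Otimes>\<^sub>M PiM B (\<lambda>_. T))" if "i \<in> B" for i
    proof -
      have "(\<lambda>w. (fst w, snd w i)) \<in> S \<Otimes>\<^sub>M PiM B (\<lambda>_. T) \<rightarrow>\<^sub>M S \<Otimes>\<^sub>M T" using that by measurable
      from measurable_compose[OF this b[OF that]] show ?thesis by simp
    qed
    then show ?thesis unfolding h_def case_prod_beta by measurable
  qed
  have prod_bound: "\<bar>\<Prod>i\<in>B. c i\<bar> \<le> 1" if "\<And>i. i \<in> B \<Longrightarrow> \<bar>c i :: real\<bar> \<le> 1" for c
    unfolding abs_prod using that by (intro prod_le_1) auto
  have h_bound: "\<bar>h x z\<bar> \<le> 1" for x z
    unfolding h_def abs_mult using a_bound b_bound prod_bound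
    by (intro mult_le_one) auto
  have h_int: "integrable (distr M S X \<Otimes>\<^sub>M PiM B D) (case_prod h)"
  proof (rule PP.integrable_const_bound[where B=1])
    show "case_prod h \<in> borel_measurable (distr M S X \<Otimes>\<^sub>M PiM B D)"
      using h_meas by (subst measurable_cong_sets[OF sets_pair_measure_cong[OF _ sets_D]]) auto
  qed (auto simp: h_bound)
  have "expectation (\<lambda>\<omega>. h (X \<omega>) (ZB \<omega>)) =
      (\<integral>w. case_prod h w \<partial>distr M (S \<Otimes>\<^sub>M PiM B (\<lambda>_. T)) (\<lambda>\<omega>. (X \<omega>, ZB \<omega>)))"
    by (subst integral_distr[OF _ h_meas]) auto
  also have "\<dots> = (\<integral>x. \<integral>z. h x z \<partial>PiM B D \<partial>distr M S X)"
    unfolding law using PP.integral_fst'[OF h_int] by simp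
  also have "\<dots> = (\<integral>x. a x * (\<Prod>i\<in>B. \<integral>z. b i x z \<partial>distr M T (Z i)) \<partial>distr M S X)"
  proof (rule Bochner_Integration.integral_cong[OF refl])
    fix x assume "x \<in> space (distr M S X)"
    then have x: "x \<in> space S" by simp
    have "integrable (D i) (b i x)" if i: "i \<in> B" for i
    proof -
      have "b i x \<in> borel_measurable T" using measurable_Pair2[OF b[OF i] x] by simp
      then show ?thesis
        using i b_bound[OF i] by (intro finite_measure.integrable_const_bound[OF prob_space.finite_measure[OF D], where B=1]) (auto simp: D_def)
    qed
    then have "(\<integral>z. (\<Prod>i\<in>B. b i x (z i)) \<partial>PiM B D) = (\<Prod>i\<in>B. \<integral>z. b i x z \<partial>D i)"
      by (rule D.product_integral_prod[OF B])
    then show "(\<integral>z. h x z \<partial>PiM B D) = a x * (\<Prod>i\<in>B. \<integral>z. b i x z \<partial>distr M T (Z i))"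
      by (simp add: h_def D_def)
  qed
  also have "\<dots> = expectation (\<lambda>\<omega>. a (X \<omega>) * (\<Prod>i\<in>B. \<integral>z. b i (X \<omega>) z \<partial>distr M T (Z i)))"
  proof (subst integral_distr)
    have "(\<lambda>x. \<integral>z. b i x z \<partial>distr M T (Z i)) \<in> borel_measurable S" if i: "i \<in> B" for i
    proof -
      interpret Di: prob_space "distr M T (Z i)" using Z[OF i] by (rule prob_space_distr)
      show ?thesis
        using b[OF i] by (intro Di.borel_measurable_lebesgue_integral)
          (subst measurable_cong_sets[OF sets_pair_measure_cong[OF _ sets_distr]], auto)
    qed
    then show "(\<lambda>x. a x * (\<Prod>i\<in>B. \<integral>z. b i x z \<partial>distr M T (Z i))) \<in> borel_measurable S"
      by measurable
  qed auto
  finally show ?thesis by (simp add: h_def ZB_def)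
qed simp

section \<open>Genealogies\<close>

definition subtree :: "nat \<Rightarrow> genealogy \<Rightarrow> genealogy" where
  "subtree i x = (\<lambda>u. x (i # u))"

definition alive :: "genealogy \<Rightarrow> real \<Rightarrow> nat list \<Rightarrow> bool" where
  "alive x t u \<longleftrightarrow> is_born x u \<and> birth_time x u \<le> t \<and> t < birth_time x u + fst (x u)"

text \<open>Cutting the tree at generation \<open>n\<close> gives a count that is finite on every genealogy and obeys a
  recursion in \<open>n\<close>; \<^const>\<open>population\<close> is its limit unless the population explodes.\<close>

definition population_upto :: "nat \<Rightarrow> genealogy \<Rightarrow> real \<Rightarrow> nat" where
  "population_upto n x t = card {u. alive x t u \<and> length u < n}"

lemma is_born_Cons: "is_born x (i # u) \<longleftrightarrow> i < snd (x []) \<and> is_born (subtree i x) u"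
  unfolding is_born_def subtree_def by (simp add: All_less_Suc2)

lemma birth_time_Cons: "birth_time x (i # u) = fst (x []) + birth_time (subtree i x) u"
  unfolding birth_time_def subtree_def by (simp add: sum.lessThan_Suc_shift del: sum.lessThan_Suc)

lemma alive_Nil: "alive x t [] \<longleftrightarrow> 0 \<le> t \<and> t < fst (x [])"
  by (simp add: alive_def is_born_def birth_time_def)

lemma alive_Cons:
  "alive x t (i # u) \<longleftrightarrow> i < snd (x []) \<and> alive (subtree i x) (t - fst (x [])) u"
  unfolding alive_def is_born_Cons birth_time_Cons by (auto simp: subtree_def)

lemma population_eq_card_alive: "population x t = card {u. alive x t u}"
  by (simp add: population_def alive_def)

lemma alive_upto_Suc:
  "{u. alive x t u \<and> length u < Suc n} = (if alive x t [] then {[]} else {}) \<union>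
     (\<Union>i<snd (x []). (#) i ` {u. alive (subtree i x) (t - fst (x [])) u \<and> length u < n})"
  (is "?A = ?B")
proof (intro set_eqI)
  show "u \<in> ?A \<longleftrightarrow> u \<in> ?B" for u by (cases u) (auto simp: alive_Cons)
qed

lemma finite_alive_upto: "finite {u. alive x t u \<and> length u < n}"
proof (induction n arbitrary: x t)
  case (Suc n)
  then show ?case unfolding alive_upto_Suc by auto
qed simp

lemma population_upto_Suc:
  "population_upto (Suc n) x t = (if 0 \<le> t \<and> t < fst (x []) then 1 else 0) +
     (\<Sum>i<snd (x []). population_upto n (subtree i x) (t - fst (x [])))"
proof -
  let ?C = "\<Union>i<snd (x []). (#) i ` {u. alive (subtree i x) (t - fst (x [])) u \<and> length u < n}"
  have "card ?C = (\<Sum>i<snd (x []). card ((#) i ` {u. alive (subtree i x) (t - fst (x [])) u \<and> length u < n}))"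
    by (intro card_UN_disjoint ballI impI finite_imageI finite_alive_upto) auto
  also have "\<dots> = (\<Sum>i<snd (x []). population_upto n (subtree i x) (t - fst (x [])))"
    by (intro sum.cong refl) (simp add: population_upto_def card_image)
  finally have C: "card ?C = \<dots>" .
  have "finite ?C" using finite_alive_upto by blast
  then have "card ((if alive x t [] then {[]} else {}) \<union> ?C) = (if alive x t [] then 1 else 0) + card ?C"
    by (subst card_Un_disjoint) auto
  then show ?thesis unfolding population_upto_def[of "Suc n"] alive_upto_Suc C
    by (simp add: alive_Nil)
qed

lemma population_upto_eventually_finite:
  assumes fin: "finite {u. alive x t u}"
  shows "\<forall>\<^sub>F n in sequentially. population_upto n x t = population x t"
proof -
  obtain m where m: "\<And>u. alive x t u \<Longrightarrow> length u < m"
    using finite_nat_set_iff_bounded[of "length ` {u. alive x t u}"] fin by auto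
  have "population_upto n x t = population x t" if "n \<ge> m" for n
  proof -
    have "{u. alive x t u \<and> length u < n} = {u. alive x t u}" using m that by fastforce
    then show ?thesis by (simp add: population_upto_def population_eq_card_alive)
  qed
  then show ?thesis by (auto simp: eventually_sequentially)
qed

lemma population_upto_explosion:
  assumes inf: "infinite {u. alive x t u}"
  shows "filterlim (\<lambda>n. population_upto n x t) at_top sequentially"
  unfolding filterlim_at_top eventually_sequentially
proof
  fix k
  obtain A where A: "A \<subseteq> {u. alive x t u}" "finite A" "card A = k"
    using infinite_arbitrarily_large[OF inf] by blast
  obtain m where m: "\<And>u. u \<in> A \<Longrightarrow> length u < m"
    using finite_nat_set_iff_bounded[of "length ` A"] A by auto
  have "k \<le> population_upto n x t" if "n \<ge> m" for n
  proof -
    have "A \<subseteq> {u. alive x t u \<and> length u < n}" using A(1) m that by fastforce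
    from card_mono[OF finite_alive_upto this] A show ?thesis by (simp add: population_upto_def)
  qed
  then show "\<exists>N. \<forall>n\<ge>N. k \<le> population_upto n x t" by blast
qed

lemma population_upto_negative:
  assumes "\<And>u. 0 \<le> fst (x u)" "t < 0"
  shows "population_upto n x t = 0"
proof -
  have "0 \<le> birth_time x u" for u unfolding birth_time_def using assms by (intro sum_nonneg) auto
  then have "\<not> birth_time x u \<le> t" for u using assms(2) by (smt (verit))
  then have "{u. alive x t u \<and> length u < n} = {}" by (simp add: alive_def)
  then show ?thesis by (simp only: population_upto_def card.empty)
qed

text \<open>Equality with a given finite set is a countable intersection of events, and a countable type has
  only countably many finite subsets.\<close>

lemma measurable_card_countable:
  fixes P :: "'u::countable \<Rightarrow> 'w \<Rightarrow> bool"
  assumes [measurable]: "\<And>u. Measurable.pred M (P u)"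
  shows "(\<lambda>w. card {u. P u w}) \<in> measurable M (count_space UNIV)"
proof -
  have pos: "Measurable.pred M (\<lambda>w. \<exists>xs :: 'u list. card (set xs) = k \<and> (\<forall>u. P u w \<longleftrightarrow> u \<in> set xs))" for k
    by measurable
  have card_iff: "card {u. P u w} = k \<longleftrightarrow> (\<exists>xs. card (set xs) = k \<and> (\<forall>u. P u w \<longleftrightarrow> u \<in> set xs))"
    if "0 < k" for w k
  proof
    assume k: "card {u. P u w} = k"
    with that have "finite {u. P u w}" by (intro card_ge_0_finite) simp
    then obtain xs where "set xs = {u. P u w}" using finite_list by blast
    with k show "\<exists>xs. card (set xs) = k \<and> (\<forall>u. P u w \<longleftrightarrow> u \<in> set xs)"
      by (intro exI[of _ xs]) auto
  next
    assume "\<exists>xs. card (set xs) = k \<and> (\<forall>u. P u w \<longleftrightarrow> u \<in> set xs)"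
    then obtain xs where "card (set xs) = k" "{u. P u w} = set xs" by auto
    then show "card {u. P u w} = k" by simp
  qed
  have "Measurable.pred M (\<lambda>w. card {u. P u w} = k)" for k
  proof (cases "k = 0")
    case True
    have "Measurable.pred M (\<lambda>w. card {u. P u w} = Suc j)" for j
      using pos[of "Suc j"] by (simp only: card_iff[OF zero_less_Suc])
    then have "Measurable.pred M (\<lambda>w. \<not> (\<exists>j. card {u. P u w} = Suc j))"
      by (intro pred_intros_logic pred_intros_countable)
    moreover have "card {u. P u w} = k \<longleftrightarrow> \<not> (\<exists>j. card {u. P u w} = Suc j)" for w
      using True by (metis nat.exhaust nat.distinct(1))
    ultimately show ?thesis by simp
  next
    case False
    then show ?thesis using pos[of k] by (simp only: card_iff neq0_conv)
  qed
  then have "{w \<in> space M. card {u. P u w} = k} \<in> sets M" for k by (rule predE)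
  moreover have "(\<lambda>w. card {u. P u w}) -` {k} \<inter> space M = {w \<in> space M. card {u. P u w} = k}" for k
    by auto
  ultimately show ?thesis
    by (simp only: measurable_count_space_eq2_countable) auto
qed

lemma space_genealogy_law [simp]: "space (genealogy_law \<mu> p) = UNIV"
  by (simp add: genealogy_law_def space_PiM space_pair_measure PiE_def extensional_def)

lemma sets_genealogy_law [measurable_cong]:
  "sets (genealogy_law \<mu> p) = sets (PiM UNIV (\<lambda>_. borel \<Otimes>\<^sub>M count_space UNIV))"
  unfolding genealogy_law_def by (intro sets_PiM_cong sets_pair_measure_cong) auto

lemma measurable_alive:
  assumes [measurable]: "f \<in> measurable M (genealogy_law \<mu> p)" "g \<in> borel_measurable M"
  shows "Measurable.pred M (\<lambda>w. alive (f w) (g w) u)"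
proof -
  have [measurable]: "(\<lambda>w. fst (f w v)) \<in> borel_measurable M"
    "(\<lambda>w. snd (f w v)) \<in> measurable M (count_space UNIV)" for v
  proof -
    have "(\<lambda>x. x v) \<in> measurable (genealogy_law \<mu> p) (borel \<Otimes>\<^sub>M count_space UNIV)"
      by (subst measurable_cong_sets[OF sets_genealogy_law refl]) (rule measurable_component_singleton, simp)
    from measurable_compose[OF assms(1) this]
    have "(\<lambda>w. f w v) \<in> measurable M (borel \<Otimes>\<^sub>M count_space UNIV)" .
    then show "(\<lambda>w. fst (f w v)) \<in> borel_measurable M"
      "(\<lambda>w. snd (f w v)) \<in> measurable M (count_space UNIV)" by measurable
  qed
  have [measurable]: "Measurable.pred M (\<lambda>w. is_born (f w) u)"
    unfolding is_born_def by measurable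
  have [measurable]: "(\<lambda>w. birth_time (f w) u) \<in> borel_measurable M"
    unfolding birth_time_def by measurable
  show ?thesis unfolding alive_def by measurable
qed

lemma measurable_population:
  assumes [measurable]: "f \<in> measurable M (genealogy_law \<mu> p)" "g \<in> borel_measurable M"
  shows "(\<lambda>w. population (f w) (g w)) \<in> measurable M (count_space UNIV)"
    and "(\<lambda>w. population_upto n (f w) (g w)) \<in> measurable M (count_space UNIV)"
proof -
  note [measurable] = measurable_alive
  show "(\<lambda>w. population (f w) (g w)) \<in> measurable M (count_space UNIV)"
    unfolding population_eq_card_alive by (rule measurable_card_countable) measurable
  show "(\<lambda>w. population_upto n (f w) (g w)) \<in> measurable M (count_space UNIV)"
    unfolding population_upto_def by (rule measurable_card_countable) measurable
qed

lemma measurable_subtree [measurable]: "subtree i \<in> measurable (genealogy_law \<mu> p) (genealogy_law \<mu> p)"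
  unfolding subtree_def[abs_def] genealogy_law_def
  by (rule measurable_PiM_single') (auto simp: space_PiM intro!: measurable_component_singleton)

context
  fixes \<mu> :: real and p :: "nat pmf"
  assumes \<mu>: "0 < \<mu>"
begin

abbreviation "particle_law \<equiv> density lborel (exponential_density \<mu>) \<Otimes>\<^sub>M measure_pmf p"
abbreviation "tree_law \<equiv> genealogy_law \<mu> p"

lemma prob_space_particle_law: "prob_space particle_law"
proof -
  interpret E: prob_space "density lborel (exponential_density \<mu>)"
    using \<mu> by (rule prob_space_exponential_density)
  interpret P: prob_space "measure_pmf p" by (rule prob_space_measure_pmf)
  interpret pair_prob_space "density lborel (exponential_density \<mu>)" "measure_pmf p" ..
  show ?thesis by (rule prob_space_axioms)
qed

lemma prob_space_tree_law: "prob_space tree_law"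
  unfolding genealogy_law_def by (rule prob_space_PiM) (rule prob_space_particle_law)

text \<open>The subtree at a child only relabels independent, identically distributed particles.\<close>

lemma distr_subtree: "distr tree_law tree_law (subtree i) = tree_law"
proof -
  have "distr tree_law tree_law (\<lambda>x. \<lambda>u\<in>UNIV. x (i # u)) = tree_law"
    unfolding genealogy_law_def
    by (rule distr_PiM_reindex) (auto simp: inj_on_def prob_space_particle_law)
  then show ?thesis by (simp add: subtree_def[abs_def] restrict_UNIV)
qed

lemma indep_particles:
  "prob_space.indep_vars tree_law (\<lambda>_. particle_law) (\<lambda>u x. x u) (UNIV :: nat list set)"
proof -
  interpret prob_space tree_law by (rule prob_space_tree_law)
  have [measurable]: "(\<lambda>x. x u) \<in> measurable tree_law particle_law" for u
    unfolding genealogy_law_def by (rule measurable_component_singleton) simp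
  have "distr tree_law particle_law (\<lambda>x. x u) = particle_law" for u
    unfolding genealogy_law_def by (rule distr_PiM_component) (auto simp: prob_space_particle_law)
  then have "distr tree_law (PiM UNIV (\<lambda>_. particle_law)) (\<lambda>x. \<lambda>u\<in>UNIV. x u) =
      PiM UNIV (\<lambda>u. distr tree_law particle_law (\<lambda>x. x u))"
    by (simp add: restrict_UNIV distr_id2 genealogy_law_def)
  then show ?thesis by (subst indep_vars_iff_distr_eq_PiM') auto
qed

lemma indep_subtrees: "prob_space.indep_vars tree_law (\<lambda>_. tree_law) subtree UNIV"
proof -
  interpret prob_space tree_law by (rule prob_space_tree_law)
  have "indep_vars (\<lambda>i. PiM (range ((#) i)) (\<lambda>_. particle_law)) (\<lambda>i x. \<lambda>u\<in>range ((#) i). x u) UNIV"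
    by (rule indep_vars_restrict[OF indep_particles]) (auto simp: disjoint_family_on_def)
  then have "indep_vars (\<lambda>_. tree_law) (\<lambda>i x. (\<lambda>y u. y (i # u)) (\<lambda>u\<in>range ((#) i). x u)) UNIV"
  proof (rule indep_vars_compose2)
    show "(\<lambda>y u. y (i # u)) \<in> PiM (range ((#) i)) (\<lambda>_. particle_law) \<rightarrow>\<^sub>M tree_law" for i
      unfolding genealogy_law_def
      by (rule measurable_PiM_single') (auto simp: space_PiM intro!: measurable_component_singleton)
  qed
  then show ?thesis by (simp add: subtree_def[abs_def])
qed

lemma root_indep_subtrees:
  "distr tree_law (particle_law \<Otimes>\<^sub>M PiM B (\<lambda>_. tree_law)) (\<lambda>x. (x [], \<lambda>i\<in>B. subtree i x)) =
    distr tree_law particle_law (\<lambda>x. x []) \<Otimes>\<^sub>M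
    distr tree_law (PiM B (\<lambda>_. tree_law)) (\<lambda>x. \<lambda>i\<in>B. subtree i x)"
proof -
  interpret prob_space tree_law by (rule prob_space_tree_law)
  define K where "K = (\<Union>i\<in>B. range ((#) i))"
  have "indep_var (PiM {[]} (\<lambda>_. particle_law)) (\<lambda>x. \<lambda>u\<in>{[]}. x u) (PiM K (\<lambda>_. particle_law)) (\<lambda>x. \<lambda>u\<in>K. x u)"
    by (rule indep_var_restrict[OF indep_particles]) (auto simp: K_def)
  moreover have "(\<lambda>y. y []) \<in> PiM {[]} (\<lambda>_. particle_law) \<rightarrow>\<^sub>M particle_law"
    by (rule measurable_component_singleton) simp
  moreover have "(\<lambda>y u. y (i # u)) \<in> PiM K (\<lambda>_. particle_law) \<rightarrow>\<^sub>M tree_law" if "i \<in> B" for i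
    unfolding genealogy_law_def using that
    by (intro measurable_PiM_single') (auto simp: space_PiM K_def intro!: measurable_component_singleton)
  then have "(\<lambda>y. \<lambda>i\<in>B. \<lambda>u. y (i # u)) \<in> PiM K (\<lambda>_. particle_law) \<rightarrow>\<^sub>M PiM B (\<lambda>_. tree_law)"
    by (rule measurable_restrict)
  ultimately have "distr tree_law (particle_law \<Otimes>\<^sub>M PiM B (\<lambda>_. tree_law))
      (\<lambda>x. ((\<lambda>u\<in>{[]}. x u) [], \<lambda>i\<in>B. \<lambda>u. (\<lambda>u\<in>K. x u) (i # u))) =
    distr tree_law particle_law (\<lambda>x. (\<lambda>u\<in>{[]}. x u) []) \<Otimes>\<^sub>M
    distr tree_law (PiM B (\<lambda>_. tree_law)) (\<lambda>x. \<lambda>i\<in>B. \<lambda>u. (\<lambda>u\<in>K. x u) (i # u))"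
    by (rule indep_var_distr_pair)
  moreover have "(\<lambda>i\<in>B. \<lambda>u. (\<lambda>u\<in>K. x u) (i # u)) = (\<lambda>i\<in>B. subtree i x)" for x :: genealogy
    by (intro restrict_ext) (auto simp: K_def subtree_def fun_eq_iff)
  ultimately show ?thesis by simp
qed

end

section \<open>Generating functions\<close>

lemma measurable_power_nat:
  assumes [measurable]: "f \<in> borel_measurable M" "g \<in> measurable M (count_space UNIV)"
  shows "(\<lambda>w. (f w :: real) ^ g w) \<in> borel_measurable M"
  by (rule measurable_compose_countable[of "\<lambda>n w. f w ^ n"]) measurable

lemma integrable_power_pmf:
  assumes "0 \<le> y" "y \<le> (1::real)" shows "integrable (measure_pmf p) (\<lambda>n. y ^ n)"
  using assms
  by (intro measure_pmf.integrable_const_bound[where B=1]) (auto simp: power_le_one)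

lemma pgf_nonneg: "0 \<le> y \<Longrightarrow> 0 \<le> pgf p y"
  by (simp add: pgf_def integral_nonneg_AE)

lemma pgf_one [simp]: "pgf p 1 = 1"
  by (simp add: pgf_def)

lemma pgf_mono: "0 \<le> y \<Longrightarrow> y \<le> z \<Longrightarrow> z \<le> 1 \<Longrightarrow> pgf p y \<le> pgf p z"
  unfolding pgf_def by (intro integral_mono integrable_power_pmf power_mono) auto

lemma pgf_le_one: "0 \<le> y \<Longrightarrow> y \<le> 1 \<Longrightarrow> pgf p y \<le> 1"
  using pgf_mono[of y 1 p] by simp

lemma continuous_on_pgf: "continuous_on {0..1} (pgf p)"
proof (rule continuous_on_sequentiallyI)
  fix u a assume u: "\<forall>n. u n \<in> {0..1::real}" "a \<in> {0..1}" "u \<longlonglongrightarrow> a"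
  show "(\<lambda>n. pgf p (u n)) \<longlonglongrightarrow> pgf p a"
    unfolding pgf_def
  proof (rule integral_dominated_convergence[where w="\<lambda>_. 1"])
    show "AE x in measure_pmf p. (\<lambda>i. u i ^ x) \<longlonglongrightarrow> a ^ x" using u by (auto intro: tendsto_power)
  qed (use u in \<open>auto simp: power_le_one\<close>)
qed

lemma measurable_pgf [measurable]: "pgf p \<in> borel_measurable borel"
proof -
  have [measurable]: "(\<lambda>w. fst w ^ snd w :: real) \<in> borel_measurable (borel \<Otimes>\<^sub>M measure_pmf p)"
    by (rule measurable_power_nat) measurable
  show ?thesis unfolding pgf_def[abs_def]
    by (rule measure_pmf.borel_measurable_lebesgue_integral) (simp add: case_prod_beta)
qed

text \<open>Bernoulli's inequality \<open>y\<^sup>n \<ge> 1 - n (1 - y)\<close>, averaged over a law with mean 1.\<close>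

lemma pgf_ge_of_critical:
  assumes critical: "measure_pmf.expectation p real = 1" and y: "0 \<le> y" "y \<le> 1"
  shows "y \<le> pgf p y"
proof -
  have int: "integrable (measure_pmf p) real"
    using critical not_integrable_integral_eq[of "measure_pmf p" real] by fastforce
  have "(\<integral>n. 1 - (1 - y) * real n \<partial>measure_pmf p) \<le> pgf p y"
    unfolding pgf_def
  proof (rule integral_mono)
    show "1 - (1 - y) * real n \<le> y ^ n" for n
      using Bernoulli_inequality[of "y - 1" n] y by (simp add: algebra_simps)
  qed (use int y in \<open>auto intro: integrable_power_pmf\<close>)
  also have "(\<integral>n. 1 - (1 - y) * real n \<partial>measure_pmf p) = y"
    using int critical by simp
  finally show ?thesis .
qed

section \<open>The renewal equation of the branching process\<close>

context
  fixes \<mu> :: real and p :: "nat pmf"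
  assumes \<mu>: "0 < \<mu>" and critical: "measure_pmf.expectation p real = 1"
begin

interpretation tree: prob_space "genealogy_law \<mu> p"
  using \<mu> by (rule prob_space_tree_law)

lemmas tree_UNIV = tree.prob_space[unfolded space_genealogy_law]

interpretation lifetime: prob_space "density lborel (exponential_density \<mu>)"
  using \<mu> by (rule prob_space_exponential_density)

lemmas [measurable] = measurable_population measurable_power_nat

definition stage_pgf :: "nat \<Rightarrow> real \<Rightarrow> real \<Rightarrow> real" where
  "stage_pgf n t s = (\<integral>x. s ^ population_upto n x t \<partial>genealogy_law \<mu> p)"

lemma stage_pgf_bounds:
  assumes "0 \<le> s" "s \<le> 1" shows "0 \<le> stage_pgf n t s" "stage_pgf n t s \<le> 1"
proof -
  show "0 \<le> stage_pgf n t s" unfolding stage_pgf_def using assms by (intro integral_nonneg_AE) auto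
  have "stage_pgf n t s \<le> (\<integral>x. 1 \<partial>genealogy_law \<mu> p)"
    unfolding stage_pgf_def using assms
    by (intro integral_mono tree.integrable_const_bound[where B=1]) (auto simp: power_le_one)
  then show "stage_pgf n t s \<le> 1" by (simp add: tree_UNIV)
qed

lemma measurable_stage_pgf [measurable]: "(\<lambda>t. stage_pgf n t s) \<in> borel_measurable borel"
  unfolding stage_pgf_def by measurable

lemma AE_lifetimes_nonneg: "AE x in genealogy_law \<mu> p. \<forall>u. 0 \<le> fst (x u)"
proof -
  have "AE v in density lborel (exponential_density \<mu>). 0 \<le> v"
    by (subst AE_density) (auto simp: exponential_density_def)
  interpret P: pair_prob_space "density lborel (exponential_density \<mu>)" "measure_pmf p" ..
  have "distr (particle_law \<mu> p) (density lborel (exponential_density \<mu>)) fst = density lborel (exponential_density \<mu>)"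
    by (rule prob_space.distr_pair_fst) (rule prob_space_measure_pmf)
  then have "AE v in distr (particle_law \<mu> p) (density lborel (exponential_density \<mu>)) fst. 0 \<le> v"
    using \<open>AE v in density lborel (exponential_density \<mu>). 0 \<le> v\<close> by (simp only:)
  then have "AE w in particle_law \<mu> p. 0 \<le> fst w"
    by (rule AE_distrD[rotated]) (rule measurable_fst)
  then have "AE x in genealogy_law \<mu> p. 0 \<le> fst (x u)" for u
    unfolding genealogy_law_def using prob_space_particle_law[OF \<mu>]
    by (intro AE_PiM_component) auto
  then show ?thesis by (simp add: AE_all_countable)
qed

lemma stage_pgf_negative: "t < 0 \<Longrightarrow> stage_pgf n t s = 1"
proof -
  assume "t < 0"
  have "AE x in genealogy_law \<mu> p. s ^ population_upto n x t = 1"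
    using AE_lifetimes_nonneg by eventually_elim (simp add: population_upto_negative \<open>t < 0\<close>)
  then have "stage_pgf n t s = (\<integral>x. 1 \<partial>genealogy_law \<mu> p)"
    unfolding stage_pgf_def by (intro integral_cong_AE) auto
  then show ?thesis by (simp add: tree_UNIV)
qed

lemma root_law:
  assumes [measurable]: "f \<in> borel_measurable (particle_law \<mu> p)" and bound: "\<And>w. \<bar>f w :: real\<bar> \<le> 1"
  shows "(\<integral>x. f (x []) \<partial>genealogy_law \<mu> p) =
    (\<integral>v. \<integral>k. f (v, k) \<partial>measure_pmf p \<partial>density lborel (exponential_density \<mu>))"
proof -
  interpret P: pair_prob_space "density lborel (exponential_density \<mu>)" "measure_pmf p" ..
  have "distr (genealogy_law \<mu> p) (particle_law \<mu> p) (\<lambda>x. x []) = particle_law \<mu> p"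
    unfolding genealogy_law_def using prob_space_particle_law[OF \<mu>] by (intro distr_PiM_component) auto
  then have "(\<integral>w. f w \<partial>particle_law \<mu> p) = (\<integral>x. f (x []) \<partial>genealogy_law \<mu> p)"
    using integral_distr[of "\<lambda>x. x []" "genealogy_law \<mu> p" "particle_law \<mu> p" f]
    by (simp add: genealogy_law_def)
  moreover have "(\<integral>v. \<integral>k. f (v, k) \<partial>measure_pmf p \<partial>density lborel (exponential_density \<mu>)) =
      (\<integral>w. f w \<partial>particle_law \<mu> p)"
    using bound by (intro P.integral_fst' P.integrable_const_bound[where B=1]) auto
  ultimately show ?thesis by simp
qed

text \<open>Decomposition at the root: after the death of the initial particle at time \<open>v\<close> its children found
  independent copies of the tree. For \<open>v > t\<close> the second factor is 1, because a subtree has no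
  living particle at a negative time.\<close>

lemma stage_pgf_Suc:
  assumes s: "0 \<le> s" "s \<le> 1"
  shows "stage_pgf (Suc n) t s =
    (\<integral>v. (if 0 \<le> t \<and> t < v then s else 1) * pgf p (stage_pgf n (t - v) s)
       \<partial>density lborel (exponential_density \<mu>))"
proof -
  define a where "a w = (if 0 \<le> t \<and> t < fst w then s else 1)" for w :: "real \<times> nat"
  define b where "b i w z = (if i < snd w then s ^ population_upto n z (t - fst w) else 1)"
    for i and w :: "real \<times> nat" and z :: genealogy
  define c where "c i w = (if i < snd w then stage_pgf n (t - fst w) s else 1)"
    for i and w :: "real \<times> nat"
  have a[measurable]: "a \<in> borel_measurable (particle_law \<mu> p)" unfolding a_def by measurable
  have b: "case_prod (b i) \<in> borel_measurable (particle_law \<mu> p \<Otimes>\<^sub>M genealogy_law \<mu> p)" for i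
    unfolding b_def case_prod_beta by measurable
  have c[measurable]: "c i \<in> borel_measurable (particle_law \<mu> p)" for i
    unfolding c_def by measurable
  have root[measurable]: "(\<lambda>x. x []) \<in> measurable (genealogy_law \<mu> p) (particle_law \<mu> p)"
    unfolding genealogy_law_def by (rule measurable_component_singleton) simp
  have a_bound: "\<bar>a w\<bar> \<le> 1" for w using s by (simp add: a_def)
  have b_bound: "\<bar>b i w z\<bar> \<le> 1" for i w z using s by (simp add: b_def power_le_one)
  have c_bound: "\<bar>c i w\<bar> \<le> 1" for i w using stage_pgf_bounds[OF s] by (auto simp: c_def)
  have prod_if: "(\<Prod>i<K. if i < k then f i else 1) = (\<Prod>i<k. f i)" if "k \<le> K"
    for k K and f :: "nat \<Rightarrow> real"
    using that by (intro prod.mono_neutral_cong_right) auto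
  have prod_bound: "\<bar>x * (\<Prod>i<K. f i)\<bar> \<le> 1" if "\<bar>x\<bar> \<le> 1" "\<And>i. \<bar>f i\<bar> \<le> 1"
    for x and f :: "nat \<Rightarrow> real" and K :: nat
    unfolding abs_mult abs_prod using that by (intro mult_le_one prod_le_1 prod_nonneg) auto
  \<comment> \<open>Only \<open>K\<close> potential children are followed, with factor 1 for those that are not born, which
    makes the number of independent factors deterministic.\<close>
  define h where "h K x = a (x []) * (\<Prod>i<K. b i (x []) (subtree i x))" for K and x :: genealogy
  define h' where "h' K x = a (x []) * (\<Prod>i<K. c i (x []))" for K and x :: genealogy
  have eq: "(\<integral>x. h K x \<partial>genealogy_law \<mu> p) = (\<integral>x. h' K x \<partial>genealogy_law \<mu> p)" for K
  proof -
    have "(\<integral>z. b i w z \<partial>genealogy_law \<mu> p) = c i w" for i w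
      by (simp add: b_def c_def stage_pgf_def tree_UNIV)
    then show ?thesis
      unfolding h_def h'_def
      using tree.expectation_prod_indep[OF finite_lessThan[of K] root root_indep_subtrees[OF \<mu>]
          tree.indep_vars_subset[OF indep_subtrees[OF \<mu>] subset_UNIV] a a_bound b b_bound]
      by (simp add: distr_subtree[OF \<mu>])
  qed
  have h_lim: "(\<lambda>K. \<integral>x. h K x \<partial>genealogy_law \<mu> p) \<longlonglongrightarrow> stage_pgf (Suc n) t s"
    unfolding stage_pgf_def
  proof (rule integral_dominated_convergence[where w="\<lambda>_. 1"])
    show "AE x in genealogy_law \<mu> p. (\<lambda>K. h K x) \<longlonglongrightarrow> s ^ population_upto (Suc n) x t"
    proof (rule AE_I2)
      fix x :: genealogy
      have "h K x = s ^ population_upto (Suc n) x t" if "snd (x []) \<le> K" for K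
        using prod_if[OF that] by (simp add: h_def a_def b_def population_upto_Suc power_add power_sum)
      then show "(\<lambda>K. h K x) \<longlonglongrightarrow> s ^ population_upto (Suc n) x t"
        by (intro tendsto_eventually) (auto simp: eventually_sequentially)
    qed
    show "h K \<in> borel_measurable (genealogy_law \<mu> p)" for K
    proof -
      have "(\<lambda>x. b i (x []) (subtree i x)) \<in> borel_measurable (genealogy_law \<mu> p)" for i
        using measurable_compose[OF measurable_Pair[OF root measurable_subtree] b[of i]] by simp
      then show ?thesis
        unfolding h_def by (intro borel_measurable_times borel_measurable_prod measurable_compose[OF root a])
    qed
    show "AE x in genealogy_law \<mu> p. norm (h K x) \<le> 1" for K
      unfolding h_def real_norm_def by (rule AE_I2) (rule prod_bound[OF a_bound b_bound])
  qed auto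
  have h'_lim: "(\<lambda>K. \<integral>x. h' K x \<partial>genealogy_law \<mu> p) \<longlonglongrightarrow>
    (\<integral>x. a (x []) * stage_pgf n (t - fst (x [])) s ^ snd (x []) \<partial>genealogy_law \<mu> p)"
  proof (rule integral_dominated_convergence[where w="\<lambda>_. 1"])
    show "AE x in genealogy_law \<mu> p. (\<lambda>K. h' K x) \<longlonglongrightarrow> a (x []) * stage_pgf n (t - fst (x [])) s ^ snd (x [])"
    proof (rule AE_I2)
      fix x :: genealogy
      have "h' K x = a (x []) * stage_pgf n (t - fst (x [])) s ^ snd (x [])" if "snd (x []) \<le> K" for K
        using prod_if[OF that] by (simp add: h'_def c_def)
      then show "(\<lambda>K. h' K x) \<longlonglongrightarrow> a (x []) * stage_pgf n (t - fst (x [])) s ^ snd (x [])"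
        by (intro tendsto_eventually) (auto simp: eventually_sequentially)
    qed
    show "h' K \<in> borel_measurable (genealogy_law \<mu> p)" for K
      unfolding h'_def by (intro borel_measurable_times borel_measurable_prod measurable_compose[OF root a] measurable_compose[OF root c])
    show "AE x in genealogy_law \<mu> p. norm (h' K x) \<le> 1" for K
      unfolding h'_def real_norm_def by (rule AE_I2) (rule prod_bound[OF a_bound c_bound])
    show "(\<lambda>x. a (x []) * stage_pgf n (t - fst (x [])) s ^ snd (x [])) \<in> borel_measurable (genealogy_law \<mu> p)"
      by (rule measurable_compose[OF root]) measurable
  qed auto
  have "stage_pgf (Suc n) t s =
    (\<integral>x. a (x []) * stage_pgf n (t - fst (x [])) s ^ snd (x []) \<partial>genealogy_law \<mu> p)"
    using LIMSEQ_unique[OF h_lim h'_lim[folded eq]] .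
  also have "\<dots> = (\<integral>v. \<integral>k. a (v, k) * stage_pgf n (t - v) s ^ k \<partial>measure_pmf p
      \<partial>density lborel (exponential_density \<mu>))"
  proof (subst root_law[where f="\<lambda>w. a w * stage_pgf n (t - fst w) s ^ snd w"])
    show "(\<lambda>w. a w * stage_pgf n (t - fst w) s ^ snd w) \<in> borel_measurable (particle_law \<mu> p)"
      by measurable
    show "\<bar>a w * stage_pgf n (t - fst w) s ^ snd w\<bar> \<le> 1" for w
      unfolding abs_mult using a_bound stage_pgf_bounds[OF s]
      by (intro mult_le_one) (auto simp: power_le_one)
  qed simp
  also have "\<dots> = (\<integral>v. (if 0 \<le> t \<and> t < v then s else 1) * pgf p (stage_pgf n (t - v) s)
      \<partial>density lborel (exponential_density \<mu>))"
    by (simp add: a_def pgf_def)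
  finally show ?thesis .
qed

text \<open>Criticality in the form \<open>f(y) \<ge> y\<close> propagates the bound through the generations.\<close>

lemma stage_pgf_ge:
  assumes s: "0 \<le> s" "s \<le> 1" shows "s \<le> stage_pgf n t s"
proof (induction n arbitrary: t)
  case 0
  then show ?case using s by (simp add: stage_pgf_def population_upto_def tree_UNIV)
next
  case (Suc n)
  let ?E = "density lborel (exponential_density \<mu>)"
  have "s = (\<integral>v. s \<partial>?E)" using lifetime.prob_space by simp
  also have "\<dots> \<le> stage_pgf (Suc n) t s"
    unfolding stage_pgf_Suc[OF s]
  proof (rule integral_mono)
    note b = stage_pgf_bounds[OF s]
    have "\<bar>(if 0 \<le> t \<and> t < v then s else 1) * pgf p (stage_pgf n (t - v) s)\<bar> \<le> 1" for v
      unfolding abs_mult using s b by (intro mult_le_one) (auto simp: pgf_nonneg pgf_le_one)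
    then show "integrable ?E (\<lambda>v. (if 0 \<le> t \<and> t < v then s else 1) * pgf p (stage_pgf n (t - v) s))"
      by (intro lifetime.integrable_const_bound[where B=1]) auto
    fix v
    show "s \<le> (if 0 \<le> t \<and> t < v then s else 1) * pgf p (stage_pgf n (t - v) s)"
    proof (cases "0 \<le> t \<and> t < v")
      case False
      have "s \<le> pgf p (stage_pgf n (t - v) s)"
        using Suc.IH[of "t - v"] pgf_ge_of_critical[OF critical b] by (rule order_trans)
      then show ?thesis by (subst if_not_P[OF False]) simp
    qed (simp add: stage_pgf_negative)
  qed simp
  finally show ?case .
qed

text \<open>On explosion \<open>s\<^bsup>N\<^esup>\<close> tends to 0 when \<open>N\<close> runs through the truncated populations, so the lower bound
  \<open>s\<close> for the p.g.f.s bounds the probability of non-explosion from below. Then \<open>s\<close> tends to 1.\<close>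

lemma AE_finite_alive: "AE x in genealogy_law \<mu> p. finite {u. alive x t u}"
proof -
  define A where "A = {x. finite {u. alive x t u}}"
  have A[measurable]: "A \<in> sets (genealogy_law \<mu> p)"
  proof -
    note [measurable] = measurable_alive
    have "finite {u. alive x t u} \<longleftrightarrow> (\<exists>xs. \<forall>u. alive x t u \<longleftrightarrow> u \<in> set xs)" for x
    proof
      assume "finite {u. alive x t u}"
      then obtain xs where "set xs = {u. alive x t u}" using finite_list by blast
      then show "\<exists>xs. \<forall>u. alive x t u \<longleftrightarrow> u \<in> set xs" by (intro exI[of _ xs]) auto
    next
      assume "\<exists>xs. \<forall>u. alive x t u \<longleftrightarrow> u \<in> set xs"
      then obtain xs where "{u. alive x t u} = set xs" by auto
      then show "finite {u. alive x t u}" by simp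
    qed
    then have "A = {x \<in> space (genealogy_law \<mu> p). \<exists>xs. \<forall>u. alive x t u \<longleftrightarrow> u \<in> set xs}"
      unfolding A_def by simp
    also have "\<dots> \<in> sets (genealogy_law \<mu> p)" by measurable
    finally show ?thesis .
  qed
  have "s \<le> tree.prob A" if s: "0 < s" "s < 1" for s
  proof -
    have "(\<lambda>n. stage_pgf n t s) \<longlonglongrightarrow> (\<integral>x. indicator A x * s ^ population x t \<partial>genealogy_law \<mu> p)"
      unfolding stage_pgf_def
    proof (rule integral_dominated_convergence[where w="\<lambda>_. 1"])
      show "AE x in genealogy_law \<mu> p. (\<lambda>n. s ^ population_upto n x t) \<longlonglongrightarrow> indicator A x * s ^ population x t"
      proof (rule AE_I2)
        fix x
        show "(\<lambda>n. s ^ population_upto n x t) \<longlonglongrightarrow> indicator A x * s ^ population x t"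
        proof (cases "finite {u. alive x t u}")
          case True
          from population_upto_eventually_finite[OF this]
          have "\<forall>\<^sub>F n in sequentially. s ^ population_upto n x t = s ^ population x t"
            by eventually_elim simp
          with True show ?thesis by (simp add: A_def tendsto_eventually)
        next
          case False
          have "(\<lambda>n. s ^ n) \<longlonglongrightarrow> 0" using s by (intro LIMSEQ_power_zero) auto
          from filterlim_compose[OF this population_upto_explosion[OF False]] False
          show ?thesis by (simp add: A_def)
        qed
      qed
    qed (use s in \<open>auto simp: power_le_one\<close>)
    then have "s \<le> (\<integral>x. indicator A x * s ^ population x t \<partial>genealogy_law \<mu> p)"
      by (rule tendsto_lowerbound) (use s stage_pgf_ge in auto)
    also have "\<dots> \<le> (\<integral>x. indicator A x \<partial>genealogy_law \<mu> p)"
      using s by (intro integral_mono tree.integrable_const_bound[where B=1])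
        (auto simp: power_le_one indicator_def)
    finally show ?thesis by simp
  qed
  then have "1 \<le> tree.prob A"
    by (intro dense_le_bounded[of 0 1]) auto
  then have "tree.prob A = 1" using tree.prob_le_1[of A] by linarith
  then show ?thesis using tree.prob_eq_1[OF A] by (simp add: A_def)
qed

lemma stage_pgf_tendsto:
  assumes s: "0 \<le> s" "s \<le> 1"
  shows "(\<lambda>n. stage_pgf n t s) \<longlonglongrightarrow> branching_pgf \<mu> p t s"
  unfolding stage_pgf_def branching_pgf_def
proof (rule integral_dominated_convergence[where w="\<lambda>_. 1"])
  show "AE x in genealogy_law \<mu> p. (\<lambda>n. s ^ population_upto n x t) \<longlonglongrightarrow> s ^ population x t"
    using AE_finite_alive[of t]
  proof eventually_elim
    case (elim x)
    from population_upto_eventually_finite[OF this]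
    have "\<forall>\<^sub>F n in sequentially. s ^ population_upto n x t = s ^ population x t"
      by eventually_elim simp
    then show ?case by (rule tendsto_eventually)
  qed
qed (use s in \<open>auto simp: power_le_one\<close>)

lemma branching_pgf_bounds:
  assumes s: "0 \<le> s" "s \<le> 1"
  shows "s \<le> branching_pgf \<mu> p t s" "branching_pgf \<mu> p t s \<le> 1"
proof -
  show "s \<le> branching_pgf \<mu> p t s"
    by (rule tendsto_lowerbound[OF stage_pgf_tendsto[OF s]]) (simp_all add: stage_pgf_ge s)
  show "branching_pgf \<mu> p t s \<le> 1"
    by (rule tendsto_upperbound[OF stage_pgf_tendsto[OF s]]) (simp_all add: stage_pgf_bounds s)
qed

lemma branching_pgf_negative:
  assumes "0 \<le> s" "s \<le> 1" "t < 0" shows "branching_pgf \<mu> p t s = 1"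
  using stage_pgf_tendsto[OF assms(1,2), of t] by (simp add: stage_pgf_negative assms(3) LIMSEQ_const_iff)

lemma measurable_branching_pgf [measurable]: "(\<lambda>t. branching_pgf \<mu> p t s) \<in> borel_measurable borel"
  unfolding branching_pgf_def by measurable

lemma branching_pgf_renewal:
  assumes s: "0 \<le> s" "s \<le> 1" and t: "0 \<le> t"
  shows "branching_pgf \<mu> p t s = s * exp (- \<mu> * t) +
    (LBINT v:{0..t}. \<mu> * exp (- \<mu> * v) * pgf p (branching_pgf \<mu> p (t - v) s))"
proof -
  let ?E = "density lborel (exponential_density \<mu>)"
  let ?F = "\<lambda>t. branching_pgf \<mu> p t s"
  have F: "0 \<le> ?F t" "?F t \<le> 1" for t using branching_pgf_bounds[OF s, of t] s by auto
  have pgf_b: "0 \<le> pgf p (?F t)" "pgf p (?F t) \<le> 1" for t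
    using F[of t] by (auto simp: pgf_nonneg pgf_le_one)
  have "(\<lambda>n. stage_pgf (Suc n) t s) \<longlonglongrightarrow> (\<integral>v. (if 0 \<le> t \<and> t < v then s else 1) * pgf p (?F (t - v)) \<partial>?E)"
    unfolding stage_pgf_Suc[OF s]
  proof (rule integral_dominated_convergence[where w="\<lambda>_. 1"])
    show "AE v in ?E. (\<lambda>n. (if 0 \<le> t \<and> t < v then s else 1) * pgf p (stage_pgf n (t - v) s)) \<longlonglongrightarrow>
        (if 0 \<le> t \<and> t < v then s else 1) * pgf p (?F (t - v))"
    proof (rule AE_I2)
      fix v
      have "(\<lambda>n. pgf p (stage_pgf n (t - v) s)) \<longlonglongrightarrow> pgf p (?F (t - v))"
        by (rule continuous_on_tendsto_compose[OF continuous_on_pgf stage_pgf_tendsto[OF s]])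
           (use F stage_pgf_bounds[OF s] in auto)
      then show "(\<lambda>n. (if 0 \<le> t \<and> t < v then s else 1) * pgf p (stage_pgf n (t - v) s)) \<longlonglongrightarrow>
        (if 0 \<le> t \<and> t < v then s else 1) * pgf p (?F (t - v))"
        by (rule tendsto_mult[OF tendsto_const])
    qed
    show "AE v in ?E. norm ((if 0 \<le> t \<and> t < v then s else 1) * pgf p (stage_pgf n (t - v) s)) \<le> 1" for n
      unfolding real_norm_def abs_mult using s stage_pgf_bounds[OF s]
      by (intro AE_I2 mult_le_one) (auto simp: pgf_nonneg pgf_le_one)
  qed auto
  then have "?F t = (\<integral>v. (if 0 \<le> t \<and> t < v then s else 1) * pgf p (?F (t - v)) \<partial>?E)"
    using LIMSEQ_Suc[OF stage_pgf_tendsto[OF s, of t]] LIMSEQ_unique by blast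
  also have "\<dots> = (\<integral>v. s * indicator {t<..} v + indicator {..t} v * pgf p (?F (t - v)) \<partial>?E)"
    using t s by (intro Bochner_Integration.integral_cong refl)
      (auto simp: indicator_def branching_pgf_negative)
  also have "\<dots> = s * lifetime.prob {t<..} + (\<integral>v. indicator {..t} v * pgf p (?F (t - v)) \<partial>?E)"
  proof (subst Bochner_Integration.integral_add)
    show "integrable ?E (\<lambda>v. s * indicator {t<..} v)"
      using s by (intro lifetime.integrable_const_bound[where B=1]) (auto simp: indicator_def)
    show "integrable ?E (\<lambda>v. indicator {..t} v * pgf p (?F (t - v)))"
      using pgf_b by (intro lifetime.integrable_const_bound[where B=1]) (auto simp: indicator_def)
  qed simp
  also have "lifetime.prob {t<..} = exp (- \<mu> * t)"
  proof -
    have "lifetime.prob {..t} = 1 - exp (- \<mu> * t)"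
      using emeasure_erlang_density[OF \<mu>, of 0 t] \<mu> t
      by (simp add: measure_def erlang_CDF_def)
    moreover have "lifetime.prob {t<..} = 1 - lifetime.prob {..t}"
      using lifetime.prob_compl[of "{..t}"] by (simp add: Compl_eq_Diff_UNIV[symmetric])
    ultimately show ?thesis by simp
  qed
  also have "(\<integral>v. indicator {..t} v * pgf p (?F (t - v)) \<partial>?E) =
      (\<integral>v. exponential_density \<mu> v * (indicator {..t} v * pgf p (?F (t - v))) \<partial>lborel)"
    using \<mu> by (subst integral_density) (auto simp: exponential_density_nonneg)
  also have "\<dots> = (LBINT v:{0..t}. \<mu> * exp (- \<mu> * v) * pgf p (?F (t - v)))"
    unfolding set_lebesgue_integral_def
    by (intro Bochner_Integration.integral_cong refl)
       (auto simp: indicator_def exponential_density_def mult_ac)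
  finally show ?thesis .
qed

end

section \<open>The evolution equation and its solution\<close>

locale critical_offspring =
  fixes \<mu> :: real and p :: "nat pmf" and \<gamma> :: real and L :: "real \<Rightarrow> real"
  assumes rate: "0 < \<mu>"
    and critical: "measure_pmf.expectation p real = 1"
    and gamma: "0 < \<gamma>"
    and slow: "slowly_varying L"
    and offspring: "\<And>s. 0 \<le> s \<Longrightarrow> s < 1 \<Longrightarrow> pgf p s = s + (1 - s) powr (\<gamma> + 1) * L (1 / (1 - s))"
begin

abbreviation "V \<equiv> V_fun (pgf p)"
abbreviation "W \<equiv> W_fun (pgf p)"
abbreviation "F \<equiv> branching_pgf \<mu> p"

text \<open>The gap \<open>f(y) - y\<close> is the mean of the nonnegative terms \<open>y\<^sup>n - 1 - n (y - 1)\<close>. If it vanished at one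
  point, the law would live on \<open>{0, 1}\<close> and \<open>f\<close> would be the identity, contradicting \<open>L > 0\<close> near
  infinity.\<close>

lemma pgf_gt: assumes y: "0 \<le> y" "y < 1" shows "y < pgf p y"
proof (rule ccontr)
  assume "\<not> y < pgf p y"
  then have eq: "pgf p y = y" using pgf_ge_of_critical[OF critical, of y] y by simp
  define d where "d z n = z ^ n - 1 - real n * (z - 1)" for z :: real and n
  have int: "integrable (measure_pmf p) real"
    using critical not_integrable_integral_eq[of "measure_pmf p" real] by fastforce
  have d_int: "integrable (measure_pmf p) (d z)" and d_eq: "(\<integral>n. d z n \<partial>measure_pmf p) = pgf p z - z"
    if "0 \<le> z" "z \<le> 1" for z
    using that int integrable_power_pmf[OF that] critical unfolding d_def pgf_def by auto
  have d_nonneg: "0 \<le> d z n" if "0 \<le> z" for z n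
    using Bernoulli_inequality[of "z - 1" n] that by (simp add: d_def)
  have "AE n in measure_pmf p. d y n = 0"
    using integral_nonneg_eq_0_iff_AE[OF d_int[of y]] d_eq[of y] d_nonneg y eq by simp
  then have zero: "d y n = 0" if "n \<in> set_pmf p" for n using that by (simp add: AE_measure_pmf_iff)
  have small: "n \<le> 1" if "n \<in> set_pmf p" for n
  proof (rule ccontr)
    assume "\<not> n \<le> 1"
    then obtain k where n: "n = Suc (Suc k)" by (metis One_nat_def Suc_le_mono le0 not0_implies_Suc)
    have "1 + real (Suc k) * (y - 1) \<le> y ^ Suc k" using Bernoulli_inequality[of "y - 1" "Suc k"] y by simp
    moreover have "0 < (1 - y) * (1 - y ^ Suc k)"
      using y by (intro mult_pos_pos) (auto intro: power_less_one_iff[THEN iffD2] simp del: power_Suc)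
    moreover have "d y n = d y (Suc k) + (1 - y) * (1 - y ^ Suc k)"
      unfolding n d_def by (simp add: algebra_simps)
    ultimately show False using zero[OF that] by (simp add: d_def)
  qed
  have id: "pgf p z = z" if "0 \<le> z" "z \<le> 1" for z
  proof -
    have "d z n = 0" if "n \<in> set_pmf p" for n
      using small[OF that] by (cases n) (auto simp: d_def)
    then have "(\<integral>n. d z n \<partial>measure_pmf p) = 0"
      by (intro integral_eq_zero_AE) (simp add: AE_measure_pmf_iff)
    with d_eq[OF that] show ?thesis by simp
  qed
  obtain a where a: "\<And>x. a \<le> x \<Longrightarrow> 0 < L x" using slow by (auto simp: slowly_varying_def)
  define x where "x = max a 1"
  have "0 < L x" "1 \<le> x" by (auto simp: x_def a)
  then have "0 < (1 - (1 - 1 / x)) powr (\<gamma> + 1) * L (1 / (1 - (1 - 1 / x)))" by simp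
  moreover have "pgf p (1 - 1 / x) = 1 - 1 / x" using \<open>1 \<le> x\<close> by (intro id) auto
  ultimately show False using offspring[of "1 - 1 / x"] \<open>1 \<le> x\<close> by simp
qed

lemma F_bounds: "0 \<le> s \<Longrightarrow> s \<le> 1 \<Longrightarrow> s \<le> F t s" "0 \<le> s \<Longrightarrow> s \<le> 1 \<Longrightarrow> F t s \<le> 1"
  using branching_pgf_bounds[OF rate critical] by auto

lemma measurable_F [measurable]: "(\<lambda>t. F t s) \<in> borel_measurable borel"
  using measurable_branching_pgf[OF rate critical] .

text \<open>The renewal equation after reversing time, which makes the dependence on \<open>t\<close> explicit and thereby
  shows that \<open>F\<close> is continuous, then differentiable.\<close>

lemma F_integral_equation:
  assumes s: "0 \<le> s" "s \<le> 1" and t: "0 \<le> t"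
  shows "F t s = exp (- \<mu> * t) * (s + integral {0..t} (\<lambda>w. \<mu> * exp (\<mu> * w) * pgf p (F w s)))"
    and "(\<lambda>w. \<mu> * exp (\<mu> * w) * pgf p (F w s)) integrable_on {0..t}"
proof -
  let ?k = "\<lambda>w. \<mu> * exp (\<mu> * w) * pgf p (F w s)"
  have pgf_b: "0 \<le> pgf p (F w s)" "pgf p (F w s) \<le> 1" for w
    using order_trans[OF s(1) F_bounds(1)[OF s]] F_bounds(2)[OF s] by (auto intro: pgf_nonneg pgf_le_one)
  have k: "set_integrable lborel {0..t} ?k"
  proof (rule set_integrable_bound)
    show "set_integrable lborel {0..t} (\<lambda>w. \<mu> * exp (\<mu> * w))"
      by (intro borel_integrable_atLeastAtMost' continuous_intros)
    show "set_borel_measurable lborel {0..t} ?k" unfolding set_borel_measurable_def by measurable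
    show "AE w in lborel. w \<in> {0..t} \<longrightarrow> norm (?k w) \<le> norm (\<mu> * exp (\<mu> * w))"
      using pgf_b rate by (intro AE_I2) (auto simp: abs_mult intro: mult_left_le)
  qed
  from set_borel_integral_eq_integral[OF k]
  have k_eq: "(LBINT w:{0..t}. ?k w) = integral {0..t} ?k" by simp
  show "?k integrable_on {0..t}" by (rule set_borel_integral_eq_integral[OF k])
  have "(LBINT v:{0..t}. \<mu> * exp (- \<mu> * v) * pgf p (F (t - v) s)) =
      (\<integral>v. indicator {0..t} v * (\<mu> * exp (- \<mu> * v) * pgf p (F (t - v) s)) \<partial>lborel)"
    by (simp add: set_lebesgue_integral_def)
  also have "\<dots> = (\<integral>w. indicator {0..t} (t - w) * (\<mu> * exp (- \<mu> * (t - w)) * pgf p (F w s)) \<partial>lborel)"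
    by (subst lborel_integral_real_affine[of "-1" _ t]) auto
  also have "\<dots> = (\<integral>w. exp (- \<mu> * t) * (indicator {0..t} w * ?k w) \<partial>lborel)"
  proof (intro Bochner_Integration.integral_cong refl)
    fix w
    have "exp (- \<mu> * (t - w)) = exp (- \<mu> * t) * exp (\<mu> * w)"
      by (simp add: exp_add[symmetric] algebra_simps)
    moreover have "indicator {0..t} (t - w) = (indicator {0..t} w :: real)" by (auto simp: indicator_def)
    ultimately show "indicator {0..t} (t - w) * (\<mu> * exp (- \<mu> * (t - w)) * pgf p (F w s)) =
        exp (- \<mu> * t) * (indicator {0..t} w * ?k w)" by simp
  qed
  also have "\<dots> = exp (- \<mu> * t) * integral {0..t} ?k"
    unfolding k_eq[symmetric] by (simp add: set_lebesgue_integral_def)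
  finally show "F t s = exp (- \<mu> * t) * (s + integral {0..t} ?k)"
    using branching_pgf_renewal[OF rate critical s t] by (simp add: algebra_simps)
qed

lemma continuous_on_F: assumes s: "0 \<le> s" "s \<le> 1" shows "continuous_on {0..T} (\<lambda>t. F t s)"
proof (cases "0 \<le> T")
  case True
  have "continuous_on {0..T} (\<lambda>t. exp (- \<mu> * t) * (s + integral {0..t} (\<lambda>w. \<mu> * exp (\<mu> * w) * pgf p (F w s))))"
    by (intro continuous_intros indefinite_integral_continuous_1 F_integral_equation(2)[OF s True])
  then show ?thesis
    by (rule continuous_on_eq) (use F_integral_equation(1)[OF s] in simp)
qed simp

lemma F_derivative:
  assumes s: "0 \<le> s" "s \<le> 1" and t: "t \<in> {0..T}"
  shows "((\<lambda>t. F t s) has_real_derivative \<mu> * (pgf p (F t s) - F t s)) (at t within {0..T})"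
proof -
  let ?k = "\<lambda>w. \<mu> * exp (\<mu> * w) * pgf p (F w s)"
  have F01: "F w s \<in> {0..1}" for w
    using order_trans[OF s(1) F_bounds(1)[OF s]] F_bounds(2)[OF s] by auto
  have "continuous_on {0..T} (\<lambda>w. pgf p (F w s))"
    using F01 by (intro continuous_on_compose2[OF continuous_on_pgf continuous_on_F[OF s]]) auto
  then have "continuous_on {0..T} ?k" by (intro continuous_intros)
  then have "((\<lambda>t. integral {0..t} ?k) has_real_derivative ?k t) (at t within {0..T})"
    by (rule integral_has_real_derivative[OF _ t])
  then have D: "((\<lambda>t. exp (- \<mu> * t) * (s + integral {0..t} ?k)) has_real_derivative
      exp (- \<mu> * t) * (?k t) - \<mu> * exp (- \<mu> * t) * (s + integral {0..t} ?k)) (at t within {0..T})"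
    by (auto intro!: derivative_eq_intros)
  have "exp (- \<mu> * t) * (?k t) - \<mu> * exp (- \<mu> * t) * (s + integral {0..t} ?k) = \<mu> * (pgf p (F t s) - F t s)"
  proof -
    have "exp (- \<mu> * t) * exp (\<mu> * t) = 1" by (simp add: exp_add[symmetric])
    then have 1: "exp (- \<mu> * t) * (?k t) = \<mu> * pgf p (F t s)"
      by (metis mult.assoc mult.commute mult.left_neutral)
    have 2: "\<mu> * exp (- \<mu> * t) * (s + integral {0..t} ?k) = \<mu> * F t s"
      using F_integral_equation(1)[OF s, of t] t by simp
    show ?thesis unfolding 1 2 by (rule right_diff_distrib[symmetric])
  qed
  with D have "((\<lambda>t. exp (- \<mu> * t) * (s + integral {0..t} ?k)) has_real_derivative
      \<mu> * (pgf p (F t s) - F t s)) (at t within {0..T})" by simp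
  then show ?thesis
    by (rule has_field_derivative_transform_within[where d=1])
       (use t F_integral_equation(1)[OF s] in simp_all)
qed

lemma F_zero: "0 \<le> s \<Longrightarrow> s \<le> 1 \<Longrightarrow> F 0 s = s"
  using F_integral_equation(1)[of s 0] by simp

text \<open>With probability \<open>exp (- \<mu>t)\<close> the initial particle is still alive and contributes \<open>s\<close>; otherwise
  the contribution is at most 1. This keeps \<open>F\<close> away from the singularity of \<open>1 / (f(u) - u)\<close> at 1.\<close>

lemma F_less_one:
  assumes s: "0 \<le> s" "s < 1" and t: "0 \<le> t"
  shows "F t s \<le> 1 - (1 - s) * exp (- \<mu> * t)"
proof -
  have s': "s \<le> 1" using s by simp
  have "integral {0..t} (\<lambda>w. \<mu> * exp (\<mu> * w) * pgf p (F w s)) \<le> integral {0..t} (\<lambda>w. \<mu> * exp (\<mu> * w))"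
  proof (rule integral_le[OF F_integral_equation(2)[OF s(1) s' t]])
    show "(\<lambda>w. \<mu> * exp (\<mu> * w)) integrable_on {0..t}"
      by (intro integrable_continuous_real continuous_intros)
    show "\<mu> * exp (\<mu> * w) * pgf p (F w s) \<le> \<mu> * exp (\<mu> * w)" for w
      using rate order_trans[OF s(1) F_bounds(1)[OF s(1) s']] F_bounds(2)[OF s(1) s']
      by (intro mult_left_le) (auto intro: pgf_le_one)
  qed
  also have "\<dots> = exp (\<mu> * t) - exp (\<mu> * 0)"
    by (intro integral_unique fundamental_theorem_of_calculus t)
       (auto intro!: derivative_eq_intros simp flip: has_real_derivative_iff_has_vector_derivative)
  finally have "F t s \<le> exp (- \<mu> * t) * (s + (exp (\<mu> * t) - 1))"
    unfolding F_integral_equation(1)[OF s(1) s' t] by simp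
  also have "\<dots> = 1 - (1 - s) * exp (- \<mu> * t)"
    by (simp add: algebra_simps exp_add[symmetric])
  finally show ?thesis .
qed

lemma V_integrand_continuous: "b < 1 \<Longrightarrow> continuous_on {0..b} (\<lambda>u. 1 / (pgf p u - u))"
proof (intro continuous_intros)
  assume b: "b < 1"
  show "continuous_on {0..b} (pgf p)"
    by (rule continuous_on_subset[OF continuous_on_pgf]) (use b in auto)
  show "\<forall>u\<in>{0..b}. pgf p u - u \<noteq> 0" using pgf_gt b by force
qed

text \<open>\<open>V\<close> in the variable \<open>u = 1 - 1/x\<close>, as a Henstock-Kurzweil integral to have the fundamental
  theorem of calculus at hand.\<close>

definition \<Phi> :: "real \<Rightarrow> real" where "\<Phi> y = integral {0..y} (\<lambda>u. 1 / (pgf p u - u))"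

lemma V_eq_\<Phi>: assumes "1 \<le> x" shows "V x = \<Phi> (1 - 1 / x)"
proof -
  have "1 - 1 / x < 1" using assms by simp
  from borel_integrable_atLeastAtMost'[OF V_integrand_continuous[OF this]]
  show ?thesis unfolding V_fun_def \<Phi>_def by (rule set_borel_integral_eq_integral)
qed

lemma \<Phi>_derivative:
  assumes "y \<in> {0..b}" "b < 1"
  shows "(\<Phi> has_real_derivative 1 / (pgf p y - y)) (at y within {0..b})"
  unfolding \<Phi>_def by (rule integral_has_real_derivative[OF V_integrand_continuous[OF assms(2)] assms(1)])

text \<open>Separation of variables in \<open>dF/dt = \<mu> (f(F) - F)\<close>.\<close>

lemma \<Phi>_F:
  assumes s: "0 \<le> s" "s < 1" and t: "0 \<le> t"
  shows "\<Phi> (F t s) = \<Phi> s + \<mu> * t"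
proof -
  define b where "b = 1 - (1 - s) * exp (- \<mu> * t)"
  have b: "b < 1" using s by (simp add: b_def)
  have F_b: "F w s \<in> {0..b}" if w: "w \<in> {0..t}" for w
  proof -
    have "F w s \<le> 1 - (1 - s) * exp (- \<mu> * w)" using F_less_one[OF s, of w] w by simp
    also have "\<dots> \<le> b" unfolding b_def using s w rate by (intro diff_left_mono mult_left_mono) auto
    finally show ?thesis using order_trans[OF s(1) F_bounds(1)[of s w]] s by simp
  qed
  have "((\<lambda>w. \<Phi> (F w s) - \<mu> * w) has_real_derivative 0) (at w within {0..t})" if w: "w \<in> {0..t}" for w
  proof -
    have "(\<Phi> has_real_derivative 1 / (pgf p (F w s) - F w s)) (at (F w s) within (\<lambda>w. F w s) ` {0..t})"
      by (rule has_field_derivative_subset[OF \<Phi>_derivative[OF F_b[OF w] b]]) (use F_b in blast)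
    from DERIV_image_chain[OF this F_derivative[OF s(1) _ w]] s
    have "((\<lambda>w. \<Phi> (F w s)) has_real_derivative 1 / (pgf p (F w s) - F w s) * (\<mu> * (pgf p (F w s) - F w s)))
        (at w within {0..t})" by (simp add: o_def)
    moreover have "pgf p (F w s) - F w s \<noteq> 0" using pgf_gt[of "F w s"] F_b[OF w] b by simp
    ultimately have "((\<lambda>w. \<Phi> (F w s)) has_real_derivative \<mu>) (at w within {0..t})" by simp
    then show ?thesis by (auto intro!: derivative_eq_intros)
  qed
  then obtain c where "\<And>w. w \<in> {0..t} \<Longrightarrow> \<Phi> (F w s) - \<mu> * w = c"
    using has_field_derivative_zero_constant[of "{0..t}" "\<lambda>w. \<Phi> (F w s) - \<mu> * w"] by auto
  from this[of 0] this[of t] t show ?thesis using F_zero[of s] s by simp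
qed

lemma V_one [simp]: "V 1 = 0" by (simp add: V_eq_\<Phi> \<Phi>_def)

lemma V_derivative:
  assumes x: "1 \<le> x"
  shows "(V has_real_derivative x powr (\<gamma> - 1) / L x) (at x within {1..})"
    and L_pos: "0 < L x"
proof -
  have y: "0 \<le> 1 - 1 / x" "1 - 1 / x < 1" using x by auto
  have pw: "1 - (1 - 1 / x) = 1 / x" "1 / (1 / x) = x" by auto
  have gap: "pgf p (1 - 1 / x) - (1 - 1 / x) = x powr (- \<gamma> - 1) * L x"
    using offspring[OF y] x by (simp add: pw powr_divide powr_minus_divide[symmetric])
  have "0 < x powr (- \<gamma> - 1)" using x by simp
  moreover have "0 < x powr (- \<gamma> - 1) * L x" using pgf_gt[OF y] unfolding gap[symmetric] by simp
  ultimately show L: "0 < L x" by (rule zero_less_mult_pos[rotated])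
  define b where "b = 1 - 1 / (x + 1)"
  have sub: "(\<lambda>z. 1 - 1 / z) ` {1..x + 1} \<subseteq> {0..b}" using x by (auto simp: b_def frac_le)
  have "(\<Phi> has_real_derivative 1 / (pgf p (1 - 1 / x) - (1 - 1 / x))) (at (1 - 1 / x) within (\<lambda>z. 1 - 1 / z) ` {1..x + 1})"
    by (rule has_field_derivative_subset[OF \<Phi>_derivative sub]) (use x in \<open>auto simp: b_def frac_le\<close>)
  moreover have "((\<lambda>z. 1 - 1 / z) has_real_derivative 1 / x ^ 2) (at x within {1..x + 1})"
    using x by (auto intro!: derivative_eq_intros simp: power2_eq_square)
  ultimately have "(\<Phi> \<circ> (\<lambda>z. 1 - 1 / z) has_real_derivative 1 / (x powr (- \<gamma> - 1) * L x) * (1 / x ^ 2)) (at x within {1..x + 1})"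
    unfolding gap by (rule DERIV_image_chain)
  also have "1 / (x powr (- \<gamma> - 1) * L x) * (1 / x ^ 2) = x powr (\<gamma> - 1) / L x"
  proof -
    have "x powr (\<gamma> - 1) * (x powr (- \<gamma> - 1) * x ^ 2) = 1"
      using x by (simp add: powr_add[symmetric] flip: powr_numeral)
    then show ?thesis using x L by (simp add: field_simps)
  qed
  finally have "(V has_real_derivative x powr (\<gamma> - 1) / L x) (at x within {1..x + 1})"
    by (rule has_field_derivative_transform_within[where d=1]) (use x in \<open>auto simp: V_eq_\<Phi>\<close>)
  moreover have "at x within {1..x + 1} = at x within {1..}"
    by (rule at_within_nhd[of _ "{..<x + 1}"]) auto
  ultimately show "(V has_real_derivative x powr (\<gamma> - 1) / L x) (at x within {1..})" by simp
qed

lemma continuous_on_V: "continuous_on {1..} V"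
  by (rule DERIV_continuous_on[where D="\<lambda>x. x powr (\<gamma> - 1) / L x"]) (simp add: V_derivative(1))

lemma V_strict_mono: "strict_mono_on {1..} V"
proof (rule strict_mono_onI)
  fix x y :: real assume "x \<in> {1..}" "y \<in> {1..}" "x < y"
  show "V x < V y"
  proof (rule DERIV_pos_imp_increasing_open[OF \<open>x < y\<close>])
    fix z assume z: "x < z" "z < y"
    then have "at z within {1..} = at z" using \<open>x \<in> {1..}\<close> by (intro at_within_interior) (auto simp: interior_real_atLeast)
    then show "\<exists>d. (V has_real_derivative d) (at z) \<and> 0 < d"
      using V_derivative(1)[of z] L_pos[of z] z \<open>x \<in> {1..}\<close> by (intro exI[of _ "z powr (\<gamma> - 1) / L z"]) auto
  next
    show "continuous_on {x..y} V"
      by (rule continuous_on_subset[OF continuous_on_V]) (use \<open>x \<in> {1..}\<close> in auto)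
  qed
qed

text \<open>\<open>V\<close> is unbounded, because \<open>f(u) - u \<le> 1 - u\<close>.\<close>

lemma V_ge_ln: assumes x: "1 \<le> x" shows "ln x \<le> V x"
proof -
  have b: "1 - 1 / x < 1" using x by simp
  have "((\<lambda>u. 1 / (1 - u)) has_integral - ln (1 - (1 - 1 / x)) - (- ln (1 - 0))) {0..1 - 1 / x}"
  proof (rule fundamental_theorem_of_calculus)
    fix u assume "u \<in> {0..1 - 1 / x}"
    then have "u < 1" using le_less_trans[OF _ b] by simp
    then have "((\<lambda>u. - ln (1 - u)) has_real_derivative 1 / (1 - u)) (at u within {0..1 - 1 / x})"
      by (auto intro!: derivative_eq_intros)
    then show "((\<lambda>u. - ln (1 - u)) has_vector_derivative 1 / (1 - u)) (at u within {0..1 - 1 / x})"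
      by (simp add: has_real_derivative_iff_has_vector_derivative)
  qed (use x in simp)
  then have "((\<lambda>u. 1 / (1 - u)) has_integral ln x) {0..1 - 1 / x}" using x by (simp add: ln_div)
  then show ?thesis
    unfolding V_eq_\<Phi>[OF x] \<Phi>_def
  proof (rule has_integral_le)
    show "((\<lambda>u. 1 / (pgf p u - u)) has_integral integral {0..1 - 1 / x} (\<lambda>u. 1 / (pgf p u - u))) {0..1 - 1 / x}"
      by (intro integrable_integral integrable_continuous_real V_integrand_continuous b)
    fix u assume "u \<in> {0..1 - 1 / x}"
    then have u: "0 \<le> u" "u < 1" using le_less_trans[OF _ b] by simp_all
    show "1 / (1 - u) \<le> 1 / (pgf p u - u)"
      using pgf_gt[OF u] pgf_le_one[of u p] u by (intro divide_left_mono mult_pos_pos) auto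
  qed
qed

lemma V_at_top: "filterlim V at_top at_top"
  by (rule filterlim_at_top_mono[OF ln_at_top])
     (auto intro: eventually_mono[OF eventually_ge_at_top[of 1]] V_ge_ln)

lemma V_image: "V ` {1..} = {0..}"
proof (intro equalityI subsetI)
  fix y assume "y \<in> V ` {1..}"
  then obtain x where "1 \<le> x" "y = V x" by auto
  then show "y \<in> {0..}" using order_trans[OF ln_ge_zero V_ge_ln, of x] by simp
next
  fix y :: real assume y: "y \<in> {0..}"
  have "1 \<le> exp y" using y by simp
  have "y \<le> V (exp y)" using V_ge_ln[of "exp y"] y by simp
  moreover have "continuous_on {1..exp y} V"
    by (rule continuous_on_subset[OF continuous_on_V]) auto
  ultimately obtain x where "1 \<le> x" "V x = y"
    using IVT'[of V 1 y "exp y"] y by auto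
  then show "y \<in> V ` {1..}" by force
qed

lemma V_inj: "inj_on V {1..}"
  using V_strict_mono by (rule strict_mono_on_imp_inj_on)

lemma W_right_inverse: assumes "0 \<le> y" shows "1 \<le> W y" "V (W y) = y"
proof -
  have y: "y \<in> V ` {1..}" using assms V_image by simp
  show "1 \<le> W y" using the_inv_into_into[OF V_inj y subset_refl] by (simp add: W_fun_def)
  show "V (W y) = y" using f_the_inv_into_f[OF V_inj y] by (simp add: W_fun_def)
qed

lemma W_V: "1 \<le> x \<Longrightarrow> W (V x) = x"
  using the_inv_into_f_f[OF V_inj, of x] by (simp add: W_fun_def)

lemma W_mono: assumes "0 \<le> x" "x \<le> y" shows "W x \<le> W y"
proof (rule ccontr)
  assume "\<not> W x \<le> W y"
  then have "V (W y) < V (W x)"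
    using V_strict_mono W_right_inverse[of x] W_right_inverse[of y] assms
    by (intro strict_mono_onD[OF V_strict_mono]) auto
  then show False using W_right_inverse[of x] W_right_inverse[of y] assms by simp
qed

lemma W_at_top: "filterlim W at_top at_top"
  unfolding filterlim_at_top
proof
  fix z :: real
  have "z \<le> W y" if "V (max 1 z) \<le> y" for y
  proof -
    have "0 \<le> V (max 1 z)" using V_image by force
    from W_mono[OF this that] W_V[of "max 1 z"] show ?thesis by simp
  qed
  then show "\<forall>\<^sub>F y in at_top. z \<le> W y" by (auto simp: eventually_at_top_linorder)
qed

lemma survival:
  assumes s: "0 \<le> s" "s < 1" and t: "0 \<le> t"
  shows "1 - F t s = 1 / W (\<mu> * t + V (1 / (1 - s)))"
proof -
  have "F t s < 1" using F_less_one[OF s t] s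
    by (smt (verit) exp_gt_zero mult_pos_pos)
  define x where "x = 1 / (1 - F t s)"
  have F0: "0 \<le> F t s" using order_trans[OF s(1) F_bounds(1)[of s t]] s by simp
  have x: "1 \<le> x" "1 - 1 / x = F t s" using \<open>F t s < 1\<close> F0 by (auto simp: x_def field_simps)
  have "1 \<le> 1 / (1 - s)" using s by (simp add: field_simps)
  then have "V x = \<mu> * t + V (1 / (1 - s))"
    using \<Phi>_F[OF s t] by (simp add: V_eq_\<Phi> x)
  then have "W (\<mu> * t + V (1 / (1 - s))) = x" using W_V[OF x(1)] by simp
  then show ?thesis by (simp add: x_def)
qed

text \<open>By l'Hospital's rule, since the derivative \<open>x\<^bsup>\<gamma>-1\<^esup> / L(x)\<close> is regularly varying.\<close>

lemma V_regularly_varying: "regularly_varying V \<gamma>"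
  unfolding regularly_varying_def
proof (intro conjI allI impI)
  show "\<forall>\<^sub>F x in at_top. 0 < V x"
    using V_at_top by (simp add: filterlim_at_top_dense)
  fix c :: real assume c: "0 < c"
  have deriv: "(V has_real_derivative x powr (\<gamma> - 1) / L x) (at x)" if "1 < x" for x
  proof -
    have "at x within {1..} = at x" using that by (intro at_within_interior) (auto simp: interior_real_atLeast)
    with V_derivative(1)[of x] that show ?thesis by simp
  qed
  define X where "X = max 1 (1 / c) + 1"
  have X: "1 < x" "1 < c * x" if "X \<le> x" for x
  proof -
    show "1 < x" using that by (simp add: X_def)
    have "1 / c < x" using that by (simp add: X_def)
    then show "1 < c * x" using c by (simp add: field_simps)
  qed
  have evX: "\<forall>\<^sub>F x in at_top. X \<le> x" by (rule eventually_ge_at_top)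
  show "((\<lambda>x. V (c * x) / V x) \<longlongrightarrow> c powr \<gamma>) at_top"
  proof (rule lhospital_at_top_at_top[OF V_at_top])
    show "\<forall>\<^sub>F x in at_top. x powr (\<gamma> - 1) / L x \<noteq> 0"
      using evX
    proof eventually_elim
      case (elim x)
      then show ?case using X(1)[of x] L_pos[of x] by auto
    qed
    show "\<forall>\<^sub>F x in at_top. ((\<lambda>x. V (c * x)) has_real_derivative (c * x) powr (\<gamma> - 1) / L (c * x) * c) (at x)"
      using evX
    proof eventually_elim
      case (elim x)
      have "((\<lambda>x. c * x) has_real_derivative c) (at x)" by (auto intro!: derivative_eq_intros)
      from DERIV_chain2[OF deriv[OF X(2)[OF elim]] this] show ?case .
    qed
    show "\<forall>\<^sub>F x in at_top. (V has_real_derivative x powr (\<gamma> - 1) / L x) (at x)"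
      using evX by eventually_elim (rule deriv, rule X(1))
    have "((\<lambda>x. c powr \<gamma> * (1 / (L (c * x) / L x))) \<longlongrightarrow> c powr \<gamma> * (1 / 1)) at_top"
      using slow c by (intro tendsto_intros) (auto simp: slowly_varying_def)
    moreover have "\<forall>\<^sub>F x in at_top. c powr \<gamma> * (1 / (L (c * x) / L x)) =
        ((c * x) powr (\<gamma> - 1) / L (c * x) * c) / (x powr (\<gamma> - 1) / L x)"
      using evX
    proof eventually_elim
      case (elim x)
      have "(c * x) powr (\<gamma> - 1) * c = c powr \<gamma> * x powr (\<gamma> - 1)"
        using c X[OF elim] by (simp add: powr_mult powr_diff)
      moreover have "0 < L x" "0 < L (c * x)" using L_pos X[OF elim] by auto
      moreover have "0 < x powr (\<gamma> - 1)" using X[OF elim] by simp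
      ultimately show ?case by (simp add: field_simps)
    qed
    ultimately show "((\<lambda>x. ((c * x) powr (\<gamma> - 1) / L (c * x) * c) / (x powr (\<gamma> - 1) / L x)) \<longlongrightarrow> c powr \<gamma>) at_top"
      by (simp add: Lim_transform_eventually)
  qed
qed

lemma V_mono: "mono_on {1..} V"
  using V_strict_mono by (rule strict_mono_on_imp_mono_on)

lemma W_regularly_varying: "regularly_varying W (1 / \<gamma>)"
  using W_right_inverse by (intro regularly_varying_right_inverse[OF V_regularly_varying gamma V_mono _ W_at_top]) auto

end

section \<open>Product functionals of the Poisson process\<close>

lemma prod_if_le_eq:
  fixes f :: "nat \<Rightarrow> real"
  assumes "n \<le> K" shows "(\<Prod>k=1..K. if k \<le> n then f k else 1) = (\<Prod>k=1..n. f k)"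
  using assms by (intro prod.mono_neutral_cong_right) auto

lemma expectation_poisson_power:
  assumes "0 < m" "0 \<le> c" "c \<le> 1"
  shows "measure_pmf.expectation (poisson_pmf m) (\<lambda>n. c ^ n) = exp (- m * (1 - c))"
proof -
  have nn: "(\<integral>\<^sup>+n. ennreal (c ^ n) \<partial>measure_pmf (poisson_pmf m)) = ennreal (exp (- m * (1 - c)))"
  proof -
    have "(\<integral>\<^sup>+n. ennreal (c ^ n) \<partial>measure_pmf (poisson_pmf m)) =
        (\<integral>\<^sup>+n. ennreal (exp (- m) * ((m * c) ^ n / fact n)) \<partial>count_space UNIV)"
      unfolding nn_integral_measure_pmf using assms
      by (intro nn_integral_cong) (simp add: ennreal_mult'[symmetric] power_mult_distrib mult_ac)
    also have "\<dots> = (\<Sum>n. ennreal (exp (- m) * ((m * c) ^ n / fact n)))"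
      by (rule nn_integral_count_space_nat)
    also have "\<dots> = ennreal (exp (- m) * exp (m * c))"
    proof (rule suminf_ennreal_eq)
      have "(\<lambda>n. (m * c) ^ n / fact n) sums exp (m * c)"
        using exp_converges[of "m * c"] by (simp add: field_simps)
      then show "(\<lambda>n. exp (- m) * ((m * c) ^ n / fact n)) sums (exp (- m) * exp (m * c))"
        by (rule sums_mult)
    qed (use assms in auto)
    also have "exp (- m) * exp (m * c) = exp (- m * (1 - c))"
      by (simp add: exp_add[symmetric] algebra_simps)
    finally show ?thesis .
  qed
  show ?thesis
    by (subst integral_eq_nn_integral) (use nn assms in auto)
qed

context poisson_process
begin

lemma measurable_count [measurable]: "0 \<le> t \<Longrightarrow> \<nu> t \<in> measurable M (count_space UNIV)"
  using count_measurable by simp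

lemma set_integrable_intensity: "0 \<le> a \<Longrightarrow> set_integrable lborel {a..b} r"
proof (cases "a \<le> b")
  case True
  assume "0 \<le> a"
  with True show ?thesis
    by (intro set_integrable_subset[OF intensity_integrable[of b]]) auto
qed simp

lemma intensity_integral_nonneg: assumes "0 \<le> a" shows "0 \<le> (LBINT u:{a..b}. r u)"
proof -
  have "AE u in lborel. u \<noteq> (0::real)" using AE_lborel_singleton by auto
  then have "AE u in lborel. 0 \<le> indicator {a..b} u *\<^sub>R r u"
  proof eventually_elim
    case (elim u)
    then show ?case using intensity_nonneg[of u] assms by (cases "u \<in> {a..b}") auto
  qed
  then show ?thesis unfolding set_lebesgue_integral_def by (rule integral_nonneg_AE)
qed

lemma expectation_increment_power:
  assumes st: "0 \<le> s" "s \<le> t" and c: "0 \<le> c" "c \<le> 1"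
  shows "expectation (\<lambda>\<omega>. c ^ (\<nu> t \<omega> - \<nu> s \<omega>)) = exp (- (LBINT u:{s..t}. r u) * (1 - c))"
proof -
  let ?m = "LBINT u:{s..t}. r u"
  have [measurable]: "\<nu> t \<in> measurable M (count_space UNIV)" "\<nu> s \<in> measurable M (count_space UNIV)"
    using st by (auto intro: count_measurable)
  have "expectation (\<lambda>\<omega>. c ^ (\<nu> t \<omega> - \<nu> s \<omega>)) =
      (\<integral>n. c ^ n \<partial>distr M (count_space UNIV) (\<lambda>\<omega>. \<nu> t \<omega> - \<nu> s \<omega>))"
    by (subst integral_distr) auto
  also have "\<dots> = measure_pmf.expectation (poisson_pmf ?m) (\<lambda>n. c ^ n)"
    using count_increment[OF st] by simp
  also have "\<dots> = exp (- ?m * (1 - c))"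
  proof (cases "0 < ?m")
    case True
    then show ?thesis using c by (rule expectation_poisson_power)
  next
    \<comment> \<open>The Poisson formula holds for positive rates; at rate 0 the law is that of the increment
      over an interval of length 0.\<close>
    case False
    then have 0: "?m = 0" using intensity_integral_nonneg[OF st(1), of t] by simp
    have "AE u in lborel. indicator {0..0::real} u *\<^sub>R r u = 0"
      using AE_lborel_singleton[of "0::real"] by eventually_elim (simp add: indicator_def)
    then have "(LBINT u:{0..0}. r u) = 0"
      unfolding set_lebesgue_integral_def by (rule integral_eq_zero_AE)
    then have "measure_pmf (poisson_pmf 0) = distr M (count_space UNIV) (\<lambda>\<omega>. 0)"
      using count_increment[of 0 0] by simp
    then have "measure_pmf.expectation (poisson_pmf 0) (\<lambda>n. c ^ n) = 1"
      by (simp add: integral_return)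
    then show ?thesis unfolding 0 by simp
  qed
  finally show ?thesis .
qed

text \<open>Right continuity of the paths makes the infimum defining the jump point a minimum.\<close>

lemma jump_point_le_iff:
  assumes \<omega>: "\<omega> \<in> space M" and t: "0 \<le> t" "k \<le> \<nu> t \<omega>" and u: "0 \<le> u"
  shows "jump_point \<nu> k \<omega> \<le> u \<longleftrightarrow> k \<le> \<nu> u \<omega>"
proof
  let ?A = "{t. 0 \<le> t \<and> k \<le> \<nu> t \<omega>}"
  have bdd: "bdd_below ?A" by (rule bdd_belowI[of _ 0]) auto
  { assume "k \<le> \<nu> u \<omega>"
    then show "jump_point \<nu> k \<omega> \<le> u"
      unfolding jump_point_def using u by (intro cInf_lower bdd) auto }
  assume le: "jump_point \<nu> k \<omega> \<le> u"
  show "k \<le> \<nu> u \<omega>"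
  proof (rule ccontr)
    assume "\<not> k \<le> \<nu> u \<omega>"
    obtain b where b: "u < b" "\<And>v. u < v \<Longrightarrow> v < b \<Longrightarrow> \<nu> v \<omega> = \<nu> u \<omega>"
      using count_right_continuous[OF \<omega> u] unfolding eventually_at_right_field by auto
    define v where "v = (u + b) / 2"
    have v: "u < v" "v < b" using b(1) by (auto simp: v_def)
    have "v \<le> x" if "x \<in> ?A" for x
    proof (rule ccontr)
      assume "\<not> v \<le> x"
      then have "\<nu> x \<omega> \<le> \<nu> v \<omega>" using that by (intro count_mono[OF \<omega>]) auto
      with that b(2)[OF v] \<open>\<not> k \<le> \<nu> u \<omega>\<close> show False by auto
    qed
    then have "v \<le> jump_point \<nu> k \<omega>"
      unfolding jump_point_def using t by (intro cInf_greatest) auto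
    with v le show False by simp
  qed
qed

lemma jump_point_bounds:
  assumes "\<omega> \<in> space M" "0 \<le> t" "k \<le> \<nu> t \<omega>"
  shows "0 \<le> jump_point \<nu> k \<omega>" "jump_point \<nu> k \<omega> \<le> t"
proof -
  show "jump_point \<nu> k \<omega> \<le> t" using jump_point_le_iff[OF assms assms(2)] assms by simp
  show "0 \<le> jump_point \<nu> k \<omega>"
    unfolding jump_point_def using assms by (intro cInf_greatest) auto
qed

text \<open>Moving every jump to the next point of a grid turns the product into one over independent Poisson
  increments, whose expectation is the exponential of a Riemann sum. The mesh then tends to 0.\<close>

lemma poisson_functional:
  assumes t: "0 \<le> t" and \<phi>: "continuous_on {0..t} \<phi>" "\<And>u. u \<in> {0..t} \<Longrightarrow> 0 \<le> \<phi> u \<and> \<phi> u \<le> 1"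
  shows "expectation (\<lambda>\<omega>. \<Prod>k=1..\<nu> t \<omega>. \<phi> (jump_point \<nu> k \<omega>)) =
    exp (- (LBINT u:{0..t}. r u * (1 - \<phi> u)))"
proof -
  \<comment> \<open>The grid continues beyond \<open>t\<close>, because the independence of increments is stated for infinite
    sequences of times.\<close>
  define \<tau> where "\<tau> N i = t * real i / real (Suc N)" for N i
  have \<tau>_nonneg: "0 \<le> \<tau> N i" for N i using t by (simp add: \<tau>_def)
  have \<tau>_mono: "\<tau> N i \<le> \<tau> N j" if "i \<le> j" for N i j
    using t that by (simp add: \<tau>_def divide_right_mono mult_left_mono)
  have \<tau>_0: "\<tau> N 0 = 0" and \<tau>_end: "\<tau> N (Suc N) = t" for N by (simp_all add: \<tau>_def)
  have \<tau>_le: "\<tau> N i \<le> t" if "i \<le> Suc N" for N i using \<tau>_mono[OF that, of N] \<tau>_end by simp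
  have \<tau>_step: "\<tau> N (Suc i) = \<tau> N i + t / real (Suc N)" for N i
    by (simp add: \<tau>_def add_divide_distrib distrib_left)
  define a where "a N \<omega> = (\<Prod>i<Suc N. \<phi> (\<tau> N (Suc i)) ^ (\<nu> (\<tau> N (Suc i)) \<omega> - \<nu> (\<tau> N i) \<omega>))" for N \<omega>
  have meas_\<nu>[measurable]: "\<nu> (\<tau> N i) \<in> measurable M (count_space UNIV)" for N i
    using \<tau>_nonneg by (rule count_measurable)
  have \<phi>\<tau>: "0 \<le> \<phi> (\<tau> N (Suc i))" "\<phi> (\<tau> N (Suc i)) \<le> 1" if "i < Suc N" for N i
    using \<phi>(2)[of "\<tau> N (Suc i)"] \<tau>_nonneg \<tau>_le[of "Suc i" N] that by auto
  \<comment> \<open>The grid point following the \<open>k\<close>-th jump.\<close>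
  define idx where "idx N k \<omega> = (LEAST i. k \<le> \<nu> (\<tau> N i) \<omega>)" for N k \<omega>
  have a_eq: "a N \<omega> = (\<Prod>k=1..\<nu> t \<omega>. \<phi> (\<tau> N (idx N k \<omega>)))" if \<omega>: "\<omega> \<in> space M" for N \<omega>
  proof -
    have mono: "\<nu> (\<tau> N i) \<omega> \<le> \<nu> (\<tau> N j) \<omega>" if "i \<le> j" for i j
      using count_mono[OF \<omega> \<tau>_nonneg \<tau>_mono[OF that]] .
    have "(\<Prod>i<m. \<phi> (\<tau> N (Suc i)) ^ (\<nu> (\<tau> N (Suc i)) \<omega> - \<nu> (\<tau> N i) \<omega>)) =
        (\<Prod>k=1..\<nu> (\<tau> N m) \<omega>. \<phi> (\<tau> N (idx N k \<omega>)))" for m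
    proof (induction m)
      case 0
      show ?case using count_0[OF \<omega>] by (simp add: \<tau>_0)
    next
      case (Suc m)
      have idx: "idx N k \<omega> = Suc m" if "k \<in> {\<nu> (\<tau> N m) \<omega><..\<nu> (\<tau> N (Suc m)) \<omega>}" for k
        unfolding idx_def
      proof (rule Least_equality)
        show "k \<le> \<nu> (\<tau> N (Suc m)) \<omega>" using that by simp
        fix i assume "k \<le> \<nu> (\<tau> N i) \<omega>"
        then show "Suc m \<le> i" using that mono[of i m] by (cases "i \<le> m") auto
      qed
      have split: "{1..\<nu> (\<tau> N (Suc m)) \<omega>} = {1..\<nu> (\<tau> N m) \<omega>} \<union> {\<nu> (\<tau> N m) \<omega><..\<nu> (\<tau> N (Suc m)) \<omega>}"
        using mono[of m "Suc m"] by auto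
      have "(\<Prod>k=1..\<nu> (\<tau> N (Suc m)) \<omega>. \<phi> (\<tau> N (idx N k \<omega>))) =
          (\<Prod>k=1..\<nu> (\<tau> N m) \<omega>. \<phi> (\<tau> N (idx N k \<omega>))) *
          (\<Prod>k\<in>{\<nu> (\<tau> N m) \<omega><..\<nu> (\<tau> N (Suc m)) \<omega>}. \<phi> (\<tau> N (idx N k \<omega>)))"
        unfolding split by (intro prod.union_disjoint) auto
      also have "(\<Prod>k\<in>{\<nu> (\<tau> N m) \<omega><..\<nu> (\<tau> N (Suc m)) \<omega>}. \<phi> (\<tau> N (idx N k \<omega>))) =
          (\<Prod>k\<in>{\<nu> (\<tau> N m) \<omega><..\<nu> (\<tau> N (Suc m)) \<omega>}. \<phi> (\<tau> N (Suc m)))"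
        by (intro prod.cong refl) (simp add: idx)
      finally show ?case using Suc by simp
    qed
    from this[of "Suc N"] show ?thesis unfolding a_def \<tau>_end .
  qed
  have a_lim: "(\<lambda>N. a N \<omega>) \<longlonglongrightarrow> (\<Prod>k=1..\<nu> t \<omega>. \<phi> (jump_point \<nu> k \<omega>))" if \<omega>: "\<omega> \<in> space M" for \<omega>
    unfolding a_eq[OF \<omega>]
  proof (rule tendsto_prod)
    fix k assume k: "k \<in> {1..\<nu> t \<omega>}"
    then have kt: "k \<le> \<nu> t \<omega>" by simp
    note bounds = jump_point_bounds[OF \<omega> t kt]
    have ex: "k \<le> \<nu> (\<tau> N (Suc N)) \<omega>" for N using kt by (simp add: \<tau>_end)
    have idx_k: "k \<le> \<nu> (\<tau> N (idx N k \<omega>)) \<omega>" and idx_le: "idx N k \<omega> \<le> Suc N" for N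
      unfolding idx_def by (rule LeastI[of _ "Suc N"], rule ex) (rule Least_le, rule ex)
    have lower: "jump_point \<nu> k \<omega> \<le> \<tau> N (idx N k \<omega>)" for N
      by (rule jump_point_le_iff[OF \<omega> t kt \<tau>_nonneg, THEN iffD2, OF idx_k])
    have upper: "\<tau> N (idx N k \<omega>) \<le> jump_point \<nu> k \<omega> + t / real (Suc N)" for N
    proof (cases "idx N k \<omega>")
      case 0
      then show ?thesis using bounds(1) t by (simp add: \<tau>_0)
    next
      case (Suc i)
      then have "\<not> k \<le> \<nu> (\<tau> N i) \<omega>" using not_less_Least[of i "\<lambda>i. k \<le> \<nu> (\<tau> N i) \<omega>"] by (simp add: idx_def)
      then have "\<tau> N i < jump_point \<nu> k \<omega>" using jump_point_le_iff[OF \<omega> t kt \<tau>_nonneg, of N i] by simp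
      then show ?thesis unfolding Suc \<tau>_step by simp
    qed
    have "(\<lambda>N. jump_point \<nu> k \<omega> + t / real (Suc N)) \<longlonglongrightarrow> jump_point \<nu> k \<omega> + 0"
      by (rule tendsto_add[OF tendsto_const LIMSEQ_Suc[OF lim_const_over_n[of t]]])
    then have "(\<lambda>N. jump_point \<nu> k \<omega> + t / real (Suc N)) \<longlonglongrightarrow> jump_point \<nu> k \<omega>"
      by (simp only: add_0_right)
    then have "(\<lambda>N. \<tau> N (idx N k \<omega>)) \<longlonglongrightarrow> jump_point \<nu> k \<omega>"
      by (rule tendsto_sandwich[OF always_eventually[OF allI[OF lower]]
            always_eventually[OF allI[OF upper]] tendsto_const])
    then show "(\<lambda>N. \<phi> (\<tau> N (idx N k \<omega>))) \<longlonglongrightarrow> \<phi> (jump_point \<nu> k \<omega>)"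
    proof (rule continuous_on_tendsto_compose[OF \<phi>(1)])
      show "jump_point \<nu> k \<omega> \<in> {0..t}" using bounds by simp
      show "\<forall>\<^sub>F N in sequentially. \<tau> N (idx N k \<omega>) \<in> {0..t}"
        using \<tau>_le[OF idx_le] \<tau>_nonneg by (intro always_eventually) simp
    qed
  qed
  have a_bound: "\<bar>a N \<omega>\<bar> \<le> 1" for N \<omega>
    unfolding a_def abs_prod using \<phi>\<tau>
    by (intro prod_le_1) (auto simp: power_abs power_le_one)
  have "(\<lambda>N. expectation (a N)) \<longlonglongrightarrow> expectation (\<lambda>\<omega>. \<Prod>k=1..\<nu> t \<omega>. \<phi> (jump_point \<nu> k \<omega>))"
  proof (rule integral_dominated_convergence[where w="\<lambda>_. 1"])
    show meas_a: "a N \<in> borel_measurable M" for N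
      unfolding a_def by (intro borel_measurable_prod measurable_power_nat) measurable
    show "(\<lambda>\<omega>. \<Prod>k=1..\<nu> t \<omega>. \<phi> (jump_point \<nu> k \<omega>)) \<in> borel_measurable M"
      by (rule borel_measurable_LIMSEQ_real[OF a_lim meas_a])
  qed (use a_lim a_bound in auto)
  moreover have "expectation (a N) = exp (- (\<Sum>i<Suc N. (LBINT u:{\<tau> N i..\<tau> N (Suc i)}. r u) * (1 - \<phi> (\<tau> N (Suc i)))))" for N
  proof -
    let ?X = "\<lambda>i \<omega>. \<phi> (\<tau> N (Suc i)) ^ (\<nu> (\<tau> N (Suc i)) \<omega> - \<nu> (\<tau> N i) \<omega>)"
    have "mono (\<tau> N)" using \<tau>_mono by (auto simp: mono_def)
    from count_indep_increments[OF this \<tau>_nonneg]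
    have "indep_vars (\<lambda>_. count_space UNIV) (\<lambda>i \<omega>. \<nu> (\<tau> N (Suc i)) \<omega> - \<nu> (\<tau> N i) \<omega>) {..<Suc N}"
      by (rule indep_vars_subset) simp
    from indep_vars_compose2[OF this, of "\<lambda>i n. \<phi> (\<tau> N (Suc i)) ^ n" "\<lambda>_. borel"]
    have ind: "indep_vars (\<lambda>_. borel) ?X {..<Suc N}" by simp
    have "integrable M (?X i)" if "i \<in> {..<Suc N}" for i
    proof (rule integrable_const_bound[where B=1])
      show "AE \<omega> in M. norm (?X i \<omega>) \<le> 1"
        using \<phi>\<tau>[of i N] that by (auto simp: power_abs power_le_one)
      show "?X i \<in> borel_measurable M" by (intro measurable_power_nat) measurable
    qed
    then have "expectation (a N) = (\<Prod>i<Suc N. expectation (?X i))"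
      unfolding a_def by (rule indep_vars_lebesgue_integral[OF finite_lessThan ind])
    also have "\<dots> = (\<Prod>i<Suc N. exp (- (LBINT u:{\<tau> N i..\<tau> N (Suc i)}. r u) * (1 - \<phi> (\<tau> N (Suc i)))))"
      using \<phi>\<tau> \<tau>_mono \<tau>_nonneg by (intro prod.cong refl expectation_increment_power) auto
    also have "\<dots> = exp (\<Sum>i<Suc N. - (LBINT u:{\<tau> N i..\<tau> N (Suc i)}. r u) * (1 - \<phi> (\<tau> N (Suc i))))"
      by (rule exp_sum[symmetric]) simp
    also have "(\<Sum>i<Suc N. - (LBINT u:{\<tau> N i..\<tau> N (Suc i)}. r u) * (1 - \<phi> (\<tau> N (Suc i)))) =
        - (\<Sum>i<Suc N. (LBINT u:{\<tau> N i..\<tau> N (Suc i)}. r u) * (1 - \<phi> (\<tau> N (Suc i))))"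
      unfolding sum_negf[symmetric] by (intro sum.cong refl) simp
    finally show ?thesis .
  qed
  moreover have "(\<lambda>N. \<Sum>i<Suc N. (LBINT u:{\<tau> N i..\<tau> N (Suc i)}. r u) * (1 - \<phi> (\<tau> N (Suc i))))
      \<longlonglongrightarrow> (LBINT u:{0..t}. r u * (1 - \<phi> u))"
  proof -
    have r\<phi>: "set_integrable lborel {a..b} (\<lambda>u. r u * (1 - \<phi> u))" if ab: "0 \<le> a" "b \<le> t" for a b
    proof (rule set_integrable_bound[OF set_integrable_intensity[OF ab(1), of b]])
      have "continuous_on {a..b} (\<lambda>u. 1 - \<phi> u)"
        by (intro continuous_on_diff continuous_on_const, rule continuous_on_subset[OF \<phi>(1)])
           (use ab in auto)
      then have "(\<lambda>u. indicator {a..b} u *\<^sub>R (1 - \<phi> u)) \<in> borel_measurable lborel"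
        using borel_measurable_continuous_on_indicator[of "{a..b}" "\<lambda>u. 1 - \<phi> u"] by simp
      moreover have "(\<lambda>u. indicator {a..b} u *\<^sub>R r u) \<in> borel_measurable lborel"
        using set_integrable_intensity[OF ab(1), of b] unfolding set_integrable_def by (rule borel_measurable_integrable)
      ultimately have "(\<lambda>u. (indicator {a..b} u *\<^sub>R r u) * (indicator {a..b} u *\<^sub>R (1 - \<phi> u))) \<in> borel_measurable lborel"
        by (rule borel_measurable_times[rotated])
      then show "set_borel_measurable lborel {a..b} (\<lambda>u. r u * (1 - \<phi> u))"
        unfolding set_borel_measurable_def
        by (rule measurable_cong[THEN iffD1, rotated]) (simp add: indicator_def)
      show "AE u in lborel. u \<in> {a..b} \<longrightarrow> norm (r u * (1 - \<phi> u)) \<le> norm (r u)"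
        using \<phi>(2) ab by (intro AE_I2) (auto simp: abs_mult intro!: mult_left_le)
    qed
    have split: "(\<Sum>i<m. LBINT u:{\<tau> N i..\<tau> N (Suc i)}. f u) = (LBINT u:{0..\<tau> N m}. f u)"
      if f: "\<And>a b. 0 \<le> a \<Longrightarrow> b \<le> t \<Longrightarrow> set_integrable lborel {a..b} f" and m: "m \<le> Suc N"
      for f :: "real \<Rightarrow> real" and m N
      using m
    proof (induction m)
      case 0
      have "AE u in lborel. indicator {0..0::real} u *\<^sub>R f u = 0"
        using AE_lborel_singleton[of "0::real"] by eventually_elim (simp add: indicator_def)
      then have "(LBINT u:{0..0}. f u) = 0"
        unfolding set_lebesgue_integral_def by (rule integral_eq_zero_AE)
      then show ?case by (simp add: \<tau>_0)
    next
      case (Suc m)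
      have hk: "(LBINT u:{a..b}. f u) = integral {a..b} f" "f integrable_on {a..b}" if "0 \<le> a" "b \<le> t" for a b
        using set_borel_integral_eq_integral[OF f[OF that]] by auto
      have "integral {0..\<tau> N m} f + integral {\<tau> N m..\<tau> N (Suc m)} f = integral {0..\<tau> N (Suc m)} f"
        using \<tau>_nonneg \<tau>_mono[of m "Suc m" N] hk(2)[of 0 "\<tau> N (Suc m)"] \<tau>_le[OF Suc.prems]
        by (intro Henstock_Kurzweil_Integration.integral_combine) auto
      then show ?case
        using Suc \<tau>_nonneg \<tau>_le[of m N] \<tau>_le[OF Suc.prems] by (simp add: hk)
    qed
    let ?R = "LBINT u:{0..t}. r u"
    have R: "0 \<le> ?R" by (rule intensity_integral_nonneg) simp
    show ?thesis
    proof (rule LIMSEQ_I)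
      fix e :: real assume "0 < e"
      define d where "d = e / (?R + 1)"
      have d: "0 < d" using R \<open>0 < e\<close> by (simp add: d_def)
      have "uniformly_continuous_on {0..t} \<phi>"
        by (rule compact_uniformly_continuous[OF \<phi>(1)]) simp
      then obtain \<eta> where \<eta>: "0 < \<eta>" "\<And>u v. u \<in> {0..t} \<Longrightarrow> v \<in> {0..t} \<Longrightarrow> dist v u < \<eta> \<Longrightarrow> dist (\<phi> v) (\<phi> u) < d"
        using d unfolding uniformly_continuous_on_def by metis
      obtain N0 :: nat where N0: "t / \<eta> < real N0" using reals_Archimedean2 by blast
      have "norm ((\<Sum>i<Suc N. (LBINT u:{\<tau> N i..\<tau> N (Suc i)}. r u) * (1 - \<phi> (\<tau> N (Suc i)))) -
          (LBINT u:{0..t}. r u * (1 - \<phi> u))) < e" if N: "N0 \<le> N" for N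
      proof -
        have step: "t / real (Suc N) < \<eta>"
        proof -
          have "t / \<eta> < real (Suc N)" using N0 N by simp
          then show ?thesis using \<eta>(1) by (simp add: field_simps)
        qed
        have loc: "\<bar>(LBINT u:{\<tau> N i..\<tau> N (Suc i)}. r u) * (1 - \<phi> (\<tau> N (Suc i))) -
            (LBINT u:{\<tau> N i..\<tau> N (Suc i)}. r u * (1 - \<phi> u))\<bar> \<le> d * (LBINT u:{\<tau> N i..\<tau> N (Suc i)}. r u)"
          if i: "i < Suc N" for i
        proof -
          let ?I = "{\<tau> N i..\<tau> N (Suc i)}"
          have le: "\<tau> N (Suc i) \<le> t" using i by (intro \<tau>_le) simp
          have ri: "set_integrable lborel ?I r" by (rule set_integrable_intensity) (rule \<tau>_nonneg)
          have r\<phi>i: "set_integrable lborel ?I (\<lambda>u. r u * (1 - \<phi> u))" by (rule r\<phi>[OF \<tau>_nonneg le])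
          have "(LBINT u:?I. r u) * (1 - \<phi> (\<tau> N (Suc i))) - (LBINT u:?I. r u * (1 - \<phi> u)) =
              (LBINT u:?I. r u * (1 - \<phi> (\<tau> N (Suc i))) - r u * (1 - \<phi> u))"
            using ri r\<phi>i by (subst set_integral_diff) auto
          also have "\<bar>\<dots>\<bar> \<le> (LBINT u:?I. d * r u)"
          proof -
            have "\<bar>LBINT u:?I. r u * (1 - \<phi> (\<tau> N (Suc i))) - r u * (1 - \<phi> u)\<bar> \<le>
              (\<integral>u. \<bar>indicator ?I u *\<^sub>R (r u * (1 - \<phi> (\<tau> N (Suc i))) - r u * (1 - \<phi> u))\<bar> \<partial>lborel)"
              unfolding set_lebesgue_integral_def by (rule integral_abs_bound)
            also have "\<dots> \<le> (LBINT u:?I. d * r u)"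
              unfolding set_lebesgue_integral_def
            proof (rule integral_mono_AE)
              show "integrable lborel (\<lambda>u. \<bar>indicator ?I u *\<^sub>R (r u * (1 - \<phi> (\<tau> N (Suc i))) - r u * (1 - \<phi> u))\<bar>)"
                using set_integral_diff(1)[OF set_integrable_mult_left[OF ri] r\<phi>i]
                by (auto simp: set_integrable_def intro!: integrable_abs)
              show "integrable lborel (\<lambda>u. indicator ?I u *\<^sub>R (d * r u))"
                using ri by (auto simp: set_integrable_def dest: integrable_mult_right[of d] simp: mult_ac)
              show "AE u in lborel. \<bar>indicator ?I u *\<^sub>R (r u * (1 - \<phi> (\<tau> N (Suc i))) - r u * (1 - \<phi> u))\<bar>
                  \<le> indicator ?I u *\<^sub>R (d * r u)"
                using AE_lborel_singleton[of "0::real"]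
              proof eventually_elim
                case (elim u)
                show ?case
                proof (cases "u \<in> ?I")
                  case True
                  then have u: "0 < u" "u \<in> {0..t}" using elim \<tau>_nonneg[of N i] le by auto
                  have "dist (\<tau> N (Suc i)) u < \<eta>"
                    using True step \<tau>_step[of N i] by (auto simp: dist_real_def)
                  then have "\<bar>\<phi> (\<tau> N (Suc i)) - \<phi> u\<bar> \<le> d"
                    using \<eta>(2)[OF u(2), of "\<tau> N (Suc i)"] \<tau>_nonneg le by (simp add: dist_real_def)
                  then have "\<bar>\<phi> u - \<phi> (\<tau> N (Suc i))\<bar> * r u \<le> d * r u"
                    using intensity_nonneg[OF u(1)] by (intro mult_right_mono) (auto simp: abs_minus_commute)
                  moreover have "r u * (1 - \<phi> (\<tau> N (Suc i))) - r u * (1 - \<phi> u) = (\<phi> u - \<phi> (\<tau> N (Suc i))) * r u"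
                    by (simp add: algebra_simps)
                  ultimately show ?thesis using True intensity_nonneg[OF u(1)] by (simp add: abs_mult)
                qed simp
              qed
            qed
            finally show ?thesis .
          qed
          also have "\<dots> = d * (LBINT u:?I. r u)" by simp
          finally show ?thesis .
        qed
        have "\<bar>(\<Sum>i<Suc N. (LBINT u:{\<tau> N i..\<tau> N (Suc i)}. r u) * (1 - \<phi> (\<tau> N (Suc i)))) -
            (LBINT u:{0..t}. r u * (1 - \<phi> u))\<bar> =
          \<bar>\<Sum>i<Suc N. (LBINT u:{\<tau> N i..\<tau> N (Suc i)}. r u) * (1 - \<phi> (\<tau> N (Suc i))) -
            (LBINT u:{\<tau> N i..\<tau> N (Suc i)}. r u * (1 - \<phi> u))\<bar>"
          unfolding sum_subtractf using split[of "\<lambda>u. r u * (1 - \<phi> u)" "Suc N" N] r\<phi> by (simp add: \<tau>_end)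
        also have "\<dots> \<le> (\<Sum>i<Suc N. d * (LBINT u:{\<tau> N i..\<tau> N (Suc i)}. r u))"
          by (rule order_trans[OF sum_abs sum_mono]) (rule loc, simp)
        also have "\<dots> = d * ?R"
          unfolding sum_distrib_left[symmetric]
          using split[of r "Suc N" N] set_integrable_intensity by (simp add: \<tau>_end)
        also have "\<dots> < e"
        proof -
          have "d * ?R < d * (?R + 1)" using d by simp
          also have "\<dots> = e" using R by (simp add: d_def)
          finally show ?thesis .
        qed
        finally show ?thesis by simp
      qed
      then show "\<exists>no. \<forall>N\<ge>no. norm ((\<Sum>i<Suc N. (LBINT u:{\<tau> N i..\<tau> N (Suc i)}. r u) * (1 - \<phi> (\<tau> N (Suc i)))) -
          (LBINT u:{0..t}. r u * (1 - \<phi> u))) < e" by blast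
    qed
  qed
  then have "(\<lambda>N. exp (- (\<Sum>i<Suc N. (LBINT u:{\<tau> N i..\<tau> N (Suc i)}. r u) * (1 - \<phi> (\<tau> N (Suc i))))))
      \<longlonglongrightarrow> exp (- (LBINT u:{0..t}. r u * (1 - \<phi> u)))"
    by (intro tendsto_exp tendsto_minus)
  ultimately show ?thesis by (simp add: LIMSEQ_unique)
qed

end

section \<open>The generating function of the total population\<close>

text \<open>Indexing the genealogies and the batch sizes by all sources lets the independence of the sources
  apply directly; the values at sources of another kind are arbitrary.\<close>

fun genealogy_of :: "(nat \<Rightarrow> nat \<Rightarrow> 'a \<Rightarrow> genealogy) \<Rightarrow> source \<Rightarrow> 'a \<Rightarrow> genealogy" where
  "genealogy_of G (Family k j) = G k j"
| "genealogy_of G _ = (\<lambda>_ _. (0, 0))"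

fun batch_of :: "(nat \<Rightarrow> 'a \<Rightarrow> nat) \<Rightarrow> source \<Rightarrow> 'a \<Rightarrow> nat" where
  "batch_of I (Batch k) = I k"
| "batch_of I _ = (\<lambda>_. 0)"

locale critical_immigration =
  branching_immigration M r \<nu> \<mu> p h I G + critical_offspring \<mu> p \<gamma> L
  for M :: "'a measure" and r :: "real \<Rightarrow> real" and \<nu> :: "real \<Rightarrow> 'a \<Rightarrow> nat"
    and \<mu> :: real and p h :: "nat pmf" and I :: "nat \<Rightarrow> 'a \<Rightarrow> nat"
    and G :: "nat \<Rightarrow> nat \<Rightarrow> 'a \<Rightarrow> genealogy" and \<gamma> :: real and L :: "real \<Rightarrow> real"
begin

abbreviation "tree \<equiv> genealogy_law \<mu> p"

abbreviation "sources \<equiv> {Arrivals} \<union> {Batch k | k. 1 \<le> k} \<union> {Family k j | k j. 1 \<le> k \<and> 1 \<le> j}"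

text \<open>The random elements attached to the sources have different types. Each is therefore replaced by
  the identity of the sample space, equipped with the \<open>\<sigma>\<close>-algebra that the element generates; these
  identities form one family of independent variables.\<close>

definition information :: "source \<Rightarrow> 'a measure" where
  "information a = (case a of
      Arrivals \<Rightarrow> vimage_algebra (space M) (\<lambda>\<omega>. \<lambda>t\<in>{0..}. \<nu> t \<omega>) (\<Pi>\<^sub>M t\<in>{0..}. count_space UNIV)
    | Batch k \<Rightarrow> vimage_algebra (space M) (I k) (count_space UNIV)
    | Family k j \<Rightarrow> vimage_algebra (space M) (G k j) tree)"

lemma space_information [simp]: "space (information a) = space M"
  by (cases a) (simp_all add: information_def)

lemma indep_information: "indep_vars information (\<lambda>_ \<omega>. \<omega>) sources"
proof -
  have sets: "(\<lambda>a. case a of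
            Arrivals \<Rightarrow> sets (vimage_algebra (space M) (\<lambda>\<omega>. \<lambda>t\<in>{0..}. \<nu> t \<omega>)
                          (\<Pi>\<^sub>M t\<in>{0..}. count_space UNIV))
          | Batch k \<Rightarrow> sets (vimage_algebra (space M) (I k) (count_space UNIV))
          | Family k j \<Rightarrow> sets (vimage_algebra (space M) (G k j) tree)) = (\<lambda>a. sets (information a))"
    by (auto simp: information_def fun_eq_iff split: source.split)
  have ind: "indep_sets (\<lambda>a. sets (information a)) sources"
    using sources_indep unfolding sets .
  have "{(\<lambda>\<omega>. \<omega>) -` A \<inter> space M |A. A \<in> sets (information a)} = sets (information a)" for a
  proof -
    have "A \<inter> space M = A" if "A \<in> sets (information a)" for A
      using sets.sets_into_space[OF that] by auto
    then show ?thesis by (auto simp: vimage_def)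
  qed
  moreover have "random_variable (information a) (\<lambda>\<omega>. \<omega>)" if "a \<in> sources" for a
  proof (rule measurableI)
    fix A assume A: "A \<in> sets (information a)"
    then have "A \<in> events" using ind that unfolding indep_sets_def by blast
    moreover have "(\<lambda>\<omega>. \<omega>) -` A \<inter> space M = A" using sets.sets_into_space[OF A] by auto
    ultimately show "(\<lambda>\<omega>. \<omega>) -` A \<inter> space M \<in> events" by simp
  qed simp
  ultimately show ?thesis unfolding indep_vars_def2 using ind by simp
qed

lemma count_information: "0 \<le> u \<Longrightarrow> \<nu> u \<in> measurable (information Arrivals) (count_space UNIV)"
proof -
  assume u: "0 \<le> u"
  have "(\<lambda>\<omega>. \<lambda>t\<in>{0..}. \<nu> t \<omega>) \<in> measurable (information Arrivals) (\<Pi>\<^sub>M t\<in>{0..}. count_space UNIV)"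
    unfolding information_def by (simp, rule measurable_vimage_algebra1) (auto simp: space_PiM)
  from measurable_compose[OF this measurable_component_singleton[of u]] u show ?thesis by simp
qed

lemma batch_information: "I k \<in> measurable (information (Batch k)) (count_space UNIV)"
  unfolding information_def by (simp, rule measurable_vimage_algebra1) auto

lemma family_information: "G k j \<in> measurable (information (Family k j)) tree"
  unfolding information_def by (simp, rule measurable_vimage_algebra1) auto

text \<open>For \<open>k > \<nu> t\<close> the path need not jump \<open>k\<close> times at all; a fixed default there makes the sublevel sets
  events of the form \<open>k \<le> \<nu> u\<close> and \<open>k > \<nu> t\<close>.\<close>

definition arrival_time :: "real \<Rightarrow> nat \<Rightarrow> 'a \<Rightarrow> real" where
  "arrival_time t k \<omega> = (if k \<le> \<nu> t \<omega> then jump_point \<nu> k \<omega> else 0)"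

lemma arrival_time_information:
  assumes t: "0 \<le> t" shows "arrival_time t k \<in> borel_measurable (information Arrivals)"
  unfolding borel_measurable_iff_le
proof
  fix c
  have iff: "arrival_time t k \<omega> \<le> c \<longleftrightarrow> 0 \<le> c \<and> (k \<le> \<nu> t \<omega> \<longrightarrow> k \<le> \<nu> (max 0 c) \<omega>)" if \<omega>: "\<omega> \<in> space M" for \<omega>
  proof (cases "k \<le> \<nu> t \<omega>")
    case True
    show ?thesis
    proof (cases "0 \<le> c")
      case c: True
      then show ?thesis using jump_point_le_iff[OF \<omega> t True c] True by (simp add: arrival_time_def)
    next
      case False
      then show ?thesis using jump_point_bounds(1)[OF \<omega> t True] True by (simp add: arrival_time_def)
    qed
  qed (simp add: arrival_time_def)
  have [measurable]: "\<nu> t \<in> measurable (information Arrivals) (count_space UNIV)"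
    "\<nu> (max 0 c) \<in> measurable (information Arrivals) (count_space UNIV)"
    using t by (auto intro: count_information)
  have "{\<omega> \<in> space (information Arrivals). 0 \<le> c \<and> (k \<le> \<nu> t \<omega> \<longrightarrow> k \<le> \<nu> (max 0 c) \<omega>)} \<in> sets (information Arrivals)"
    by measurable
  moreover have "{\<omega> \<in> space (information Arrivals). arrival_time t k \<omega> \<le> c} =
      {\<omega> \<in> space (information Arrivals). 0 \<le> c \<and> (k \<le> \<nu> t \<omega> \<longrightarrow> k \<le> \<nu> (max 0 c) \<omega>)}"
    by (rule Collect_cong, unfold space_information, rule conj_cong[OF refl iff])
  ultimately show "{\<omega> \<in> space (information Arrivals). arrival_time t k \<omega> \<le> c} \<in> sets (information Arrivals)"
    by (simp only:)
qed

lemma information_le: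
  assumes "a \<in> sources" "f \<in> measurable (information a) N" shows "f \<in> measurable M N"
proof -
  have "random_variable (information a) (\<lambda>\<omega>. \<omega>)"
    using indep_information assms(1) unfolding indep_vars_def by blast
  from measurable_compose[OF this assms(2)] show ?thesis .
qed

lemma F_pos_bounds:
  assumes "0 \<le> s" "s \<le> 1" shows "0 \<le> F t s" "F t s \<le> 1" "\<bar>F t s\<bar> \<le> 1"
  using order_trans[OF assms(1) F_bounds(1)[OF assms, of t]] F_bounds(2)[OF assms, of t] by auto

lemma total_population_eq:
  "total_population \<nu> I G t \<omega> =
     (\<Sum>k=1..\<nu> t \<omega>. \<Sum>j=1..I k \<omega>. population (G k j \<omega>) (t - arrival_time t k \<omega>))"
  unfolding total_population_def arrival_time_def by (intro sum.cong refl) auto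

text \<open>The numbers of batches and of immigrants are random. A product over a deterministic grid, with
  factor 1 outside the random range, can be averaged factor by factor, and it stabilises as the
  grid grows.\<close>

lemma prod_immigrants_eventually:
  fixes f :: "nat \<Rightarrow> nat \<Rightarrow> real"
  shows "\<forall>\<^sub>F K in sequentially. (\<Prod>(k, j)\<in>{1..K} \<times> {1..K}. if k \<le> n \<and> j \<le> m k then f k j else 1) =
    (\<Prod>k=1..n. \<Prod>j=1..m k. f k j)"
proof -
  have "(\<Prod>(k, j)\<in>{1..K} \<times> {1..K}. if k \<le> n \<and> j \<le> m k then f k j else 1) =
    (\<Prod>k=1..n. \<Prod>j=1..m k. f k j)" if K: "n + (\<Sum>k=1..n. m k) \<le> K" for K
  proof -
    have "(\<Prod>(k, j)\<in>{1..K} \<times> {1..K}. if k \<le> n \<and> j \<le> m k then f k j else 1) =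
        (\<Prod>k=1..K. if k \<le> n then \<Prod>j=1..K. if j \<le> m k then f k j else 1 else 1)"
      unfolding prod.cartesian_product[symmetric] by (intro prod.cong refl) auto
    also have "\<dots> = (\<Prod>k=1..n. \<Prod>j=1..K. if j \<le> m k then f k j else 1)"
      using K by (intro prod_if_le_eq) simp
    also have "\<dots> = (\<Prod>k=1..n. \<Prod>j=1..m k. f k j)"
    proof (rule prod.cong[OF refl])
      fix k assume "k \<in> {1..n}"
      then have "m k \<le> (\<Sum>k=1..n. m k)" by (intro member_le_sum) auto
      with K show "(\<Prod>j=1..K. if j \<le> m k then f k j else 1) = (\<Prod>j=1..m k. f k j)"
        by (intro prod_if_le_eq) simp
    qed
    finally show ?thesis .
  qed
  then show ?thesis unfolding eventually_sequentially by blast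
qed

definition Families :: "nat \<Rightarrow> source set" where
  "Families K = (\<lambda>(k, j). Family k j) ` ({1..K} \<times> {1..K})"

lemma prod_Families: "(\<Prod>a\<in>Families K. f a) = (\<Prod>(k, j)\<in>{1..K} \<times> {1..K}. f (Family k j))"
  unfolding Families_def by (subst prod.reindex) (auto simp: inj_on_def split_def)

lemma measurable_total_population:
  assumes t: "0 \<le> t" shows "total_population \<nu> I G t \<in> measurable M (count_space UNIV)"
proof -
  have [measurable]: "\<nu> t \<in> measurable M (count_space UNIV)" using t by simp
  have A[measurable]: "arrival_time t k \<in> borel_measurable M" for k
    using arrival_time_information[OF t] by (intro information_le[of Arrivals]) auto
  have pop: "(\<lambda>\<omega>. population (G k j \<omega>) (t - arrival_time t k \<omega>)) \<in> measurable M (count_space UNIV)"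
    if "1 \<le> k" "1 \<le> j" for k j
    using family_measurable[OF that] by (intro measurable_population) auto
  define Y' where "Y' K \<omega> = (\<Sum>k=1..K. \<Sum>j=1..K. if k \<le> \<nu> t \<omega> \<and> j \<le> I k \<omega>
      then real (population (G k j \<omega>) (t - arrival_time t k \<omega>)) else 0)" for K \<omega>
  have Y'_meas: "Y' K \<in> borel_measurable M" for K
    unfolding Y'_def
  proof (intro borel_measurable_sum)
    fix k j assume "k \<in> {1..K}" "j \<in> {1..K}"
    then have kj: "1 \<le> k" "1 \<le> j" by auto
    note [measurable] = batch_measurable[OF kj(1)] pop[OF kj]
    show "(\<lambda>\<omega>. if k \<le> \<nu> t \<omega> \<and> j \<le> I k \<omega> then real (population (G k j \<omega>) (t - arrival_time t k \<omega>)) else 0)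
      \<in> borel_measurable M" by measurable
  qed
  have "(\<lambda>K. Y' K \<omega>) \<longlonglongrightarrow> real (total_population \<nu> I G t \<omega>)" for \<omega>
  proof (rule tendsto_eventually, unfold eventually_sequentially, intro exI allI impI)
    fix K assume K: "\<nu> t \<omega> + (\<Sum>k=1..\<nu> t \<omega>. I k \<omega>) \<le> K"
    have "Y' K \<omega> = (\<Sum>k=1..K. if k \<le> \<nu> t \<omega> then \<Sum>j=1..K. if j \<le> I k \<omega>
        then real (population (G k j \<omega>) (t - arrival_time t k \<omega>)) else 0 else 0)"
      unfolding Y'_def by (intro sum.cong refl) auto
    also have "\<dots> = (\<Sum>k=1..\<nu> t \<omega>. \<Sum>j=1..K. if j \<le> I k \<omega>
        then real (population (G k j \<omega>) (t - arrival_time t k \<omega>)) else 0)"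
      using K by (intro sum.mono_neutral_cong_right) auto
    also have "\<dots> = (\<Sum>k=1..\<nu> t \<omega>. \<Sum>j=1..I k \<omega>. real (population (G k j \<omega>) (t - arrival_time t k \<omega>)))"
    proof (rule sum.cong[OF refl])
      fix k assume "k \<in> {1..\<nu> t \<omega>}"
      then have "I k \<omega> \<le> (\<Sum>k=1..\<nu> t \<omega>. I k \<omega>)" by (intro member_le_sum) auto
      with K show "(\<Sum>j=1..K. if j \<le> I k \<omega> then real (population (G k j \<omega>) (t - arrival_time t k \<omega>)) else 0) =
          (\<Sum>j=1..I k \<omega>. real (population (G k j \<omega>) (t - arrival_time t k \<omega>)))"
        by (intro sum.mono_neutral_cong_right) auto
    qed
    finally show "Y' K \<omega> = real (total_population \<nu> I G t \<omega>)"
      by (simp add: total_population_eq)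
  qed
  then have "(\<lambda>\<omega>. real (total_population \<nu> I G t \<omega>)) \<in> borel_measurable M"
    by (intro borel_measurable_LIMSEQ_real[OF _ Y'_meas])
  then have "(\<lambda>\<omega>. nat \<lfloor>real (total_population \<nu> I G t \<omega>)\<rfloor>) \<in> measurable M (count_space UNIV)"
    by measurable
  then show ?thesis by simp
qed

text \<open>Averaging over the genealogies, given the arrivals and the batch sizes.\<close>

lemma expectation_families:
  assumes t: "0 \<le> t" and s: "0 \<le> s" "s \<le> 1"
  shows "expectation (\<lambda>\<omega>. s ^ total_population \<nu> I G t \<omega>) =
    expectation (\<lambda>\<omega>. \<Prod>k=1..\<nu> t \<omega>. F (t - arrival_time t k \<omega>) s ^ I k \<omega>)"
proof -
  define A where "A = {Arrivals} \<union> {Batch k | k. 1 \<le> k}"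
  define S where "S = PiM A information"
  define X where "X \<omega> = (\<lambda>a\<in>A. \<omega>)" for \<omega> :: 'a
  define on where "on k j x \<longleftrightarrow> k \<le> \<nu> t (x Arrivals) \<and> j \<le> I k (x (Batch k))" for k j and x :: "source \<Rightarrow> 'a"
  define b where "b a x z = (case a of Family k j \<Rightarrow>
      if on k j x then s ^ population z (t - arrival_time t k (x Arrivals)) else 1 | _ \<Rightarrow> 1)"
    for a and x :: "source \<Rightarrow> 'a" and z :: genealogy
  define c where "c k j \<omega> = (if k \<le> \<nu> t \<omega> \<and> j \<le> I k \<omega> then F (t - arrival_time t k \<omega>) s else 1)" for k j \<omega>
  have A_sub: "A \<subseteq> sources" by (auto simp: A_def)
  have arr: "(\<lambda>x. x Arrivals) \<in> measurable S (information Arrivals)"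
    unfolding S_def by (rule measurable_component_singleton) (simp add: A_def)
  have bat: "(\<lambda>x. x (Batch k)) \<in> measurable S (information (Batch k))" if "1 \<le> k" for k
    unfolding S_def by (rule measurable_component_singleton) (use that in \<open>auto simp: A_def\<close>)
  have [measurable]: "(\<lambda>x. \<nu> t (x Arrivals)) \<in> measurable S (count_space UNIV)"
    by (rule measurable_compose[OF arr count_information[OF t]])
  have [measurable]: "(\<lambda>x. arrival_time t k (x Arrivals)) \<in> borel_measurable S" for k
    by (rule measurable_compose[OF arr arrival_time_information[OF t]])
  have on[measurable]: "Measurable.pred S (on k j)" if "1 \<le> k" for k j
  proof -
    have [measurable]: "(\<lambda>x. I k (x (Batch k))) \<in> measurable S (count_space UNIV)"
      by (rule measurable_compose[OF bat[OF that] batch_information])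
    show ?thesis unfolding on_def by measurable
  qed
  have X: "random_variable S X"
    unfolding S_def X_def using indep_information A_sub
    by (intro measurable_restrict) (auto simp: indep_vars_def)
  have step: "expectation (\<lambda>\<omega>. \<Prod>a\<in>Families K. b a (X \<omega>) (genealogy_of G a \<omega>)) =
      expectation (\<lambda>\<omega>. \<Prod>(k, j)\<in>{1..K} \<times> {1..K}. c k j \<omega>)" for K
  proof -
    let ?B = "Families K"
    have B: "?B \<subseteq> sources" "A \<inter> ?B = {}" "finite ?B" by (auto simp: Families_def A_def)
    have gen: "genealogy_of G a \<in> measurable (information a) tree" if "a \<in> ?B" for a
      using that family_information by (auto simp: Families_def)
    have ind_XB: "indep_var S X (PiM ?B information) (\<lambda>\<omega>. \<lambda>a\<in>?B. \<omega>)"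
      unfolding S_def X_def using B A_sub by (intro indep_var_restrict[OF indep_information]) auto
    have vec: "(\<lambda>y. \<lambda>a\<in>?B. genealogy_of G a (y a)) \<in> measurable (PiM ?B information) (PiM ?B (\<lambda>_. tree))"
    proof (rule measurable_restrict)
      fix a assume a: "a \<in> ?B"
      have "(\<lambda>y. y a) \<in> measurable (PiM ?B information) (information a)"
        by (rule measurable_component_singleton[OF a])
      from measurable_compose[OF this gen[OF a]]
      show "(\<lambda>y. genealogy_of G a (y a)) \<in> measurable (PiM ?B information) (tree)" .
    qed
    have "distr M (S \<Otimes>\<^sub>M PiM ?B (\<lambda>_. tree)) (\<lambda>\<omega>. (X \<omega>, \<lambda>a\<in>?B. genealogy_of G a ((\<lambda>a\<in>?B. \<omega>) a))) =
        distr M S X \<Otimes>\<^sub>M distr M (PiM ?B (\<lambda>_. tree)) (\<lambda>\<omega>. \<lambda>a\<in>?B. genealogy_of G a ((\<lambda>a\<in>?B. \<omega>) a))"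
      using indep_var_distr_pair[OF ind_XB measurable_ident vec] by (simp only: id_apply)
    moreover have "(\<lambda>a\<in>?B. genealogy_of G a ((\<lambda>a\<in>?B. \<omega>) a)) = (\<lambda>a\<in>?B. genealogy_of G a \<omega>)" for \<omega>
      by (rule restrict_ext) simp
    ultimately have ind: "distr M (S \<Otimes>\<^sub>M PiM ?B (\<lambda>_. tree)) (\<lambda>\<omega>. (X \<omega>, \<lambda>a\<in>?B. genealogy_of G a \<omega>)) =
        distr M S X \<Otimes>\<^sub>M distr M (PiM ?B (\<lambda>_. tree)) (\<lambda>\<omega>. \<lambda>a\<in>?B. genealogy_of G a \<omega>)"
      by simp
    have ind_Z: "indep_vars (\<lambda>_. tree) (genealogy_of G) ?B"
      using indep_vars_compose2[OF indep_vars_subset[OF indep_information B(1)], of "genealogy_of G" "\<lambda>_. tree"] gen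
      by simp
    have b_meas: "case_prod (b a) \<in> borel_measurable (S \<Otimes>\<^sub>M tree)" if "a \<in> ?B" for a
    proof -
      obtain k j where a: "a = Family k j" and k: "1 \<le> k" using \<open>a \<in> ?B\<close> by (auto simp: Families_def)
      note [measurable] = on[OF k] measurable_population measurable_power_nat
      show ?thesis unfolding a b_def source.case case_prod_beta by measurable
    qed
    have b_bound: "\<bar>b a x z\<bar> \<le> 1" for a x z
      using s by (cases a) (auto simp: b_def power_le_one)
    have b_int: "(\<integral>z. b (Family k j) (X \<omega>) z \<partial>distr M tree (genealogy_of G (Family k j))) = c k j \<omega>"
      if "1 \<le> k" "1 \<le> j" for k j \<omega>
    proof -
      have on_iff: "on k j (X \<omega>) \<longleftrightarrow> k \<le> \<nu> t \<omega> \<and> j \<le> I k \<omega>" and arr_X: "X \<omega> Arrivals = \<omega>"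
        using that by (auto simp: on_def X_def A_def)
      show ?thesis
      proof (cases "k \<le> \<nu> t \<omega> \<and> j \<le> I k \<omega>")
        case True
        then show ?thesis
          using family_law[OF that] by (simp add: b_def c_def branching_pgf_def on_iff arr_X)
      next
        case False
        then have "b (Family k j) (X \<omega>) z = 1" for z by (simp only: b_def source.case on_iff if_False)
        moreover have "c k j \<omega> = 1" using False by (simp only: c_def if_False)
        ultimately show ?thesis
          using family_law[OF that] prob_space.prob_space[OF prob_space_tree_law[OF rate_pos], of p] by simp
      qed
    qed
    have "expectation (\<lambda>\<omega>. 1 * (\<Prod>a\<in>?B. b a (X \<omega>) (genealogy_of G a \<omega>))) =
        expectation (\<lambda>\<omega>. 1 * (\<Prod>a\<in>?B. \<integral>z. b a (X \<omega>) z \<partial>distr M tree (genealogy_of G a)))"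
      by (rule expectation_prod_indep[where a="\<lambda>_. 1", OF B(3) X ind ind_Z _ _ b_meas b_bound]) auto
    also have "\<dots> = expectation (\<lambda>\<omega>. \<Prod>(k, j)\<in>{1..K} \<times> {1..K}. c k j \<omega>)"
      unfolding prod_Families
    proof (intro Bochner_Integration.integral_cong refl)
      fix \<omega>
      have "(\<Prod>(k, j)\<in>{1..K} \<times> {1..K}. \<integral>z. b (Family k j) (X \<omega>) z \<partial>distr M tree (genealogy_of G (Family k j))) =
          (\<Prod>(k, j)\<in>{1..K} \<times> {1..K}. c k j \<omega>)"
        by (rule prod.cong[OF refl]) (clarify, rule b_int, auto)
      then show "1 * (\<Prod>(k, j)\<in>{1..K} \<times> {1..K}. \<integral>z. b (Family k j) (X \<omega>) z \<partial>distr M tree (genealogy_of G (Family k j))) =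
          (\<Prod>(k, j)\<in>{1..K} \<times> {1..K}. c k j \<omega>)" by simp
    qed
    finally show ?thesis by simp
  qed
  have b_eq: "(\<Prod>a\<in>Families K. b a (X \<omega>) (genealogy_of G a \<omega>)) =
      (\<Prod>(k, j)\<in>{1..K} \<times> {1..K}. if k \<le> \<nu> t \<omega> \<and> j \<le> I k \<omega>
         then s ^ population (G k j \<omega>) (t - arrival_time t k \<omega>) else 1)" for K \<omega>
    unfolding prod_Families
    by (rule prod.cong[OF refl]) (auto simp: b_def on_def X_def A_def)
  have bounds: "\<bar>\<Prod>x\<in>B. f x\<bar> \<le> 1" if "\<And>x. \<bar>f x :: real\<bar> \<le> 1" for B :: "(nat \<times> nat) set" and f
    unfolding abs_prod using that by (intro prod_le_1) auto
  have lim1: "(\<lambda>K. expectation (\<lambda>\<omega>. \<Prod>a\<in>Families K. b a (X \<omega>) (genealogy_of G a \<omega>))) \<longlonglongrightarrow>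
      expectation (\<lambda>\<omega>. s ^ total_population \<nu> I G t \<omega>)"
  proof (rule integral_dominated_convergence[where w="\<lambda>_. 1"])
    show "(\<lambda>\<omega>. s ^ total_population \<nu> I G t \<omega>) \<in> borel_measurable M"
      by (intro measurable_power_nat measurable_total_population t) simp
    show "(\<lambda>\<omega>. \<Prod>a\<in>Families K. b a (X \<omega>) (genealogy_of G a \<omega>)) \<in> borel_measurable M" for K
      unfolding b_eq
    proof (rule borel_measurable_prod, clarify)
      fix k j assume kj: "k \<in> {1..K}" "j \<in> {1..K}"
      then have kj': "1 \<le> k" "1 \<le> j" by auto
      have [measurable]: "\<nu> t \<in> measurable M (count_space UNIV)" using t by simp
      have [measurable]: "arrival_time t k \<in> borel_measurable M"
        using arrival_time_information[OF t] by (intro information_le[of Arrivals]) auto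
      note [measurable] = batch_measurable[OF kj'(1)] family_measurable[OF kj'] measurable_population measurable_power_nat
      show "(\<lambda>\<omega>. if k \<le> \<nu> t \<omega> \<and> j \<le> I k \<omega> then s ^ population (G k j \<omega>) (t - arrival_time t k \<omega>) else 1)
          \<in> borel_measurable M" by measurable
    qed
    show "AE \<omega> in M. (\<lambda>K. \<Prod>a\<in>Families K. b a (X \<omega>) (genealogy_of G a \<omega>)) \<longlonglongrightarrow> s ^ total_population \<nu> I G t \<omega>"
    proof (rule AE_I2)
      fix \<omega>
      have "s ^ total_population \<nu> I G t \<omega> =
          (\<Prod>k=1..\<nu> t \<omega>. \<Prod>j=1..I k \<omega>. s ^ population (G k j \<omega>) (t - arrival_time t k \<omega>))"
        unfolding total_population_eq power_sum ..
      then show "(\<lambda>K. \<Prod>a\<in>Families K. b a (X \<omega>) (genealogy_of G a \<omega>)) \<longlonglongrightarrow> s ^ total_population \<nu> I G t \<omega>"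
        unfolding b_eq
        using prod_immigrants_eventually[of "\<nu> t \<omega>" "\<lambda>k. I k \<omega>" "\<lambda>k j. s ^ population (G k j \<omega>) (t - arrival_time t k \<omega>)"]
        by (simp only:) (rule tendsto_eventually)
    qed
    show "AE \<omega> in M. norm (\<Prod>a\<in>Families K. b a (X \<omega>) (genealogy_of G a \<omega>)) \<le> 1" for K
      unfolding b_eq real_norm_def using s
      by (intro AE_I2 bounds) (auto simp: power_le_one split: prod.split)
  qed simp
  have lim2: "(\<lambda>K. expectation (\<lambda>\<omega>. \<Prod>(k, j)\<in>{1..K} \<times> {1..K}. c k j \<omega>)) \<longlonglongrightarrow>
      expectation (\<lambda>\<omega>. \<Prod>k=1..\<nu> t \<omega>. F (t - arrival_time t k \<omega>) s ^ I k \<omega>)"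
  proof (rule integral_dominated_convergence[where w="\<lambda>_. 1"])
    show meas: "(\<lambda>\<omega>. \<Prod>(k, j)\<in>{1..K} \<times> {1..K}. c k j \<omega>) \<in> borel_measurable M" for K
    proof (rule borel_measurable_prod, clarify)
      fix k j assume kj: "k \<in> {1..K}" "j \<in> {1..K}"
      then have kj': "1 \<le> k" by auto
      have [measurable]: "\<nu> t \<in> measurable M (count_space UNIV)" using t by simp
      have [measurable]: "arrival_time t k \<in> borel_measurable M"
        using arrival_time_information[OF t] by (intro information_le[of Arrivals]) auto
      note [measurable] = batch_measurable[OF kj']
      show "c k j \<in> borel_measurable M" unfolding c_def by measurable
    qed
    have lim: "(\<lambda>K. \<Prod>(k, j)\<in>{1..K} \<times> {1..K}. c k j \<omega>) \<longlonglongrightarrow>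
        (\<Prod>k=1..\<nu> t \<omega>. F (t - arrival_time t k \<omega>) s ^ I k \<omega>)" for \<omega>
      using prod_immigrants_eventually[of "\<nu> t \<omega>" "\<lambda>k. I k \<omega>" "\<lambda>k j. F (t - arrival_time t k \<omega>) s"]
      unfolding c_def by (intro tendsto_eventually) simp
    show "(\<lambda>\<omega>. \<Prod>k=1..\<nu> t \<omega>. F (t - arrival_time t k \<omega>) s ^ I k \<omega>) \<in> borel_measurable M"
      by (rule borel_measurable_LIMSEQ_real[OF lim meas])
    show "AE \<omega> in M. (\<lambda>K. \<Prod>(k, j)\<in>{1..K} \<times> {1..K}. c k j \<omega>) \<longlonglongrightarrow>
        (\<Prod>k=1..\<nu> t \<omega>. F (t - arrival_time t k \<omega>) s ^ I k \<omega>)"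
      by (rule AE_I2) (rule lim)
    show "AE \<omega> in M. norm (\<Prod>(k, j)\<in>{1..K} \<times> {1..K}. c k j \<omega>) \<le> 1" for K
      unfolding real_norm_def using F_pos_bounds[OF s]
      by (intro AE_I2 bounds) (auto simp: c_def split: prod.split)
  qed simp
  show ?thesis using LIMSEQ_unique[OF lim1 lim2[folded step]] .
qed

text \<open>Averaging over the batch sizes, given the arrivals.\<close>

lemma expectation_batches:
  assumes t: "0 \<le> t" and s: "0 \<le> s" "s \<le> 1"
  shows "expectation (\<lambda>\<omega>. \<Prod>k=1..\<nu> t \<omega>. F (t - arrival_time t k \<omega>) s ^ I k \<omega>) =
    expectation (\<lambda>\<omega>. \<Prod>k=1..\<nu> t \<omega>. pgf h (F (t - arrival_time t k \<omega>) s))"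
proof -
  define S where "S = PiM {Arrivals} information"
  define X where "X \<omega> = (\<lambda>a\<in>{Arrivals}. \<omega>)" for \<omega> :: 'a
  define b where "b a x n = (case a of Batch k \<Rightarrow>
      if k \<le> \<nu> t (x Arrivals) then F (t - arrival_time t k (x Arrivals)) s ^ n else 1 | _ \<Rightarrow> 1)"
    for a and x :: "source \<Rightarrow> 'a" and n :: nat
  define c where "c k \<omega> = (if k \<le> \<nu> t \<omega> then pgf h (F (t - arrival_time t k \<omega>) s) else 1)" for k \<omega>
  have arr: "(\<lambda>x. x Arrivals) \<in> measurable S (information Arrivals)"
    unfolding S_def by (rule measurable_component_singleton) simp
  have [measurable]: "(\<lambda>x. \<nu> t (x Arrivals)) \<in> measurable S (count_space UNIV)"
    by (rule measurable_compose[OF arr count_information[OF t]])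
  have [measurable]: "(\<lambda>x. arrival_time t k (x Arrivals)) \<in> borel_measurable S" for k
    by (rule measurable_compose[OF arr arrival_time_information[OF t]])
  have X: "random_variable S X"
    unfolding S_def X_def using indep_information
    by (intro measurable_restrict) (auto simp: indep_vars_def)
  have prod_B: "(\<Prod>a\<in>Batch ` {1..K}. f a) = (\<Prod>k=1..K. f (Batch k))" for K and f :: "source \<Rightarrow> real"
    by (subst prod.reindex) (auto simp: inj_on_def)
  have step: "expectation (\<lambda>\<omega>. \<Prod>a\<in>Batch ` {1..K}. b a (X \<omega>) (batch_of I a \<omega>)) =
      expectation (\<lambda>\<omega>. \<Prod>k=1..K. c k \<omega>)" for K
  proof -
    let ?B = "Batch ` {1..K}"
    have B: "?B \<subseteq> sources" "{Arrivals} \<inter> ?B = {}" "finite ?B" by auto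
    have gen: "batch_of I a \<in> measurable (information a) (count_space UNIV)" if "a \<in> ?B" for a
      using that batch_information by auto
    have ind_XB: "indep_var S X (PiM ?B information) (\<lambda>\<omega>. \<lambda>a\<in>?B. \<omega>)"
      unfolding S_def X_def using B by (intro indep_var_restrict[OF indep_information]) auto
    have vec: "(\<lambda>y. \<lambda>a\<in>?B. batch_of I a (y a)) \<in> measurable (PiM ?B information) (PiM ?B (\<lambda>_. count_space UNIV))"
    proof (rule measurable_restrict)
      fix a assume a: "a \<in> ?B"
      have "(\<lambda>y. y a) \<in> measurable (PiM ?B information) (information a)"
        by (rule measurable_component_singleton[OF a])
      from measurable_compose[OF this gen[OF a]]
      show "(\<lambda>y. batch_of I a (y a)) \<in> measurable (PiM ?B information) (count_space UNIV)" .
    qed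
    have "distr M (S \<Otimes>\<^sub>M PiM ?B (\<lambda>_. count_space UNIV)) (\<lambda>\<omega>. (X \<omega>, \<lambda>a\<in>?B. batch_of I a ((\<lambda>a\<in>?B. \<omega>) a))) =
        distr M S X \<Otimes>\<^sub>M distr M (PiM ?B (\<lambda>_. count_space UNIV)) (\<lambda>\<omega>. \<lambda>a\<in>?B. batch_of I a ((\<lambda>a\<in>?B. \<omega>) a))"
      using indep_var_distr_pair[OF ind_XB measurable_ident vec] by (simp only: id_apply)
    moreover have "(\<lambda>a\<in>?B. batch_of I a ((\<lambda>a\<in>?B. \<omega>) a)) = (\<lambda>a\<in>?B. batch_of I a \<omega>)" for \<omega>
      by (rule restrict_ext) simp
    ultimately have ind: "distr M (S \<Otimes>\<^sub>M PiM ?B (\<lambda>_. count_space UNIV)) (\<lambda>\<omega>. (X \<omega>, \<lambda>a\<in>?B. batch_of I a \<omega>)) =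
        distr M S X \<Otimes>\<^sub>M distr M (PiM ?B (\<lambda>_. count_space UNIV)) (\<lambda>\<omega>. \<lambda>a\<in>?B. batch_of I a \<omega>)"
      by simp
    have ind_Z: "indep_vars (\<lambda>_. count_space UNIV) (batch_of I) ?B"
      using indep_vars_compose2[OF indep_vars_subset[OF indep_information B(1)], of "batch_of I" "\<lambda>_. count_space UNIV"] gen
      by simp
    have b_meas: "case_prod (b a) \<in> borel_measurable (S \<Otimes>\<^sub>M count_space UNIV)" if "a \<in> ?B" for a
    proof -
      obtain k where a: "a = Batch k" using \<open>a \<in> ?B\<close> by auto
      note [measurable] = measurable_power_nat
      show ?thesis unfolding a b_def source.case case_prod_beta by measurable
    qed
    have b_bound: "\<bar>b a x z\<bar> \<le> 1" for a x z
      using F_pos_bounds[OF s] by (cases a) (auto simp: b_def power_abs power_le_one)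
    have b_int: "(\<integral>z. b (Batch k) (X \<omega>) z \<partial>distr M (count_space UNIV) (batch_of I (Batch k))) = c k \<omega>"
      if "1 \<le> k" for k \<omega>
      using batch_law[OF that] by (simp add: b_def c_def X_def pgf_def)
    have "expectation (\<lambda>\<omega>. 1 * (\<Prod>a\<in>?B. b a (X \<omega>) (batch_of I a \<omega>))) =
        expectation (\<lambda>\<omega>. 1 * (\<Prod>a\<in>?B. \<integral>z. b a (X \<omega>) z \<partial>distr M (count_space UNIV) (batch_of I a)))"
      by (rule expectation_prod_indep[where a="\<lambda>_. 1", OF B(3) X ind ind_Z _ _ b_meas b_bound]) auto
    then show ?thesis unfolding prod_B using b_int by (simp del: batch_of.simps)
  qed
  have b_eq: "(\<Prod>a\<in>Batch ` {1..K}. b a (X \<omega>) (batch_of I a \<omega>)) =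
      (\<Prod>k=1..K. if k \<le> \<nu> t \<omega> then F (t - arrival_time t k \<omega>) s ^ I k \<omega> else 1)" for K \<omega>
    unfolding prod_B by (rule prod.cong[OF refl]) (auto simp: b_def X_def)
  have bounds: "\<bar>\<Prod>x\<in>B. f x\<bar> \<le> 1" if "\<And>x. \<bar>f x :: real\<bar> \<le> 1" for B :: "nat set" and f
    unfolding abs_prod using that by (intro prod_le_1) auto
  have ev: "(\<lambda>K. \<Prod>k=1..K. if k \<le> n then f k else 1) \<longlonglongrightarrow> (\<Prod>k=1..n. f k)" for n and f :: "nat \<Rightarrow> real"
    by (rule tendsto_eventually, unfold eventually_sequentially, intro exI[of _ n] allI impI, rule prod_if_le_eq)
  have [measurable]: "\<nu> t \<in> measurable M (count_space UNIV)" using t by simp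
  have [measurable]: "arrival_time t k \<in> borel_measurable M" for k
    using arrival_time_information[OF t] by (intro information_le[of Arrivals]) auto
  have lim1: "(\<lambda>K. expectation (\<lambda>\<omega>. \<Prod>a\<in>Batch ` {1..K}. b a (X \<omega>) (batch_of I a \<omega>))) \<longlonglongrightarrow>
      expectation (\<lambda>\<omega>. \<Prod>k=1..\<nu> t \<omega>. F (t - arrival_time t k \<omega>) s ^ I k \<omega>)"
    unfolding b_eq
  proof (rule integral_dominated_convergence[where w="\<lambda>_. 1"])
    show meas: "(\<lambda>\<omega>. \<Prod>k=1..K. if k \<le> \<nu> t \<omega> then F (t - arrival_time t k \<omega>) s ^ I k \<omega> else 1) \<in> borel_measurable M" for K
    proof (rule borel_measurable_prod)
      fix k assume "k \<in> {1..K}"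
      then have k: "1 \<le> k" by simp
      note [measurable] = batch_measurable[OF k] measurable_power_nat
      show "(\<lambda>\<omega>. if k \<le> \<nu> t \<omega> then F (t - arrival_time t k \<omega>) s ^ I k \<omega> else 1) \<in> borel_measurable M"
        by measurable
    qed
    show "(\<lambda>\<omega>. \<Prod>k=1..\<nu> t \<omega>. F (t - arrival_time t k \<omega>) s ^ I k \<omega>) \<in> borel_measurable M"
      by (rule borel_measurable_LIMSEQ_real[OF ev meas])
    show "AE \<omega> in M. norm (\<Prod>k=1..K. if k \<le> \<nu> t \<omega> then F (t - arrival_time t k \<omega>) s ^ I k \<omega> else 1) \<le> 1" for K
      unfolding real_norm_def using F_pos_bounds[OF s]
      by (intro AE_I2 bounds) (auto simp: power_abs power_le_one)
  qed (use ev in auto)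
  have lim2: "(\<lambda>K. expectation (\<lambda>\<omega>. \<Prod>k=1..K. c k \<omega>)) \<longlonglongrightarrow>
      expectation (\<lambda>\<omega>. \<Prod>k=1..\<nu> t \<omega>. pgf h (F (t - arrival_time t k \<omega>) s))"
    unfolding c_def
  proof (rule integral_dominated_convergence[where w="\<lambda>_. 1"])
    show meas: "(\<lambda>\<omega>. \<Prod>k=1..K. if k \<le> \<nu> t \<omega> then pgf h (F (t - arrival_time t k \<omega>) s) else 1) \<in> borel_measurable M" for K
      by measurable
    show "(\<lambda>\<omega>. \<Prod>k=1..\<nu> t \<omega>. pgf h (F (t - arrival_time t k \<omega>) s)) \<in> borel_measurable M"
      by (rule borel_measurable_LIMSEQ_real[OF ev meas])
    show "AE \<omega> in M. norm (\<Prod>k=1..K. if k \<le> \<nu> t \<omega> then pgf h (F (t - arrival_time t k \<omega>) s) else 1) \<le> 1" for K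
      unfolding real_norm_def using F_pos_bounds[OF s]
      by (intro AE_I2 bounds) (auto simp: pgf_nonneg pgf_le_one)
  qed (use ev in auto)
  show ?thesis using LIMSEQ_unique[OF lim1 lim2[folded step]] .
qed

lemma total_population_pgf:
  assumes t: "0 \<le> t" and s: "0 \<le> s" "s \<le> 1"
  shows "expectation (\<lambda>\<omega>. s ^ total_population \<nu> I G t \<omega>) =
    exp (- (LBINT u:{0..t}. r u * q_fun \<mu> p h (t - u) s))"
proof -
  have "expectation (\<lambda>\<omega>. s ^ total_population \<nu> I G t \<omega>) =
      expectation (\<lambda>\<omega>. \<Prod>k=1..\<nu> t \<omega>. pgf h (F (t - arrival_time t k \<omega>) s))"
    unfolding expectation_families[OF assms] by (rule expectation_batches[OF assms])
  also have "\<dots> = expectation (\<lambda>\<omega>. \<Prod>k=1..\<nu> t \<omega>. pgf h (F (t - jump_point \<nu> k \<omega>) s))"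
    by (intro Bochner_Integration.integral_cong prod.cong refl) (simp add: arrival_time_def)
  also have "\<dots> = exp (- (LBINT u:{0..t}. r u * (1 - pgf h (F (t - u) s))))"
  proof (rule poisson_functional[OF t, of "\<lambda>u. pgf h (F (t - u) s)"])
    have "continuous_on {0..t} (\<lambda>u. F (t - u) s)"
      by (rule continuous_on_compose2[OF continuous_on_F[OF s, of t]]) (auto intro!: continuous_intros)
    then show "continuous_on {0..t} (\<lambda>u. pgf h (F (t - u) s))"
      by (rule continuous_on_compose2[OF continuous_on_pgf]) (use F_pos_bounds[OF s] in auto)
  qed (use F_pos_bounds[OF s] in \<open>auto simp: pgf_nonneg pgf_le_one\<close>)
  finally show ?thesis by (simp add: q_fun_def)
qed

end

section \<open>Asymptotics of convolutions\<close>

lemma set_integrable_powr_at_top: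
  fixes e X :: real
  assumes "e < - 1" "0 < X" shows "set_integrable lborel {X..} (\<lambda>u. u powr e)"
  unfolding set_integrable_def
proof (rule integrableI_nonneg)
  have "(\<integral>\<^sup>+u. ennreal (indicator {X..} u * u powr e) \<partial>lborel) = ennreal (- (X powr (e + 1)) / (e + 1))"
    by (rule nn_integral_has_integral_lebesgue[OF _ has_integral_powr_to_inf[OF assms]]) simp
  then show "(\<integral>\<^sup>+u. ennreal (indicator {X..} u *\<^sub>R u powr e) \<partial>lborel) < \<infinity>" by simp
qed auto

lemma set_integral_powr_from_0:
  fixes e t :: real
  assumes "- 1 < e" "0 \<le> t"
  shows "set_integrable lborel {0..t} (\<lambda>u. u powr e)" "(LBINT u:{0..t}. u powr e) = t powr (e + 1) / (e + 1)"
proof -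
  have nn: "(\<integral>\<^sup>+u. ennreal (indicator {0..t} u * u powr e) \<partial>lborel) = ennreal (t powr (e + 1) / (e + 1))"
    by (rule nn_integral_has_integral_lebesgue[OF _ has_integral_powr_from_0[OF assms]]) simp
  show "set_integrable lborel {0..t} (\<lambda>u. u powr e)"
    unfolding set_integrable_def by (rule integrableI_nonneg) (use nn in auto)
  show "(LBINT u:{0..t}. u powr e) = t powr (e + 1) / (e + 1)"
    unfolding set_lebesgue_integral_def
    by (subst integral_eq_nn_integral) (use nn assms in auto)
qed

lemma set_integrable_at_top_of_power_bound:
  fixes f :: "real \<Rightarrow> real"
  assumes f: "\<And>b. set_integrable lborel {0..b} f"
    and X: "0 < X" and bound: "\<And>u. X \<le> u \<Longrightarrow> \<bar>f u\<bar> \<le> C * u powr e" and e: "e < - 1"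
  shows "set_integrable lborel {0..} f"
  unfolding set_integrable_def
proof (rule Bochner_Integration.integrable_bound)
  show "integrable lborel (\<lambda>u. \<bar>indicator {0..X} u *\<^sub>R f u\<bar> + C * (indicator {X..} u *\<^sub>R u powr e))"
    using f[of X] set_integrable_powr_at_top[OF e X] unfolding set_integrable_def by auto
  have "(\<lambda>u. indicator {0..real n} u *\<^sub>R f u) \<in> borel_measurable lborel" for n
    using f[of "real n"] unfolding set_integrable_def by (rule borel_measurable_integrable)
  moreover have "(\<lambda>n. indicator {0..real n} u *\<^sub>R f u) \<longlonglongrightarrow> indicator {0..} u *\<^sub>R f u" for u
  proof (rule tendsto_eventually)
    have "\<forall>\<^sub>F n in sequentially. u \<le> real n" 
      using filterlim_real_sequentially by (simp add: filterlim_at_top)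
    then show "\<forall>\<^sub>F n in sequentially. indicator {0..real n} u *\<^sub>R f u = indicator {0..} u *\<^sub>R f u"
      by eventually_elim (auto simp: indicator_def)
  qed
  ultimately show "(\<lambda>u. indicator {0..} u *\<^sub>R f u) \<in> borel_measurable lborel"
    by (rule borel_measurable_LIMSEQ_real[rotated])
  show "AE u in lborel. norm (indicator {0..} u *\<^sub>R f u)
      \<le> norm (\<bar>indicator {0..X} u *\<^sub>R f u\<bar> + C * (indicator {X..} u *\<^sub>R u powr e))"
  proof (rule AE_I2)
    fix u
    show "norm (indicator {0..} u *\<^sub>R f u)
      \<le> norm (\<bar>indicator {0..X} u *\<^sub>R f u\<bar> + C * (indicator {X..} u *\<^sub>R u powr e))"
    proof (cases "X \<le> u")
      case True
      then have "norm (indicator {0..} u *\<^sub>R f u) \<le> C * u powr e" using bound[OF True] X by simp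
      moreover have "0 \<le> \<bar>indicator {0..X} u *\<^sub>R f u\<bar>" by simp
      ultimately show ?thesis using True by simp
    qed (auto simp: indicator_def)
  qed
qed

lemma set_integral_growth_bound:
  fixes f :: "real \<Rightarrow> real"
  assumes f: "\<And>b. set_integrable lborel {0..b} f"
    and X: "0 < X" and C: "0 \<le> C" and bound: "\<And>u. X \<le> u \<Longrightarrow> f u \<le> C * u powr e" and e: "- 1 < e"
  obtains A where "0 \<le> A" "\<And>t. 0 \<le> t \<Longrightarrow> (LBINT u:{0..t}. f u) \<le> A + C / (e + 1) * t powr (e + 1)"
proof
  define A where "A = (\<integral>u. \<bar>indicator {0..X} u *\<^sub>R f u\<bar> \<partial>lborel)"
  show "0 \<le> A" unfolding A_def by (rule integral_nonneg_AE) simp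
  fix t :: real assume t: "0 \<le> t"
  note p = set_integral_powr_from_0[OF e t]
  have int: "integrable lborel (\<lambda>u. \<bar>indicator {0..X} u *\<^sub>R f u\<bar>)"
    "integrable lborel (\<lambda>u. C * (indicator {0..t} u *\<^sub>R u powr e))"
    using f[of X] p(1) unfolding set_integrable_def by auto
  have "(LBINT u:{0..t}. f u) \<le> (\<integral>u. \<bar>indicator {0..X} u *\<^sub>R f u\<bar> + C * (indicator {0..t} u *\<^sub>R u powr e) \<partial>lborel)"
    unfolding set_lebesgue_integral_def
  proof (rule integral_mono)
    show "integrable lborel (\<lambda>u. indicator {0..t} u *\<^sub>R f u)" using f[of t] by (simp add: set_integrable_def)
    show "integrable lborel (\<lambda>u. \<bar>indicator {0..X} u *\<^sub>R f u\<bar> + C * (indicator {0..t} u *\<^sub>R u powr e))"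
      using int by (rule Bochner_Integration.integrable_add)
    fix u
    show "indicator {0..t} u *\<^sub>R f u \<le> \<bar>indicator {0..X} u *\<^sub>R f u\<bar> + C * (indicator {0..t} u *\<^sub>R u powr e)"
    proof (cases "u \<in> {0..t}")
      case True
      have "0 \<le> C * u powr e" using C by simp
      then show ?thesis using True bound[of u] by (cases "X \<le> u") (auto simp: indicator_def)
    qed simp
  qed
  also have "\<dots> = A + C * (LBINT u:{0..t}. u powr e)"
    using int unfolding A_def set_lebesgue_integral_def by (subst Bochner_Integration.integral_add) auto
  finally show "(LBINT u:{0..t}. f u) \<le> A + C / (e + 1) * t powr (e + 1)"
    using p(2) by simp
qed

lemma set_integral_reflect:
  fixes f :: "real \<Rightarrow> real"
  shows "(LBINT u:{0..t}. f (t - u)) = (LBINT u:{0..t}. f u)"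
    and "set_integrable lborel {0..t} f \<Longrightarrow> set_integrable lborel {0..t} (\<lambda>u. f (t - u))"
proof -
  have ind: "indicator {0..t} (t - u) = (indicator {0..t} u :: real)" for u by (auto simp: indicator_def)
  have "(LBINT u:{0..t}. f u) = (\<integral>u. indicator {0..t} (t - u) *\<^sub>R f (t - u) \<partial>lborel)"
    unfolding set_lebesgue_integral_def by (subst lborel_integral_real_affine[of "-1" _ t]) auto
  then show "(LBINT u:{0..t}. f (t - u)) = (LBINT u:{0..t}. f u)"
    by (simp add: set_lebesgue_integral_def ind)
  assume "set_integrable lborel {0..t} f"
  then have "integrable lborel (\<lambda>u. indicator {0..t} (t + - 1 * u) *\<^sub>R f (t + - 1 * u))"
    unfolding set_integrable_def by (rule lborel_integrable_real_affine) simp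
  then show "set_integrable lborel {0..t} (\<lambda>u. f (t - u))"
    by (simp add: set_integrable_def ind)
qed

lemma slowly_varying_shift:
  assumes L: "slowly_varying L" and u: "0 \<le> u"
  shows "((\<lambda>t. L (t - u) / L t) \<longlongrightarrow> 1) at_top"
proof (rule tendstoI)
  fix e :: real assume e: "0 < e"
  define k where "k = 1 + e / 2"
  have k: "1 < k" "k < 1 + e" "0 < k" using e by (auto simp: k_def)
  have k': "1 - e < 1 / k"
  proof -
    have "(1 - e) * k = 1 - e / 2 - e * e / 2" by (simp add: k_def field_simps)
    also have "\<dots> < 1" using mult_pos_pos[OF e e] e by linarith
    finally show ?thesis using k(3) by (simp add: pos_less_divide_eq)
  qed
  obtain X where X: "0 < X" "\<And>x. X \<le> x \<Longrightarrow> 0 < L x"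
    "\<And>x y. X \<le> x \<Longrightarrow> x \<le> y \<Longrightarrow> y \<le> 2 * x \<Longrightarrow> L y \<le> k * L x \<and> L x \<le> k * L y"
    using slowly_varying_uniform[OF L k(1)] by blast
  have "\<forall>\<^sub>F t in at_top. 2 * u + X \<le> t" by (rule eventually_ge_at_top)
  then show "\<forall>\<^sub>F t in at_top. dist (L (t - u) / L t) 1 < e"
  proof eventually_elim
    case (elim t)
    have t: "X \<le> t - u" "t - u \<le> t" "t \<le> 2 * (t - u)" using elim u X(1) by auto
    have pos: "0 < L t" "0 < L (t - u)" using X(2)[of t] X(2)[of "t - u"] t by auto
    have "L (t - u) / L t \<le> k" "1 / k \<le> L (t - u) / L t"
      using X(3)[OF t] pos k(3) by (auto simp: field_simps)
    then show ?case using k(2) k' by (simp add: dist_real_def abs_less_iff)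
  qed
qed

text \<open>The integrable function \<open>A\<close> concentrates near 0, where \<open>B t (t - u)\<close> is comparable to \<open>\<kappa> b(t)\<close>:
  on \<open>{0..t/2}\<close> dominated convergence applies. On the other half \<open>A\<close> is at most \<open>e(t)\<close>, and what
  remains is the total mass of the kernel. The kernel may depend on \<open>t\<close>, which is needed for the
  moving argument \<open>s\<^sub>t\<close>.\<close>

lemma convolution_asymptotic:
  fixes A :: "real \<Rightarrow> real" and B :: "real \<Rightarrow> real \<Rightarrow> real" and b e E :: "real \<Rightarrow> real"
  assumes A: "set_integrable lborel {0..} A" "\<And>u. 0 < u \<Longrightarrow> 0 \<le> A u"
    and B: "\<And>t. 0 \<le> t \<Longrightarrow> set_integrable lborel {0..t} (B t)" "\<And>t u. 0 < u \<Longrightarrow> 0 \<le> B t u"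
    and b: "\<forall>\<^sub>F t in at_top. 0 < b t"
    and lim: "\<And>u. 0 \<le> u \<Longrightarrow> ((\<lambda>t. B t (t - u) / b t) \<longlongrightarrow> \<kappa>) at_top"
    and dom: "\<forall>\<^sub>F t in at_top. \<forall>u\<in>{0..t / 2}. B t (t - u) \<le> K * b t"
    and e: "\<forall>\<^sub>F t in at_top. \<forall>u\<in>{t / 2..t}. A u \<le> e t"
    and E: "\<forall>\<^sub>F t in at_top. (LBINT u:{0..t}. B t u) \<le> E t"
    and small: "((\<lambda>t. e t * E t / b t) \<longlongrightarrow> 0) at_top"
  shows "((\<lambda>t. (LBINT u:{0..t}. A u * B t (t - u)) / b t) \<longlongrightarrow> \<kappa> * (LBINT u:{0..}. A u)) at_top"
proof -
  have null: "AE u in lborel. u \<noteq> (c::real)" for c by (rule AE_lborel_singleton)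
  have A_meas: "(\<lambda>u. indicator {0..} u *\<^sub>R A u) \<in> borel_measurable lborel"
    using A(1) unfolding set_integrable_def by (rule borel_measurable_integrable)
  have B_refl: "set_integrable lborel {0..t} (\<lambda>u. B t (t - u))" if "0 \<le> t" for t
    using set_integral_reflect(2)[OF B(1)[OF that]] .
  have B_meas: "(\<lambda>u. indicator {0..t} u *\<^sub>R B t (t - u)) \<in> borel_measurable lborel" if "0 \<le> t" for t
    using B_refl[OF that] unfolding set_integrable_def by (rule borel_measurable_integrable)
  have AB_meas: "(\<lambda>u. indicator S u *\<^sub>R (A u * B t (t - u))) \<in> borel_measurable lborel"
    if S: "S \<subseteq> {0..t}" "S \<in> sets borel" and t: "0 \<le> t" for S t
  proof -
    have "(\<lambda>u. indicator S u * ((indicator {0..} u *\<^sub>R A u) * (indicator {0..t} u *\<^sub>R B t (t - u)))) \<in> borel_measurable lborel"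
      using A_meas B_meas[OF t] S(2) by (intro borel_measurable_times borel_measurable_indicator) auto
    also have "(\<lambda>u. indicator S u * ((indicator {0..} u *\<^sub>R A u) * (indicator {0..t} u *\<^sub>R B t (t - u)))) =
        (\<lambda>u. indicator S u *\<^sub>R (A u * B t (t - u)))"
      using S(1) by (auto simp: indicator_def fun_eq_iff)
    finally show ?thesis .
  qed
  have b_lim: "\<forall>\<^sub>F t in at_top. (0::real) < t" by (rule eventually_gt_at_top)
  define g where "g t u = (if 0 < t then indicator {0..t / 2} u *\<^sub>R (A u * B t (t - u)) / b t else 0)" for t u
  have "((\<lambda>t. \<integral>u. g t u \<partial>lborel) \<longlongrightarrow> (\<integral>u. \<kappa> * (indicator {0..} u *\<^sub>R A u) \<partial>lborel)) at_top"
  proof (rule integral_dominated_convergence_at_top[where w="\<lambda>u. \<bar>K\<bar> * \<bar>indicator {0..} u *\<^sub>R A u\<bar>"])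
    show "(\<lambda>u. \<kappa> * (indicator {0..} u *\<^sub>R A u)) \<in> borel_measurable lborel"
      using A_meas by (intro borel_measurable_times) auto
    show "g t \<in> borel_measurable lborel" for t
      unfolding g_def using AB_meas[of "{0..t / 2}" t]
      by (cases "0 < t") (auto intro!: borel_measurable_divide)
    show "integrable lborel (\<lambda>u. \<bar>K\<bar> * \<bar>indicator {0..} u *\<^sub>R A u\<bar>)"
      using A(1) unfolding set_integrable_def by auto
    show "\<forall>\<^sub>F t in at_top. AE u in lborel. norm (g t u) \<le> \<bar>K\<bar> * \<bar>indicator {0..} u *\<^sub>R A u\<bar>"
      using b dom b_lim
    proof eventually_elim
      case (elim t)
      show ?case using null[of 0]
      proof eventually_elim
        case (elim u)
        show ?case
        proof (cases "u \<in> {0..t / 2}")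
          case True
          then have u: "0 < u" "0 < t - u" using elim \<open>0 < t\<close> by auto
          have Bu: "0 \<le> B t (t - u)" using B(2)[OF u(2)] .
          have "B t (t - u) \<le> K * b t" using True \<open>\<forall>u\<in>{0..t / 2}. B t (t - u) \<le> K * b t\<close> by blast
          then have "B t (t - u) / b t \<le> K" using \<open>0 < b t\<close> by (simp add: pos_divide_le_eq)
          then have "A u * (B t (t - u) / b t) \<le> A u * \<bar>K\<bar>" using A(2)[OF u(1)] by (intro mult_left_mono) auto
          moreover have "norm (g t u) = A u * (B t (t - u) / b t)"
            using True A(2)[OF u(1)] Bu \<open>0 < b t\<close> \<open>0 < t\<close> by (simp add: g_def abs_mult)
          ultimately show ?thesis using True A(2)[OF u(1)] by (simp add: mult.commute)
        qed (simp add: g_def)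
      qed
    qed
    show "AE u in lborel. ((\<lambda>t. g t u) \<longlongrightarrow> \<kappa> * (indicator {0..} u *\<^sub>R A u)) at_top"
    proof (rule AE_I2)
      fix u :: real
      show "((\<lambda>t. g t u) \<longlongrightarrow> \<kappa> * (indicator {0..} u *\<^sub>R A u)) at_top"
      proof (cases "0 \<le> u")
        case True
        have "((\<lambda>t. B t (t - u) / b t * A u) \<longlongrightarrow> \<kappa> * A u) at_top"
          by (rule tendsto_mult[OF lim[OF True] tendsto_const])
        moreover have "\<forall>\<^sub>F t in at_top. B t (t - u) / b t * A u = g t u"
          using eventually_ge_at_top[of "2 * u"] b_lim
          by eventually_elim (use True in \<open>simp add: g_def\<close>)
        ultimately show ?thesis using True by (simp add: Lim_transform_eventually)
      next
        case False
        then have "(\<lambda>t. g t u) = (\<lambda>_. 0)" by (auto simp: g_def indicator_def fun_eq_iff)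
        with False show ?thesis by simp
      qed
    qed
  qed
  then have main: "((\<lambda>t. \<integral>u. g t u \<partial>lborel) \<longlongrightarrow> \<kappa> * (LBINT u:{0..}. A u)) at_top"
    by (simp add: set_lebesgue_integral_def)
  define R where "R t = (LBINT u:{t / 2<..t}. A u * B t (t - u))" for t
  have R: "\<forall>\<^sub>F t in at_top. set_integrable lborel {t / 2<..t} (\<lambda>u. A u * B t (t - u)) \<and> \<bar>R t\<bar> \<le> e t * E t"
    using e E b_lim
  proof eventually_elim
    case (elim t)
    have e0: "0 \<le> e t"
      using A(2)[of t] bspec[OF elim(1), of t] \<open>0 < t\<close> by auto
    have t0: "0 \<le> t" using \<open>0 < t\<close> by simp
    have int: "integrable lborel (\<lambda>u. e t * (indicator {0..t} u *\<^sub>R B t (t - u)))"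
      using B_refl[OF t0] by (simp add: set_integrable_def)
    have bd: "AE u in lborel. norm (indicator {t / 2<..t} u *\<^sub>R (A u * B t (t - u))) \<le> e t * (indicator {0..t} u *\<^sub>R B t (t - u))"
      using null[of t]
    proof eventually_elim
      case (elim u)
      show ?case
      proof (cases "u \<in> {0..t}")
        case True
        then have B0: "0 \<le> B t (t - u)" using elim by (intro B(2)) auto
        show ?thesis
        proof (cases "u \<in> {t / 2<..t}")
          case in2: True
          then have "A u \<le> e t" using \<open>\<forall>u\<in>{t / 2..t}. A u \<le> e t\<close> by auto
          moreover have "0 \<le> A u" using in2 \<open>0 < t\<close> by (intro A(2)) auto
          ultimately show ?thesis using in2 True B0 by (simp add: abs_mult mult_right_mono)
        next
          case False
          have "0 \<le> e t * (indicator {0..t} u *\<^sub>R B t (t - u))"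
            using e0 B0 by (intro mult_nonneg_nonneg) (auto simp: indicator_def)
          with False show ?thesis by simp
        qed
      next
        case False
        then have "u \<notin> {t / 2<..t}" using \<open>0 < t\<close> by auto
        with False show ?thesis by simp
      qed
    qed
    have set_int: "set_integrable lborel {t / 2<..t} (\<lambda>u. A u * B t (t - u))"
      unfolding set_integrable_def
    proof (rule Bochner_Integration.integrable_bound[OF int])
      show "(\<lambda>u. indicator {t / 2<..t} u *\<^sub>R (A u * B t (t - u))) \<in> borel_measurable lborel"
        using t0 by (intro AB_meas) auto
      show "AE u in lborel. norm (indicator {t / 2<..t} u *\<^sub>R (A u * B t (t - u))) \<le> norm (e t * (indicator {0..t} u *\<^sub>R B t (t - u)))"
        using bd by eventually_elim (rule order_trans, assumption, simp only: real_norm_def abs_ge_self)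
    qed
    have "\<bar>R t\<bar> \<le> (\<integral>u. norm (indicator {t / 2<..t} u *\<^sub>R (A u * B t (t - u))) \<partial>lborel)"
      unfolding R_def set_lebesgue_integral_def real_norm_def by (rule integral_abs_bound)
    also have "\<dots> \<le> (\<integral>u. e t * (indicator {0..t} u *\<^sub>R B t (t - u)) \<partial>lborel)"
      using set_int int bd by (intro integral_mono_AE) (auto simp: set_integrable_def)
    also have "\<dots> = e t * (LBINT u:{0..t}. B t u)"
      using set_integral_reflect(1)[of t "B t"] by (simp add: set_lebesgue_integral_def)
    also have "\<dots> \<le> e t * E t" using elim(2) e0 by (rule mult_left_mono)
    finally show ?case using set_int by blast
  qed
  have rest: "((\<lambda>t. R t / b t) \<longlongrightarrow> 0) at_top"
  proof (rule Lim_null_comparison[OF _ small])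
    show "\<forall>\<^sub>F t in at_top. norm (R t / b t) \<le> e t * E t / b t"
      using R b
    proof eventually_elim
      case (elim t)
      then have "\<bar>R t\<bar> / b t \<le> e t * E t / b t" by (intro divide_right_mono) auto
      with elim show ?case by (simp only: real_norm_def abs_divide abs_of_pos)
    qed
  qed
  have "((\<lambda>t. (\<integral>u. g t u \<partial>lborel) + R t / b t) \<longlongrightarrow> \<kappa> * (LBINT u:{0..}. A u) + 0) at_top"
    by (rule tendsto_add[OF main rest])
  moreover have "\<forall>\<^sub>F t in at_top. (\<integral>u. g t u \<partial>lborel) + R t / b t = (LBINT u:{0..t}. A u * B t (t - u)) / b t"
    using R b dom b_lim
  proof eventually_elim
    case (elim t)
    have t0: "0 \<le> t" using \<open>0 < t\<close> by simp
    have first: "set_integrable lborel {0..t / 2} (\<lambda>u. A u * B t (t - u))"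
      unfolding set_integrable_def
    proof (rule Bochner_Integration.integrable_bound)
      show "integrable lborel (\<lambda>u. (K * b t) * \<bar>indicator {0..} u *\<^sub>R A u\<bar>)"
        using A(1) unfolding set_integrable_def by auto
      show "(\<lambda>u. indicator {0..t / 2} u *\<^sub>R (A u * B t (t - u))) \<in> borel_measurable lborel"
        using t0 by (intro AB_meas) auto
      show "AE u in lborel. norm (indicator {0..t / 2} u *\<^sub>R (A u * B t (t - u))) \<le> norm (K * b t * \<bar>indicator {0..} u *\<^sub>R A u\<bar>)"
        using null[of 0]
      proof eventually_elim
        case (elim u)
        show ?case
        proof (cases "u \<in> {0..t / 2}")
          case True
          then have u: "0 < u" "0 < t - u" using elim \<open>0 < t\<close> by auto
          have "B t (t - u) \<le> K * b t" using True \<open>\<forall>u\<in>{0..t / 2}. B t (t - u) \<le> K * b t\<close> by blast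
          then have "A u * B t (t - u) \<le> A u * (K * b t)" using A(2)[OF u(1)] by (rule mult_left_mono)
          moreover have "0 \<le> A u * B t (t - u)" using A(2)[OF u(1)] B(2)[OF u(2)] by simp
          ultimately show ?thesis
            using True A(2)[OF u(1)] order_trans[OF _ abs_ge_self[of "K * b t * A u"]]
            by (simp add: abs_mult mult_ac)
        qed simp
      qed
    qed
    have "{0..t} = {0..t / 2} \<union> {t / 2<..t}" using \<open>0 < t\<close> by auto
    then have "(LBINT u:{0..t}. A u * B t (t - u)) = (LBINT u:{0..t / 2}. A u * B t (t - u)) + R t"
      unfolding R_def using first elim(1) by (simp, intro set_integral_Un) auto
    moreover have "(\<integral>u. g t u \<partial>lborel) = (LBINT u:{0..t / 2}. A u * B t (t - u)) / b t"
      using \<open>0 < t\<close> by (simp add: g_def set_lebesgue_integral_def)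
    ultimately show ?case by (simp add: add_divide_distrib)
  qed
  ultimately show ?thesis by (simp add: Lim_transform_eventually)
qed

text \<open>As \<open>1 - exp (- x) = x \<psi>(x)\<close> with \<open>\<psi>\<close> continuous and \<open>\<psi>(0) = 1\<close>, the exponentials may be
  linearised.\<close>

lemma one_minus_exp_ratio:
  fixes J\<^sub>1 J\<^sub>0 b :: "real \<Rightarrow> real"
  assumes J: "((\<lambda>t. J\<^sub>1 t / b t) \<longlongrightarrow> d\<^sub>1) at_top" "((\<lambda>t. J\<^sub>0 t / b t) \<longlongrightarrow> d\<^sub>0) at_top"
    and b: "\<forall>\<^sub>F t in at_top. 0 < b t" "(b \<longlongrightarrow> 0) at_top" and d: "d\<^sub>0 \<noteq> 0"
  shows "((\<lambda>t. (1 - exp (- J\<^sub>1 t)) / (1 - exp (- J\<^sub>0 t))) \<longlongrightarrow> d\<^sub>1 / d\<^sub>0) at_top"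
proof -
  define \<psi> where "\<psi> x = (if x = 0 then 1 else (1 - exp (- x)) / x)" for x :: real
  have \<psi>: "1 - exp (- x) = x * \<psi> x" for x by (simp add: \<psi>_def)
  have "((\<lambda>x. (1 - exp (- x)) / x) \<longlongrightarrow> 1) (at (0::real))"
    by real_asymp
  then have "(\<psi> \<longlongrightarrow> 1) (at 0)"
    by (rule Lim_transform_eventually) (auto simp: \<psi>_def eventually_at_filter)
  then have \<psi>_cont: "isCont \<psi> 0" by (simp add: isCont_def \<psi>_def)
  have lim: "((\<lambda>t. (1 - exp (- J t)) / b t) \<longlongrightarrow> d) at_top" if J: "((\<lambda>t. J t / b t) \<longlongrightarrow> d) at_top" for J d
  proof -
    have "((\<lambda>t. J t / b t * b t) \<longlongrightarrow> d * 0) at_top" by (rule tendsto_mult[OF J b(2)])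
    moreover have "\<forall>\<^sub>F t in at_top. J t / b t * b t = J t" using b(1) by eventually_elim simp
    ultimately have "(J \<longlongrightarrow> 0) at_top" by (simp add: Lim_transform_eventually)
    from isCont_tendsto_compose[OF \<psi>_cont this]
    have "((\<lambda>t. \<psi> (J t)) \<longlongrightarrow> 1) at_top" by (simp add: \<psi>_def)
    from tendsto_mult[OF J this] show ?thesis by (simp add: \<psi>)
  qed
  have "((\<lambda>t. (1 - exp (- J\<^sub>1 t)) / b t / ((1 - exp (- J\<^sub>0 t)) / b t)) \<longlongrightarrow> d\<^sub>1 / d\<^sub>0) at_top"
    by (rule tendsto_divide[OF lim[OF J(1)] lim[OF J(2)] d])
  moreover have "\<forall>\<^sub>F t in at_top. (1 - exp (- J\<^sub>1 t)) / b t / ((1 - exp (- J\<^sub>0 t)) / b t) =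
      (1 - exp (- J\<^sub>1 t)) / (1 - exp (- J\<^sub>0 t))"
    using b(1) by eventually_elim simp
  ultimately show ?thesis by (rule Lim_transform_eventually)
qed

section \<open>Asymptotics of the function q\<close>

locale critical_model = critical_offspring \<mu> p \<gamma> L
  for \<mu> :: real and p :: "nat pmf" and \<gamma> :: real and L :: "real \<Rightarrow> real" +
  fixes h :: "nat pmf" and \<alpha> :: real and l :: "real \<Rightarrow> real"
  assumes alpha: "0 < \<alpha>"
    and slow_immigrants: "slowly_varying l"
    and immigrants: "\<And>s. 0 \<le> s \<Longrightarrow> s < 1 \<Longrightarrow> pgf h s = 1 - (1 - s) powr \<alpha> * l (1 / (1 - s))"
begin

abbreviation "q \<equiv> q_fun \<mu> p h"

lemma pgf_immigrants_less_one: assumes y: "0 \<le> y" "y < 1" shows "pgf h y < 1"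
proof -
  obtain a where a: "\<And>x. a \<le> x \<Longrightarrow> 0 < l x" using slow_immigrants by (auto simp: slowly_varying_def)
  define x where "x = max (max a 1) (1 / (1 - y))"
  have x: "0 < l x" "1 \<le> x" "1 / (1 - y) \<le> x" by (auto simp: x_def a)
  have "y \<le> 1 - 1 / x"
  proof -
    have "1 \<le> x * (1 - y)" using x(3) y by (simp add: pos_divide_le_eq)
    then have "1 / x \<le> 1 - y" using x(2) by (simp add: pos_divide_le_eq mult.commute)
    then show ?thesis by simp
  qed
  then have "pgf h y \<le> pgf h (1 - 1 / x)" using y x(2) by (intro pgf_mono) auto
  also have "\<dots> = 1 - (1 / x) powr \<alpha> * l x" using immigrants[of "1 - 1 / x"] x(2) by simp
  also have "\<dots> < 1" using x by simp
  finally show ?thesis .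
qed

text \<open>\<open>H\<close> and \<open>K\<close> are reciprocals, so that they increase and the lemmas on monotone regularly varying
  functions apply: \<open>q(t;s) = 1 / K(\<mu>t + V(1/(1 - s)))\<close>.\<close>

definition H :: "real \<Rightarrow> real" where "H x = 1 / (1 - pgf h (1 - 1 / x))"

lemma H_pos: "1 \<le> x \<Longrightarrow> 0 < H x"
  unfolding H_def using pgf_immigrants_less_one[of "1 - 1 / x"] by simp

lemma H_mono: "mono_on {1..} H"
proof (rule mono_onI)
  fix x y :: real assume xy: "x \<in> {1..}" "y \<in> {1..}" "x \<le> y"
  then have "1 - 1 / x \<le> 1 - 1 / y" by (simp add: frac_le)
  then have "pgf h (1 - 1 / x) \<le> pgf h (1 - 1 / y)" using xy by (intro pgf_mono) auto
  moreover have "pgf h (1 - 1 / y) < 1" "pgf h (1 - 1 / x) < 1"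
    using xy by (auto intro!: pgf_immigrants_less_one)
  ultimately show "H x \<le> H y" unfolding H_def by (intro divide_left_mono) auto
qed

lemma H_regularly_varying: "regularly_varying H \<alpha>"
  unfolding regularly_varying_def
proof (intro conjI allI impI)
  show "\<forall>\<^sub>F x in at_top. 0 < H x"
    by (rule eventually_mono[OF eventually_ge_at_top[of 1]]) (rule H_pos)
  fix c :: real assume c: "0 < c"
  obtain a where a: "\<And>x. a \<le> x \<Longrightarrow> 0 < l x" using slow_immigrants by (auto simp: slowly_varying_def)
  have H_eq: "H x = x powr \<alpha> / l x" if "1 \<le> x" for x
    using immigrants[of "1 - 1 / x"] that by (simp add: H_def powr_divide)
  have "((\<lambda>x. c powr \<alpha> * (1 / (l (c * x) / l x))) \<longlongrightarrow> c powr \<alpha> * (1 / 1)) at_top"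
    using slow_immigrants c by (intro tendsto_intros) (auto simp: slowly_varying_def)
  moreover have "\<forall>\<^sub>F x in at_top. max (max 1 (1 / c)) (max a (a / c)) \<le> x" by (rule eventually_ge_at_top)
  then have "\<forall>\<^sub>F x in at_top. c powr \<alpha> * (1 / (l (c * x) / l x)) = H (c * x) / H x"
  proof eventually_elim
    case (elim x)
    then have x: "1 \<le> x" "1 \<le> c * x" "a \<le> x" "a \<le> c * x" using c by (auto simp: field_simps)
    then show ?case
      using a[of x] a[of "c * x"] c by (simp add: H_eq powr_mult field_simps)
  qed
  ultimately show "((\<lambda>x. H (c * x) / H x) \<longlongrightarrow> c powr \<alpha>) at_top"
    by (simp add: Lim_transform_eventually)
qed

definition K :: "real \<Rightarrow> real" where "K y = H (W y)"

lemma K_pos: "0 \<le> y \<Longrightarrow> 0 < K y"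
  unfolding K_def using H_pos W_right_inverse by simp

lemma K_mono: "mono_on {0..} K"
  unfolding K_def using W_mono W_right_inverse
  by (intro mono_onI mono_onD[OF H_mono]) auto

lemma K_regularly_varying: "regularly_varying K (\<alpha> / \<gamma>)"
  using regularly_varying_compose[OF H_regularly_varying less_imp_le[OF alpha] H_mono W_regularly_varying W_at_top]
  by (simp add: K_def[abs_def])

lemma V_nonneg: "0 \<le> s \<Longrightarrow> s < 1 \<Longrightarrow> 0 \<le> V (1 / (1 - s))"
proof -
  assume s: "0 \<le> s" "s < 1"
  then have "1 \<le> 1 / (1 - s)" by simp
  from order_trans[OF ln_ge_zero[OF this] V_ge_ln[OF this]] show ?thesis .
qed

lemma q_eq:
  assumes s: "0 \<le> s" "s < 1" and t: "0 \<le> t"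
  shows "q t s = 1 / K (\<mu> * t + V (1 / (1 - s)))"
proof -
  have "F t s = 1 - 1 / W (\<mu> * t + V (1 / (1 - s)))" using survival[OF s t] by simp
  then show ?thesis by (simp add: q_fun_def K_def H_def)
qed

lemma q_zero_eq: "0 \<le> t \<Longrightarrow> q t 0 = 1 / K (\<mu> * t)"
  using q_eq[of 0 t] by simp

lemma q_bounds: assumes "0 \<le> s" "s \<le> 1" shows "0 \<le> q t s" "q t s \<le> 1"
proof -
  have "0 \<le> F t s" "F t s \<le> 1"
    using order_trans[OF assms(1) F_bounds(1)[OF assms, of t]] F_bounds(2)[OF assms, of t] by auto
  then show "0 \<le> q t s" "q t s \<le> 1" by (auto simp: q_fun_def pgf_nonneg pgf_le_one)
qed

lemma q_antimono:
  assumes "0 \<le> s" "s < 1" "0 \<le> t" "t \<le> t'" shows "q t' s \<le> q t 0"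
proof -
  have "\<mu> * t \<le> \<mu> * t'" using assms rate by simp
  then have "\<mu> * t \<le> \<mu> * t' + V (1 / (1 - s))" using V_nonneg[OF assms(1,2)] by linarith
  then have "K (\<mu> * t) \<le> K (\<mu> * t' + V (1 / (1 - s)))"
    using assms(3) rate by (intro mono_onD[OF K_mono]) (auto intro: order_trans[of 0 "\<mu> * t"])
  then show ?thesis
    using assms K_pos[of "\<mu> * t"] rate by (simp add: q_eq[OF assms(1,2)] q_zero_eq frac_le)
qed

lemma q_zero_pos: "0 \<le> t \<Longrightarrow> 0 < q t 0"
  using q_zero_eq[of t] K_pos[of "\<mu> * t"] rate by simp

lemma measurable_q [measurable]: "(\<lambda>t. q t s) \<in> borel_measurable borel"
  unfolding q_fun_def by measurable

lemma set_integrable_q: "0 \<le> s \<Longrightarrow> s \<le> 1 \<Longrightarrow> set_integrable lborel {0..b} (\<lambda>u. q u s)"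
proof (rule set_integrable_bound[of lborel _ "\<lambda>_. 1 :: real"])
  show "set_integrable lborel {0..b} (\<lambda>_. 1 :: real)"
    by (intro borel_integrable_atLeastAtMost' continuous_on_const)
  show "set_borel_measurable lborel {0..b} (\<lambda>u. q u s)" unfolding set_borel_measurable_def by measurable
qed (use q_bounds in auto)

lemma q_regularly_varying: "regularly_varying (\<lambda>t. q t 0) (- (\<alpha> / \<gamma>))"
  unfolding regularly_varying_def
proof (intro conjI allI impI)
  show "\<forall>\<^sub>F t in at_top. 0 < q t 0"
    by (rule eventually_mono[OF eventually_ge_at_top[of 0]]) (rule q_zero_pos)
  fix c :: real assume c: "0 < c"
  have "filterlim (\<lambda>t. \<mu> * t) at_top at_top"
    using rate by (intro filterlim_tendsto_pos_mult_at_top[OF tendsto_const _ filterlim_ident])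
  then have "((\<lambda>t. 1 / (K (c * (\<mu> * t)) / K (\<mu> * t))) \<longlongrightarrow> 1 / c powr (\<alpha> / \<gamma>)) at_top"
    using K_regularly_varying c
    by (intro tendsto_divide tendsto_const)
       (auto simp: regularly_varying_def intro: filterlim_compose[of "\<lambda>x. K (c * x) / K x"])
  moreover have "\<forall>\<^sub>F t in at_top. 1 / (K (c * (\<mu> * t)) / K (\<mu> * t)) = q (c * t) 0 / q t 0"
    using eventually_ge_at_top[of 0]
  proof eventually_elim
    case (elim t)
    then show ?case using c by (simp add: q_zero_eq mult_ac)
  qed
  ultimately show "((\<lambda>t. q (c * t) 0 / q t 0) \<longlongrightarrow> c powr - (\<alpha> / \<gamma>)) at_top"
    by (simp add: powr_minus_divide Lim_transform_eventually)
qed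

lemma q_upper_bound:
  assumes "\<beta> < \<alpha> / \<gamma>"
  obtains X C where "0 < X" "0 < C" "\<And>t. X \<le> t \<Longrightarrow> q t 0 \<le> C * t powr (- \<beta>)"
proof -
  have less: "- (\<alpha> / \<gamma>) < - \<beta>" using assms by simp
  have bdd: "\<exists>B. \<forall>t\<in>{0..b}. q t 0 \<le> B" for b
    using q_bounds(2)[of 0] by (intro exI[of _ 1]) simp
  show thesis
  proof (rule regularly_varying_power_bound[OF q_regularly_varying less bdd])
    fix X C assume X: "0 < X" "0 < C" "\<And>t. X \<le> t \<Longrightarrow> 0 < q t 0 \<and> q t 0 \<le> C * t powr (- \<beta>)"
    show thesis by (rule that[OF X(1,2)]) (use X(3) in blast)
  qed
qed

lemma q_lower_bound:
  assumes "\<alpha> / \<gamma> < \<beta>"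
  obtains X C where "0 < X" "0 < C" "\<And>t. X \<le> t \<Longrightarrow> 1 / q t 0 \<le> C * t powr \<beta>"
proof -
  have rv: "regularly_varying (\<lambda>t. 1 / q t 0) (\<alpha> / \<gamma>)"
    using regularly_varying_inverse[OF q_regularly_varying] by simp
  have bdd: "\<exists>B. \<forall>t\<in>{0..b}. 1 / q t 0 \<le> B" for b
  proof (intro exI ballI)
    fix t assume t: "t \<in> {0..b}"
    then have "q b 0 \<le> q t 0" by (intro q_antimono) auto
    moreover have "0 < q b 0" using t by (intro q_zero_pos) auto
    ultimately show "1 / q t 0 \<le> 1 / q b 0" by (intro divide_left_mono) auto
  qed
  show thesis
  proof (rule regularly_varying_power_bound[OF rv assms bdd])
    fix X C assume X: "0 < X" "0 < C" "\<And>t. X \<le> t \<Longrightarrow> 0 < 1 / q t 0 \<and> 1 / q t 0 \<le> C * t powr \<beta>"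
    show thesis by (rule that[OF X(1,2)]) (use X(3) in blast)
  qed
qed

text \<open>Starting from \<open>s\<close> instead of 0 amounts to starting the clock at \<open>V(1/(1 - s))\<close>, which is compared
  with \<open>\<mu>t\<close>.\<close>

lemma q_ratio_tendsto:
  assumes s: "\<And>t. 0 \<le> s t \<and> s t < 1" and d: "0 \<le> d"
    and lim: "((\<lambda>t. V (1 / (1 - s t)) / (\<mu> * t)) \<longlongrightarrow> d) at_top" and u: "0 \<le> u"
  shows "((\<lambda>t. q (t - u) (s t) / q t 0) \<longlongrightarrow> (1 + d) powr (- (\<alpha> / \<gamma>))) at_top"
proof -
  define f where "f t = (\<mu> * (t - u) + V (1 / (1 - s t))) / (\<mu> * t)" for t
  have top: "filterlim (\<lambda>t. \<mu> * t) at_top at_top"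
    using rate by (intro filterlim_tendsto_pos_mult_at_top[OF tendsto_const _ filterlim_ident])
  have "((\<lambda>t. (t - u) / t) \<longlongrightarrow> 1) at_top" by real_asymp
  then have "((\<lambda>t. (t - u) / t + V (1 / (1 - s t)) / (\<mu> * t)) \<longlongrightarrow> 1 + d) at_top" by (rule tendsto_add[OF _ lim])
  moreover have "\<forall>\<^sub>F t in at_top. (t - u) / t + V (1 / (1 - s t)) / (\<mu> * t) = f t"
    using eventually_gt_at_top[of 0] by eventually_elim (use rate in \<open>simp add: f_def add_divide_distrib\<close>)
  ultimately have "(f \<longlongrightarrow> 1 + d) at_top" by (rule Lim_transform_eventually)
  then have "((\<lambda>t. K (f t * (\<mu> * t)) / K (\<mu> * t)) \<longlongrightarrow> (1 + d) powr (\<alpha> / \<gamma>)) at_top"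
    using d alpha gamma by (intro regularly_varying_mono_limit[OF K_regularly_varying _ K_mono _ _ top]) auto
  then have "((\<lambda>t. 1 / (K (f t * (\<mu> * t)) / K (\<mu> * t))) \<longlongrightarrow> 1 / (1 + d) powr (\<alpha> / \<gamma>)) at_top"
    using d by (intro tendsto_divide tendsto_const) auto
  moreover have "\<forall>\<^sub>F t in at_top. 1 / (K (f t * (\<mu> * t)) / K (\<mu> * t)) = q (t - u) (s t) / q t 0"
    using eventually_ge_at_top[of u] eventually_gt_at_top[of 0]
  proof eventually_elim
    case (elim t)
    then have "f t * (\<mu> * t) = \<mu> * (t - u) + V (1 / (1 - s t))" using rate by (simp add: f_def)
    then show ?case using elim s by (simp add: q_eq q_zero_eq)
  qed
  ultimately show ?thesis by (simp add: powr_minus_divide Lim_transform_eventually)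
qed

text \<open>Since \<open>1 / (1 - exp (- z / w))\<close> is asymptotic to \<open>w / z\<close> and \<open>V(W(\<mu>t)) = \<mu>t\<close>.\<close>

lemma V_scaled:
  assumes z: "0 < z"
  shows "((\<lambda>t. V (1 / (1 - exp (- z / W (\<mu> * t)))) / (\<mu> * t)) \<longlongrightarrow> z powr (- \<gamma>)) at_top"
proof -
  have "filterlim (\<lambda>t. \<mu> * t) at_top at_top"
    using rate by (intro filterlim_tendsto_pos_mult_at_top[OF tendsto_const _ filterlim_ident])
  then have W_top: "filterlim (\<lambda>t. W (\<mu> * t)) at_top at_top" by (rule filterlim_compose[OF W_at_top])
  have "((\<lambda>x. 1 / ((1 - exp (- z / x)) * x)) \<longlongrightarrow> inverse z) at_top" using z by real_asymp
  then have "((\<lambda>x. 1 / ((1 - exp (- z / x)) * x)) \<longlongrightarrow> 1 / z) at_top" by (simp only: inverse_eq_divide)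
  from filterlim_compose[OF this W_top]
  have "((\<lambda>t. 1 / ((1 - exp (- z / W (\<mu> * t))) * W (\<mu> * t))) \<longlongrightarrow> 1 / z) at_top" .
  then have "((\<lambda>t. V (1 / ((1 - exp (- z / W (\<mu> * t))) * W (\<mu> * t)) * W (\<mu> * t)) / V (W (\<mu> * t)))
      \<longlongrightarrow> (1 / z) powr \<gamma>) at_top"
    using z gamma by (intro regularly_varying_mono_limit[OF V_regularly_varying _ V_mono _ _ W_top]) auto
  moreover have "\<forall>\<^sub>F t in at_top. V (1 / ((1 - exp (- z / W (\<mu> * t))) * W (\<mu> * t)) * W (\<mu> * t)) / V (W (\<mu> * t)) =
      V (1 / (1 - exp (- z / W (\<mu> * t)))) / (\<mu> * t)"
    using eventually_ge_at_top[of 0]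
  proof eventually_elim
    case (elim t)
    then have W: "1 \<le> W (\<mu> * t)" "V (W (\<mu> * t)) = \<mu> * t" using W_right_inverse[of "\<mu> * t"] rate by auto
    have "1 / (c * w) * w = 1 / c" if "1 \<le> w" for c w :: real using that by simp
    from this[OF W(1)] show ?case by (simp only: W(2))
  qed
  ultimately have "((\<lambda>t. V (1 / (1 - exp (- z / W (\<mu> * t)))) / (\<mu> * t)) \<longlongrightarrow> (1 / z) powr \<gamma>) at_top"
    by (rule Lim_transform_eventually)
  moreover have "(1 / z) powr \<gamma> = z powr (- \<gamma>)" using z by (simp add: powr_divide powr_minus_divide)
  ultimately show ?thesis by (simp only:)
qed

end

section \<open>The convolution of the intensity with q\<close>

locale decaying_intensity = critical_model \<mu> p \<gamma> L h \<alpha> l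
  for \<mu> :: real and p :: "nat pmf" and \<gamma> :: real and L :: "real \<Rightarrow> real"
    and h :: "nat pmf" and \<alpha> :: real and l :: "real \<Rightarrow> real" +
  fixes r :: "real \<Rightarrow> real" and \<theta> :: real and L\<^sub>R :: "real \<Rightarrow> real"
  assumes intensity: "\<And>t. 0 < t \<Longrightarrow> r t = t powr (- \<theta>) * L\<^sub>R t"
    and intensity_ge: "\<And>t. 0 < t \<Longrightarrow> 0 \<le> r t"
    and intensity_int: "\<And>t. set_integrable lborel {0..t} r"
    and slow_intensity: "slowly_varying L\<^sub>R"
begin

lemma intensity_pos: "\<forall>\<^sub>F t in at_top. 0 < r t"
proof -
  obtain a where a: "\<And>x. a \<le> x \<Longrightarrow> 0 < L\<^sub>R x" using slow_intensity by (auto simp: slowly_varying_def)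
  show ?thesis
    using eventually_ge_at_top[of a] eventually_gt_at_top[of 0]
    by eventually_elim (simp add: intensity a)
qed

lemma intensity_upper:
  assumes "0 < \<delta>"
  obtains X C where "0 < X" "0 < C" "\<And>t. X \<le> t \<Longrightarrow> r t \<le> C * t powr (\<delta> - \<theta>)"
proof -
  obtain X C where X: "0 < X" "0 < C" "\<And>x. X \<le> x \<Longrightarrow> 0 < L\<^sub>R x"
    "\<And>x. X \<le> x \<Longrightarrow> L\<^sub>R x \<le> C * x powr \<delta>"
    by (rule slowly_varying_upper[OF slow_intensity assms]) (rule that; blast)
  have "r t \<le> C * t powr (\<delta> - \<theta>)" if t: "X \<le> t" for t
  proof -
    have "r t \<le> t powr (- \<theta>) * (C * t powr \<delta>)"
      using intensity[of t] X(1) X(4)[OF t] t by (simp add: mult_left_mono)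
    also have "\<dots> = C * (t powr (- \<theta>) * t powr \<delta>)" by (rule mult.left_commute)
    also have "t powr (- \<theta>) * t powr \<delta> = t powr (\<delta> - \<theta>)" by (simp add: powr_add[symmetric])
    finally show ?thesis .
  qed
  then show thesis by (rule that[OF X(1,2)])
qed

text \<open>For \<open>\<theta> = 1\<close> and \<open>\<alpha>/\<gamma> > 1\<close> the integrable factor is \<open>q\<close> and the kernel is \<open>r\<close>.\<close>

lemma intensity_convolution_harmonic:
  assumes \<theta>: "\<theta> = 1" and a: "1 < \<alpha> / \<gamma>" and s: "0 \<le> s" "s < 1"
  shows "((\<lambda>t. (LBINT u:{0..t}. r u * q (t - u) s) / r t) \<longlongrightarrow> (LBINT u:{0..}. q u s)) at_top"
    and "set_integrable lborel {0..} (\<lambda>u. q u s)"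
proof -
  \<comment> \<open>With \<open>\<beta> = 1 + 3 \<delta>\<close> the remainder, at most of order \<open>t\<^bsup>-\<beta>\<^esup> t\<^sup>\<delta> / t\<^bsup>-1-\<delta>\<^esup> = t\<^bsup>-\<delta>\<^esup>\<close>, is negligible.\<close>
  define \<beta> \<delta> where "\<beta> = (1 + \<alpha> / \<gamma>) / 2" and "\<delta> = (\<beta> - 1) / 3"
  have \<beta>: "1 < \<beta>" "\<beta> < \<alpha> / \<gamma>" and \<delta>: "0 < \<delta>" and \<beta>\<delta>: "\<beta> = 1 + 3 * \<delta>"
  proof -
    have "1 < (1 + k) / 2 \<and> (1 + k) / 2 < k \<and> 0 < ((1 + k) / 2 - 1) / 3 \<and>
        (1 + k) / 2 = 1 + 3 * (((1 + k) / 2 - 1) / 3)" if "1 < k" for k :: real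
      using that by (simp add: field_simps)
    from this[OF a] show "1 < \<beta>" "\<beta> < \<alpha> / \<gamma>" "0 < \<delta>" "\<beta> = 1 + 3 * \<delta>"
      unfolding \<delta>_def \<beta>_def by blast+
  qed
  have s1: "s \<le> 1" using s by simp
  obtain X1 C1 where X1: "0 < X1" "0 < C1" "\<And>t. X1 \<le> t \<Longrightarrow> q t 0 \<le> C1 * t powr (- \<beta>)"
    by (rule q_upper_bound[OF \<beta>(2)]) (rule that; blast)
  obtain X2 C2 where X2: "0 < X2" "0 < C2" "\<And>t. X2 \<le> t \<Longrightarrow> r t \<le> C2 * t powr (\<delta> - 1)"
    by (rule intensity_upper[OF \<delta>, unfolded \<theta>]) (rule that; blast)
  obtain X3 C3 where X3: "0 < X3" "0 < C3" "\<And>x. X3 \<le> x \<Longrightarrow> 0 < L\<^sub>R x"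
    "\<And>x. X3 \<le> x \<Longrightarrow> C3 * x powr (- \<delta>) \<le> L\<^sub>R x"
    by (rule slowly_varying_lower[OF slow_intensity \<delta>]) (rule that; blast)
  have r_lower: "C3 * t powr (- \<delta> - 1) \<le> r t" if t: "X3 \<le> t" for t
  proof -
    have exponent: "- \<delta> - 1 = - 1 + - \<delta>" by simp
    have "C3 * t powr (- \<delta> - 1) = t powr (- 1) * (C3 * t powr (- \<delta>))"
      unfolding exponent powr_add by (rule mult.left_commute)
    also have "\<dots> \<le> t powr (- 1) * L\<^sub>R t" by (rule mult_left_mono[OF X3(4)[OF t]]) simp
    also have "\<dots> = r t" using intensity[of t] X3(1) t \<theta> by simp
    finally show ?thesis .
  qed
  have two: "1 < (2 :: real)" by simp
  obtain X4 where X4: "0 < X4" "\<And>x. X4 \<le> x \<Longrightarrow> 0 < L\<^sub>R x"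
    "\<And>x y. X4 \<le> x \<Longrightarrow> x \<le> y \<Longrightarrow> y \<le> 2 * x \<Longrightarrow> L\<^sub>R y \<le> 2 * L\<^sub>R x \<and> L\<^sub>R x \<le> 2 * L\<^sub>R y"
    by (rule slowly_varying_uniform[OF slow_intensity two]) (rule that; blast)
  have e1: "- 1 < \<delta> - 1" using \<delta> by simp
  obtain A0 where A0: "0 \<le> A0" "\<And>t. 0 \<le> t \<Longrightarrow> (LBINT u:{0..t}. r u) \<le> A0 + C2 / (\<delta> - 1 + 1) * t powr (\<delta> - 1 + 1)"
    by (rule set_integral_growth_bound[OF intensity_int X2(1) less_imp_le[OF X2(2)] _ e1], rule X2(3), assumption)
       (rule that; blast)
  define E where "E t = A0 + C2 / \<delta> * t powr \<delta>" for t
  show q_int: "set_integrable lborel {0..} (\<lambda>u. q u s)"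
  proof (rule set_integrable_at_top_of_power_bound[OF set_integrable_q[OF s(1) s1] X1(1)])
    show "\<bar>q u s\<bar> \<le> C1 * u powr (- \<beta>)" if "X1 \<le> u" for u
      using X1(3)[OF that] q_bounds[OF s(1) s1] q_antimono[OF s, of u u] X1(1) that by simp
  qed (use \<beta> in simp)
  have "((\<lambda>t. (LBINT u:{0..t}. q u s * r (t - u)) / r t) \<longlongrightarrow> 1 * (LBINT u:{0..}. q u s)) at_top"
  proof (rule convolution_asymptotic[where B="\<lambda>_. r" and e="\<lambda>t. q (t / 2) 0" and E=E and K=4])
    show "set_integrable lborel {0..} (\<lambda>u. q u s)" by (rule q_int)
    show "0 \<le> q u s" for u using q_bounds[OF s(1) s1] by simp
    show "set_integrable lborel {0..t} r" for t by (rule intensity_int)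
    show "0 \<le> r u" if "0 < u" for u using that by (rule intensity_ge)
    show "\<forall>\<^sub>F t in at_top. 0 < r t" by (rule intensity_pos)
    show "((\<lambda>t. r (t - u) / r t) \<longlongrightarrow> 1) at_top" if u: "0 \<le> u" for u
    proof -
      have "((\<lambda>t. t / (t - u)) \<longlongrightarrow> 1) at_top" by real_asymp
      from tendsto_mult[OF this slowly_varying_shift[OF slow_intensity u]]
      have "((\<lambda>t. t / (t - u) * (L\<^sub>R (t - u) / L\<^sub>R t)) \<longlongrightarrow> 1) at_top" by simp
      moreover have "\<forall>\<^sub>F t in at_top. t / (t - u) * (L\<^sub>R (t - u) / L\<^sub>R t) = r (t - u) / r t"
        using eventually_gt_at_top[of u] by eventually_elim (use u in \<open>simp add: intensity \<theta> powr_minus_divide\<close>)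
      ultimately show ?thesis by (rule Lim_transform_eventually)
    qed
    show "\<forall>\<^sub>F t in at_top. \<forall>u\<in>{0..t / 2}. r (t - u) \<le> 4 * r t"
      using eventually_ge_at_top[of "2 * X4"]
    proof (eventually_elim, intro ballI)
      fix t u assume t: "2 * X4 \<le> t" and u: "u \<in> {0..t / 2}"
      then have y: "0 < t" "0 < t - u" "t / 2 \<le> t - u" using X4(1) by auto
      have L: "L\<^sub>R (t - u) \<le> 2 * L\<^sub>R t" using X4(3)[of "t - u" t] t u by auto
      have "r (t - u) = L\<^sub>R (t - u) / (t - u)" using y by (simp add: intensity \<theta> powr_minus_divide)
      also have "\<dots> \<le> 2 * L\<^sub>R t / (t / 2)"
        using L y X4(2)[of "t - u"] X4(2)[of t] t u by (intro frac_le) auto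
      also have "\<dots> = 4 * r t" using y by (simp add: intensity \<theta> powr_minus_divide)
      finally show "r (t - u) \<le> 4 * r t" .
    qed
    show "\<forall>\<^sub>F t in at_top. \<forall>u\<in>{t / 2..t}. q u s \<le> q (t / 2) 0"
      using eventually_ge_at_top[of 0]
      by eventually_elim (use q_antimono[OF s] in auto)
    show "\<forall>\<^sub>F t in at_top. (LBINT u:{0..t}. r u) \<le> E t"
      using eventually_ge_at_top[of 0] by eventually_elim (use A0(2) in \<open>simp add: E_def\<close>)
    show "((\<lambda>t. q (t / 2) 0 * E t / r t) \<longlongrightarrow> 0) at_top"
    proof (rule Lim_null_comparison)
      show "((\<lambda>t. C1 * (t / 2) powr (- \<beta>) * (A0 + C2 / \<delta> * t powr \<delta>) / (C3 * t powr (- \<delta> - 1))) \<longlongrightarrow> 0) at_top"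
        unfolding \<beta>\<delta> using X1(2) X2(2) X3(2) \<delta> by real_asymp
      show "\<forall>\<^sub>F t in at_top. norm (q (t / 2) 0 * E t / r t)
          \<le> C1 * (t / 2) powr (- \<beta>) * (A0 + C2 / \<delta> * t powr \<delta>) / (C3 * t powr (- \<delta> - 1))"
        using eventually_ge_at_top[of "2 * X1"] eventually_ge_at_top[of X3]
      proof eventually_elim
        case (elim t)
        have t: "0 < t" using elim X3(1) by simp
        have E0: "0 \<le> E t" unfolding E_def using A0(1) X2(2) \<delta> by simp
        have low: "0 < C3 * t powr (- \<delta> - 1)" using X3(2) t by simp
        have "q (t / 2) 0 * E t / r t \<le> C1 * (t / 2) powr (- \<beta>) * E t / (C3 * t powr (- \<delta> - 1))"
          using X1(3)[of "t / 2"] r_lower[of t] elim low E0 q_bounds[of 0 "t / 2"] X1(2)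
          by (intro frac_le mult_right_mono) auto
        moreover have "0 \<le> q (t / 2) 0 * E t / r t"
          using E0 q_bounds[of 0 "t / 2"] intensity_ge[OF t] by simp
        ultimately show ?case by (simp add: E_def)
      qed
    qed
  qed
  moreover have "(LBINT u:{0..t}. q u s * r (t - u)) = (LBINT u:{0..t}. r u * q (t - u) s)" for t
    using set_integral_reflect(1)[of t "\<lambda>u. r u * q (t - u) s"] by (simp add: mult.commute)
  ultimately show "((\<lambda>t. (LBINT u:{0..t}. r u * q (t - u) s) / r t) \<longlongrightarrow> (LBINT u:{0..}. q u s)) at_top"
    by simp
qed

lemma set_integrable_intensity_total:
  assumes \<theta>: "1 < \<theta>" shows "set_integrable lborel {0..} r"
proof -
  have d: "0 < (\<theta> - 1) / 2" using \<theta> by simp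
  obtain X C where X: "0 < X" "0 < C" "\<And>t. X \<le> t \<Longrightarrow> r t \<le> C * t powr ((\<theta> - 1) / 2 - \<theta>)"
    by (rule intensity_upper[OF d]) (rule that; blast)
  show ?thesis
  proof (rule set_integrable_at_top_of_power_bound[OF intensity_int X(1)])
    show "\<bar>r u\<bar> \<le> C * u powr ((\<theta> - 1) / 2 - \<theta>)" if "X \<le> u" for u
      using X(3)[OF that] intensity_ge[of u] X(1) that by simp
  qed (use \<theta> in \<open>simp add: field_simps\<close>)
qed

text \<open>For \<open>\<theta> > 1\<close> and \<open>\<alpha>/\<gamma> = 1\<close> the integrable factor is \<open>r\<close> and the kernel is \<open>q(\<cdot>;s\<^sub>t)\<close>. The case
  \<open>s\<^sub>t = 0\<close>, \<open>d = 0\<close> gives the normalisation \<open>J(t;0)\<close>.\<close>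

lemma intensity_convolution_integrable:
  assumes \<theta>: "1 < \<theta>" and a: "\<alpha> / \<gamma> = 1" and s: "\<And>t. 0 \<le> s t \<and> s t < 1"
    and d: "0 \<le> d" "((\<lambda>t. V (1 / (1 - s t)) / (\<mu> * t)) \<longlongrightarrow> d) at_top"
  shows "((\<lambda>t. (LBINT u:{0..t}. r u * q (t - u) (s t)) / q t 0) \<longlongrightarrow>
    (1 + d) powr (- (\<alpha> / \<gamma>)) * (LBINT u:{0..}. r u)) at_top"
proof -
  \<comment> \<open>With \<open>\<theta> = 1 + 4 \<delta>\<close> the remainder, at most of order \<open>t\<^bsup>\<delta>-\<theta>\<^esup> t\<^sup>\<delta> t\<^bsup>1+\<delta>\<^esup> = t\<^bsup>-\<delta>\<^esup>\<close>, is negligible.\<close>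
  define \<delta> where "\<delta> = (\<theta> - 1) / 4"
  have \<delta>: "0 < \<delta>" and \<theta>\<delta>: "\<theta> = 1 + 4 * \<delta>" using \<theta> by (simp_all add: \<delta>_def field_simps)
  have s': "0 \<le> s t" "s t < 1" "s t \<le> 1" for t using s[of t] by auto
  have b1: "1 - \<delta> < \<alpha> / \<gamma>" and b2: "\<alpha> / \<gamma> < 1 + \<delta>" using a \<delta> by auto
  obtain X1 C1 where X1: "0 < X1" "0 < C1" "\<And>t. X1 \<le> t \<Longrightarrow> q t 0 \<le> C1 * t powr (- (1 - \<delta>))"
    by (rule q_upper_bound[OF b1]) (rule that; blast)
  obtain X2 C2 where X2: "0 < X2" "0 < C2" "\<And>t. X2 \<le> t \<Longrightarrow> 1 / q t 0 \<le> C2 * t powr (1 + \<delta>)"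
    by (rule q_lower_bound[OF b2]) (rule that; blast)
  obtain X3 C3 where X3: "0 < X3" "0 < C3" "\<And>t. X3 \<le> t \<Longrightarrow> r t \<le> C3 * t powr (\<delta> - \<theta>)"
    by (rule intensity_upper[OF \<delta>]) (rule that; blast)
  have e1: "- 1 < - (1 - \<delta>)" using \<delta> by simp
  have q0_int: "set_integrable lborel {0..b} (\<lambda>u. q u 0)" for b by (rule set_integrable_q) auto
  obtain A0 where A0: "0 \<le> A0" "\<And>t. 0 \<le> t \<Longrightarrow> (LBINT u:{0..t}. q u 0) \<le> A0 + C1 / (- (1 - \<delta>) + 1) * t powr (- (1 - \<delta>) + 1)"
    by (rule set_integral_growth_bound[OF q0_int X1(1) less_imp_le[OF X1(2)] _ e1], rule X1(3), assumption)
       (rule that; blast)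
  define E where "E t = A0 + C1 / \<delta> * t powr \<delta>" for t
  define e where "e t = C3 * (t / 2) powr (\<delta> - \<theta>)" for t
  show ?thesis
  proof (rule convolution_asymptotic[where A=r and B="\<lambda>t v. q v (s t)" and b="\<lambda>t. q t 0" and e=e and E=E
        and K="(1 / 2) powr (- (\<alpha> / \<gamma>)) + 1"])
    show "set_integrable lborel {0..} r" by (rule set_integrable_intensity_total[OF \<theta>])
    show "0 \<le> r u" if "0 < u" for u using that by (rule intensity_ge)
    show "set_integrable lborel {0..t} (\<lambda>v. q v (s t))" for t using s' by (intro set_integrable_q) auto
    show "0 \<le> q u (s t)" for t u using s' q_bounds by simp
    show "\<forall>\<^sub>F t in at_top. 0 < q t 0"
      by (rule eventually_mono[OF eventually_ge_at_top[of 0]]) (rule q_zero_pos)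
    show "((\<lambda>t. q (t - u) (s t) / q t 0) \<longlongrightarrow> (1 + d) powr (- (\<alpha> / \<gamma>))) at_top" if "0 \<le> u" for u
      by (rule q_ratio_tendsto[OF s d that])
    show "\<forall>\<^sub>F t in at_top. \<forall>u\<in>{0..t / 2}. q (t - u) (s t) \<le> ((1 / 2) powr (- (\<alpha> / \<gamma>)) + 1) * q t 0"
    proof -
      have "((\<lambda>t. q (1 / 2 * t) 0 / q t 0) \<longlongrightarrow> (1 / 2) powr (- (\<alpha> / \<gamma>))) at_top"
        using q_regularly_varying by (simp only: regularly_varying_def)
      from order_tendstoD(2)[OF this, of "(1 / 2) powr (- (\<alpha> / \<gamma>)) + 1"]
      have "\<forall>\<^sub>F t in at_top. q (1 / 2 * t) 0 / q t 0 < (1 / 2) powr (- (\<alpha> / \<gamma>)) + 1" by simp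
      then show ?thesis using eventually_ge_at_top[of 0]
      proof (eventually_elim, intro ballI)
        fix t u assume q: "q (1 / 2 * t) 0 / q t 0 < (1 / 2) powr (- (\<alpha> / \<gamma>)) + 1" and t: "0 \<le> t" and u: "u \<in> {0..t / 2}"
        have "q (t - u) (s t) \<le> q (1 / 2 * t) 0" using s' t u by (intro q_antimono) auto
        also have "\<dots> \<le> ((1 / 2) powr (- (\<alpha> / \<gamma>)) + 1) * q t 0"
          using q q_zero_pos[OF t] by (simp only: pos_divide_less_eq less_imp_le)
        finally show "q (t - u) (s t) \<le> ((1 / 2) powr (- (\<alpha> / \<gamma>)) + 1) * q t 0" .
      qed
    qed
    show "\<forall>\<^sub>F t in at_top. \<forall>u\<in>{t / 2..t}. r u \<le> e t"
      using eventually_ge_at_top[of "2 * X3"]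
    proof (eventually_elim, intro ballI)
      fix t u assume t: "2 * X3 \<le> t" and u: "u \<in> {t / 2..t}"
      then have "r u \<le> C3 * u powr (\<delta> - \<theta>)" by (intro X3(3)) auto
      also have "u powr (\<delta> - \<theta>) \<le> (t / 2) powr (\<delta> - \<theta>)"
        using t u X3(1) \<delta> by (intro powr_mono2') (auto simp: \<theta>\<delta>)
      finally show "r u \<le> e t" using X3(2) by (simp add: e_def)
    qed
    show "\<forall>\<^sub>F t in at_top. (LBINT u:{0..t}. q u (s t)) \<le> E t"
      using eventually_ge_at_top[of 0]
    proof eventually_elim
      case (elim t)
      have "(LBINT u:{0..t}. q u (s t)) \<le> (LBINT u:{0..t}. q u 0)"
        using s' by (intro set_integral_mono set_integrable_q q_antimono) auto
      also have "\<dots> \<le> E t" using A0(2)[OF elim] by (simp add: E_def)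
      finally show ?case .
    qed
    show "((\<lambda>t. e t * E t / q t 0) \<longlongrightarrow> 0) at_top"
    proof (rule Lim_null_comparison)
      show "((\<lambda>t. C3 * (t / 2) powr (\<delta> - \<theta>) * (A0 + C1 / \<delta> * t powr \<delta>) * (C2 * t powr (1 + \<delta>))) \<longlongrightarrow> 0) at_top"
        unfolding \<theta>\<delta> using X1(2) X2(2) X3(2) \<delta> by real_asymp
      show "\<forall>\<^sub>F t in at_top. norm (e t * E t / q t 0)
          \<le> C3 * (t / 2) powr (\<delta> - \<theta>) * (A0 + C1 / \<delta> * t powr \<delta>) * (C2 * t powr (1 + \<delta>))"
        using eventually_ge_at_top[of X2]
      proof eventually_elim
        case (elim t)
        have E0: "0 \<le> E t" unfolding E_def using A0(1) X1(2) \<delta> by simp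
        have e0: "0 \<le> e t" unfolding e_def using X3(2) by simp
        have "e t * E t * (1 / q t 0) \<le> e t * E t * (C2 * t powr (1 + \<delta>))"
          using X2(3)[OF elim] e0 E0 by (intro mult_left_mono) auto
        moreover have "0 \<le> e t * E t / q t 0" using E0 e0 q_bounds[of 0 t] by simp
        ultimately show ?case by (simp add: E_def e_def)
      qed
    qed
  qed
qed

end

section \<open>The conditional limit theorems\<close>

lemma (in prob_space) integral_uniform_measure_eq:
  assumes A[measurable]: "A \<in> events" and pos: "0 < prob A" and f[measurable]: "f \<in> borel_measurable M"
  shows "(\<integral>\<omega>. f \<omega> \<partial>uniform_measure M A) = expectation (\<lambda>\<omega>. indicator A \<omega> * f \<omega>) / prob A"
proof -
  have "uniform_measure M A = density M (\<lambda>\<omega>. ennreal (indicator A \<omega> / prob A))"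
    unfolding uniform_measure_def
    by (intro density_cong AE_I2)
       (auto simp: emeasure_eq_measure indicator_def divide_ennreal[symmetric] pos)
  then have "(\<integral>\<omega>. f \<omega> \<partial>uniform_measure M A) = expectation (\<lambda>\<omega>. (indicator A \<omega> / prob A) *\<^sub>R f \<omega>)"
    using pos by (simp add: integral_density)
  then show ?thesis by simp
qed

lemma set_integral_pos_of_eventually_pos:
  fixes f :: "real \<Rightarrow> real"
  assumes f: "set_integrable lborel {0..} f" "\<And>u. 0 < u \<Longrightarrow> 0 \<le> f u" and pos: "\<forall>\<^sub>F u in at_top. 0 < f u"
  shows "0 < (LBINT u:{0..}. f u)"
proof -
  have nonneg: "AE u in lborel. 0 \<le> indicator {0..} u *\<^sub>R f u"
    using AE_lborel_singleton[of "0::real"]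
  proof eventually_elim
    case (elim u)
    then show ?case using f(2)[of u] by (auto simp: indicator_def)
  qed
  have "(LBINT u:{0..}. f u) \<noteq> 0"
  proof
    assume "(LBINT u:{0..}. f u) = 0"
    then have zero: "AE u in lborel. indicator {0..} u *\<^sub>R f u = 0"
      using integral_nonneg_eq_0_iff_AE[OF f(1)[unfolded set_integrable_def] nonneg]
      by (simp add: set_lebesgue_integral_def)
    obtain X where X: "\<And>u. X \<le> u \<Longrightarrow> 0 < f u" using pos by (auto simp: eventually_at_top_linorder)
    define Y where "Y = max X 0"
    have "AE u in lborel. u \<notin> {Y..Y + 1}"
      using zero
    proof eventually_elim
      case (elim u)
      then show ?case using X[of u] by (auto simp: Y_def indicator_def)
    qed
    then have "emeasure lborel {Y..Y + 1} = 0"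
      by (subst (asm) AE_iff_measurable[of "{Y..Y + 1}"]) auto
    then show False by simp
  qed
  moreover have "0 \<le> (LBINT u:{0..}. f u)"
    unfolding set_lebesgue_integral_def by (rule integral_nonneg_AE[OF nonneg])
  ultimately show ?thesis by simp
qed

locale decaying_immigration =
  critical_immigration M r \<nu> \<mu> p h I G \<gamma> L + decaying_intensity \<mu> p \<gamma> L h \<alpha> l r \<theta> L\<^sub>R
  for M :: "'a measure" and r :: "real \<Rightarrow> real" and \<nu> :: "real \<Rightarrow> 'a \<Rightarrow> nat"
    and \<mu> :: real and p h :: "nat pmf" and I :: "nat \<Rightarrow> 'a \<Rightarrow> nat"
    and G :: "nat \<Rightarrow> nat \<Rightarrow> 'a \<Rightarrow> genealogy" and \<gamma> :: real and L :: "real \<Rightarrow> real"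
    and \<alpha> :: real and l :: "real \<Rightarrow> real" and \<theta> :: real and L\<^sub>R :: "real \<Rightarrow> real"
begin

abbreviation "Y \<equiv> total_population \<nu> I G"

definition J :: "real \<Rightarrow> real \<Rightarrow> real" where "J t s = (LBINT u:{0..t}. r u * q (t - u) s)"

abbreviation "survive t \<equiv> {\<omega> \<in> space M. 0 < Y t \<omega>}"

lemma survive_event [measurable]: "0 \<le> t \<Longrightarrow> survive t \<in> events"
proof -
  assume "0 \<le> t"
  note [measurable] = measurable_total_population[OF this]
  show ?thesis by measurable
qed

lemma prob_survive: assumes t: "0 \<le> t" shows "prob (survive t) = 1 - exp (- J t 0)"
proof -
  have "expectation (\<lambda>\<omega>. 0 ^ Y t \<omega>) = expectation (\<lambda>\<omega>. indicator (space M - survive t) \<omega> :: real)"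
    by (intro Bochner_Integration.integral_cong) (auto simp: indicator_def power_0_left)
  also have "\<dots> = prob (space M - survive t)"
    using survive_event[OF t] by (simp add: Int_absorb2 Diff_subset)
  also have "\<dots> = 1 - prob (survive t)" by (rule prob_compl[OF survive_event[OF t]])
  finally show ?thesis using total_population_pgf[OF t, of 0] by (simp add: J_def)
qed

lemma conditional_pgf:
  assumes t: "0 \<le> t" and s: "0 \<le> s" "s \<le> 1" and pos: "0 < prob (survive t)"
  shows "(\<integral>\<omega>. s ^ Y t \<omega> \<partial>uniform_measure M (survive t)) = 1 - (1 - exp (- J t s)) / (1 - exp (- J t 0))"
proof -
  note [measurable] = measurable_total_population[OF t] measurable_power_nat survive_event[OF t]
  have int: "integrable M (\<lambda>\<omega>. x ^ Y t \<omega>)" if "0 \<le> x" "x \<le> 1" for x :: real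
    using that by (intro integrable_const_bound[where B=1]) (auto simp: power_le_one)
  have "expectation (\<lambda>\<omega>. indicator (survive t) \<omega> * s ^ Y t \<omega>) = expectation (\<lambda>\<omega>. s ^ Y t \<omega> - 0 ^ Y t \<omega>)"
    by (intro Bochner_Integration.integral_cong) (auto simp: indicator_def power_0_left)
  also have "\<dots> = exp (- J t s) - exp (- J t 0)"
    using int[OF s] int[of 0] total_population_pgf[OF t s] total_population_pgf[OF t, of 0]
    by (simp add: J_def)
  finally have "(\<integral>\<omega>. s ^ Y t \<omega> \<partial>uniform_measure M (survive t)) = (exp (- J t s) - exp (- J t 0)) / prob (survive t)"
    using integral_uniform_measure_eq[OF survive_event[OF t] pos, of "\<lambda>\<omega>. s ^ Y t \<omega>"] by simp
  moreover have "(x - y) / (1 - y) = 1 - (1 - x) / (1 - y)" if "0 < 1 - y" for x y :: real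
    using that by (simp add: field_simps)
  ultimately show ?thesis using pos unfolding prob_survive[OF t] by simp
qed

lemma prob_survive_eventually:
  assumes "((\<lambda>t. J t 0 / b t) \<longlongrightarrow> d) at_top" "0 < d" "\<forall>\<^sub>F t in at_top. 0 < b t"
  shows "\<forall>\<^sub>F t in at_top. 0 \<le> t \<and> 0 < prob (survive t)"
  using order_tendstoD(1)[OF assms(1,2)] assms(3) eventually_ge_at_top[of 0]
proof eventually_elim
  case (elim t)
  then have "0 < J t 0" by (simp add: zero_less_divide_iff)
  with elim show ?case by (simp add: prob_survive)
qed

lemma tendsto_zero_of_power_bound:
  fixes f :: "real \<Rightarrow> real"
  assumes "\<forall>\<^sub>F t in at_top. 0 < f t" and "\<And>t. X \<le> t \<Longrightarrow> f t \<le> C * t powr e" and "e < 0"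
  shows "(f \<longlongrightarrow> 0) at_top"
proof (rule tendsto_sandwich)
  show "\<forall>\<^sub>F t in at_top. 0 \<le> f t" using assms(1) by eventually_elim simp
  show "\<forall>\<^sub>F t in at_top. f t \<le> C * t powr e" using eventually_ge_at_top[of X] by eventually_elim (rule assms(2))
  have "((\<lambda>t. C * t powr e) \<longlongrightarrow> C * 0) at_top"
    using assms(3) by (intro tendsto_mult tendsto_const tendsto_neg_powr filterlim_ident)
  then show "((\<lambda>t. C * t powr e) \<longlongrightarrow> 0) at_top" by simp
qed simp

lemma conditional_pgf_harmonic:
  assumes \<theta>: "\<theta> = 1" and a: "1 < \<alpha> / \<gamma>" and s: "0 \<le> s" "s < 1"
  shows "((\<lambda>t. \<integral>\<omega>. s ^ Y t \<omega> \<partial>uniform_measure M (survive t)) \<longlongrightarrow>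
    1 - Delta \<mu> p h s / Q_total \<mu> p h) at_top"
proof -
  have J: "((\<lambda>t. J t s / r t) \<longlongrightarrow> Delta \<mu> p h s) at_top" if "0 \<le> s" "s < 1" for s
    using intensity_convolution_harmonic(1)[OF \<theta> a that] by (simp add: J_def Delta_def)
  have J0: "((\<lambda>t. J t 0 / r t) \<longlongrightarrow> Q_total \<mu> p h) at_top"
    using J[of 0] by (simp add: Delta_def Q_total_def)
  have Q_pos: "0 < Q_total \<mu> p h"
    unfolding Q_total_def
  proof (rule set_integral_pos_of_eventually_pos)
    show "set_integrable lborel {0..} (\<lambda>u. q u 0)" by (rule intensity_convolution_harmonic(2)[OF \<theta> a]) auto
    show "0 \<le> q u 0" for u by (rule q_bounds) auto
    show "\<forall>\<^sub>F u in at_top. 0 < q u 0"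
      by (rule eventually_mono[OF eventually_ge_at_top[of 0]]) (rule q_zero_pos)
  qed
  have half: "0 < (1 / 2 :: real)" by simp
  obtain X C where X: "0 < X" "0 < C" "\<And>t. X \<le> t \<Longrightarrow> r t \<le> C * t powr (1 / 2 - \<theta>)"
    by (rule intensity_upper[OF half]) (rule that; blast)
  have r0: "(r \<longlongrightarrow> 0) at_top"
    by (rule tendsto_zero_of_power_bound[OF intensity_pos X(3)]) (simp_all add: \<theta>)
  have "((\<lambda>t. 1 - (1 - exp (- J t s)) / (1 - exp (- J t 0))) \<longlongrightarrow> 1 - Delta \<mu> p h s / Q_total \<mu> p h) at_top"
    using Q_pos by (intro tendsto_diff tendsto_const one_minus_exp_ratio[OF J[OF s] J0 intensity_pos r0]) simp
  moreover have "\<forall>\<^sub>F t in at_top. 1 - (1 - exp (- J t s)) / (1 - exp (- J t 0)) =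
      (\<integral>\<omega>. s ^ Y t \<omega> \<partial>uniform_measure M (survive t))"
    using prob_survive_eventually[OF J0 Q_pos intensity_pos]
    by eventually_elim (use s in \<open>simp add: conditional_pgf\<close>)
  ultimately show ?thesis by (rule Lim_transform_eventually)
qed

text \<open>The point mass at 0 stands in at the times at which the conditioning event is null, so that the
  family consists of laws for every \<open>t\<close>.\<close>

definition scaled_law :: "real \<Rightarrow> real measure" where
  "scaled_law t = (if 0 \<le> t \<and> 0 < prob (survive t)
     then distr (uniform_measure M (survive t)) borel (\<lambda>\<omega>. real (Y t \<omega>) / W (\<mu> * t))
     else return borel 0)"

lemma
  assumes t: "0 \<le> t" and pos: "0 < prob (survive t)"
  shows prob_space_conditional: "prob_space (uniform_measure M (survive t))"
    and measurable_scaled: "(\<lambda>\<omega>. real (Y t \<omega>) / W (\<mu> * t)) \<in> borel_measurable (uniform_measure M (survive t))"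
proof -
  show "prob_space (uniform_measure M (survive t))"
    using pos by (intro prob_space_uniform_measure) (auto simp: emeasure_eq_measure)
  note [measurable] = measurable_total_population[OF t]
  have "(\<lambda>\<omega>. real (Y t \<omega>) / W (\<mu> * t)) \<in> borel_measurable M" by measurable
  then show "(\<lambda>\<omega>. real (Y t \<omega>) / W (\<mu> * t)) \<in> borel_measurable (uniform_measure M (survive t))"
    by (simp add: measurable_cong_sets[OF sets_uniform_measure refl])
qed

lemma real_distribution_scaled_law: "real_distribution (scaled_law t)"
proof (cases "0 \<le> t \<and> 0 < prob (survive t)")
  case True
  then interpret U: prob_space "uniform_measure M (survive t)" by (intro prob_space_conditional) auto
  show ?thesis using True measurable_scaled unfolding scaled_law_def by (simp add: U.real_distribution_distr)
next
  case False
  interpret U: prob_space "return borel (0::real)" by (rule prob_space_return) simp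
  show ?thesis using False unfolding scaled_law_def
    by (simp only: if_False) (unfold_locales, auto)
qed

lemma scaled_law_nonneg: "AE x in scaled_law t. 0 \<le> x"
proof (cases "0 \<le> t \<and> 0 < prob (survive t)")
  case True
  then have W: "1 \<le> W (\<mu> * t)" using rate by (intro W_right_inverse) simp
  have "AE \<omega> in uniform_measure M (survive t). 0 \<le> real (Y t \<omega>) / W (\<mu> * t)" using W by (intro AE_I2) simp
  then show ?thesis using True measurable_scaled unfolding scaled_law_def by (simp add: AE_distr_iff)
next
  case False
  then have "scaled_law t = return borel 0" unfolding scaled_law_def by (simp only: if_False)
  then show ?thesis by (simp only:) (subst AE_return, auto)
qed

lemma scaled_law_laplace:
  assumes t: "0 \<le> t" and pos: "0 < prob (survive t)" and z: "0 < z"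
  shows "(\<integral>x. exp (- z * x) \<partial>scaled_law t) =
    1 - (1 - exp (- J t (exp (- z / W (\<mu> * t))))) / (1 - exp (- J t 0))"
proof -
  have W: "1 \<le> W (\<mu> * t)" using rate t by (intro W_right_inverse) simp
  have "(\<integral>x. exp (- z * x) \<partial>scaled_law t) =
      (\<integral>\<omega>. exp (- z * (real (Y t \<omega>) / W (\<mu> * t))) \<partial>uniform_measure M (survive t))"
    using t pos measurable_scaled[OF t pos] unfolding scaled_law_def by (simp add: integral_distr)
  also have "\<dots> = (\<integral>\<omega>. exp (- z / W (\<mu> * t)) ^ Y t \<omega> \<partial>uniform_measure M (survive t))"
    by (intro Bochner_Integration.integral_cong refl) (simp add: exp_of_nat_mult[symmetric] mult.commute)
  also have "\<dots> = 1 - (1 - exp (- J t (exp (- z / W (\<mu> * t))))) / (1 - exp (- J t 0))"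
    using W z by (intro conditional_pgf t pos) auto
  finally show ?thesis .
qed

lemma scaled_law_cdf:
  assumes t: "0 \<le> t" and pos: "0 < prob (survive t)"
  shows "cdf (scaled_law t) x = \<P>(\<omega> in M. real (Y t \<omega>) / W (\<mu> * t) \<le> x \<bar> 0 < Y t \<omega>)"
proof -
  note [measurable] = measurable_total_population[OF t]
  have "cdf (scaled_law t) x = measure (uniform_measure M (survive t))
      {\<omega> \<in> space M. real (Y t \<omega>) / W (\<mu> * t) \<le> x}"
    using t pos measurable_scaled[OF t pos] unfolding scaled_law_def cdf_def
    by (simp add: measure_distr) (rule arg_cong[where f="measure _"], auto)
  also have "\<dots> = \<P>(\<omega> in M. real (Y t \<omega>) / W (\<mu> * t) \<le> x \<bar> 0 < Y t \<omega>)"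
    using measure_uniform_measure_eq_cond_prob[of "\<lambda>\<omega>. real (Y t \<omega>) / W (\<mu> * t) \<le> x" "\<lambda>\<omega>. 0 < Y t \<omega>"] by simp
  finally show ?thesis .
qed

text \<open>The limit law is identified along the integers; along any other sequence the limit has the same
  Laplace transform, hence is the same law.\<close>

lemma conditional_limit_law:
  assumes \<theta>: "1 < \<theta>" and a: "\<alpha> / \<gamma> = 1"
  shows "\<exists>D. real_distribution D \<and> measure D {..<0} = 0 \<and>
    (\<forall>z>0. (\<integral>x. exp (- z * x) \<partial>D) = 1 - z powr \<alpha> / (1 + z powr \<gamma>) powr (\<alpha> / \<gamma>)) \<and>
    (\<forall>x\<ge>0. ((\<lambda>t. \<P>(\<omega> in M. real (Y t \<omega>) / W (\<mu> * t) \<le> x \<bar> 0 < Y t \<omega>)) \<longlongrightarrow> cdf D x) at_top)"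
proof -
  have \<alpha>\<gamma>: "\<alpha> = \<gamma>" using a gamma by simp
  define \<phi> where "\<phi> z = 1 / (1 + z powr \<alpha>)" for z :: real
  have complement: "1 - w / (1 + w) = 1 / (1 + w)" if "0 < w" for w :: real
    using that by (simp add: field_simps)
  let ?R = "LBINT u:{0..}. r u"
  have R_pos: "0 < ?R"
    by (rule set_integral_pos_of_eventually_pos[OF set_integrable_intensity_total[OF \<theta>] intensity_ge intensity_pos])
  have q_pos: "\<forall>\<^sub>F t in at_top. 0 < q t 0"
    by (rule eventually_mono[OF eventually_ge_at_top[of 0]]) (rule q_zero_pos)
  have half: "1 / 2 < \<alpha> / \<gamma>" using a by simp
  obtain X C where X: "0 < X" "0 < C" "\<And>t. X \<le> t \<Longrightarrow> q t 0 \<le> C * t powr (- (1 / 2))"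
    by (rule q_upper_bound[OF half]) (rule that; blast)
  have q0: "((\<lambda>t. q t 0) \<longlongrightarrow> 0) at_top"
    by (rule tendsto_zero_of_power_bound[OF q_pos X(3)]) simp_all
  have J0: "((\<lambda>t. J t 0 / q t 0) \<longlongrightarrow> ?R) at_top"
    using intensity_convolution_integrable[OF \<theta> a, of "\<lambda>_. 0" 0] by (simp add: J_def)
  have alive: "\<forall>\<^sub>F t in at_top. 0 \<le> t \<and> 0 < prob (survive t)"
    by (rule prob_survive_eventually[OF J0 R_pos q_pos])
  have laplace: "((\<lambda>t. \<integral>x. exp (- z * x) \<partial>scaled_law t) \<longlongrightarrow> \<phi> z) at_top" if z: "0 < z" for z
  proof -
    define s where "s t = (if 0 \<le> t then exp (- z / W (\<mu> * t)) else 0)" for t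
    have s: "0 \<le> s t \<and> s t < 1" for t
    proof (cases "0 \<le> t")
      case True
      then have "1 \<le> W (\<mu> * t)" using rate by (intro W_right_inverse) simp
      then show ?thesis using z True by (simp add: s_def)
    qed (simp add: s_def)
    have "\<forall>\<^sub>F t in at_top. V (1 / (1 - exp (- z / W (\<mu> * t)))) / (\<mu> * t) = V (1 / (1 - s t)) / (\<mu> * t)"
      using eventually_ge_at_top[of 0] by eventually_elim (simp add: s_def)
    from Lim_transform_eventually[OF V_scaled[OF z] this]
    have Vs: "((\<lambda>t. V (1 / (1 - s t)) / (\<mu> * t)) \<longlongrightarrow> z powr (- \<gamma>)) at_top" .
    have "((\<lambda>t. J t (s t) / q t 0) \<longlongrightarrow> (1 + z powr (- \<gamma>)) powr (- (\<alpha> / \<gamma>)) * ?R) at_top"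
      using intensity_convolution_integrable[OF \<theta> a s powr_ge_zero Vs] by (simp only: J_def)
    from tendsto_diff[OF tendsto_const one_minus_exp_ratio[OF this J0 q_pos q0], of 1] R_pos
    have "((\<lambda>t. 1 - (1 - exp (- J t (s t))) / (1 - exp (- J t 0))) \<longlongrightarrow>
        1 - (1 + z powr (- \<gamma>)) powr (- (\<alpha> / \<gamma>))) at_top" by simp
    also have "1 - (1 + z powr (- \<gamma>)) powr (- (\<alpha> / \<gamma>)) = \<phi> z"
    proof -
      have pos: "0 < z powr \<gamma>" using z by simp
      have "(1 + z powr (- \<gamma>)) powr (- (\<alpha> / \<gamma>)) = 1 / (1 + 1 / z powr \<gamma>)"
        unfolding a powr_minus_divide using pos by (simp add: add_nonneg_nonneg)
      also have "\<dots> = z powr \<gamma> / (1 + z powr \<gamma>)" using pos by (simp add: field_simps)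
      also have "1 - z powr \<gamma> / (1 + z powr \<gamma>) = \<phi> z"
        unfolding \<phi>_def \<alpha>\<gamma> by (rule complement[OF pos])
      finally show ?thesis .
    qed
    finally have "((\<lambda>t. 1 - (1 - exp (- J t (s t))) / (1 - exp (- J t 0))) \<longlongrightarrow> \<phi> z) at_top" .
    moreover have "\<forall>\<^sub>F t in at_top. 1 - (1 - exp (- J t (s t))) / (1 - exp (- J t 0)) =
        (\<integral>x. exp (- z * x) \<partial>scaled_law t)"
      using alive
    proof eventually_elim
      case (elim t)
      then show ?case using scaled_law_laplace[of t z] z by (simp add: s_def)
    qed
    ultimately show ?thesis by (rule Lim_transform_eventually)
  qed
  have \<phi>_1: "(\<phi> \<longlongrightarrow> 1) (at_right 0)"
    unfolding \<phi>_def using alpha by real_asymp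
  have seq_limit: "\<exists>D. real_distribution D \<and> (AE x in D. 0 \<le> x) \<and>
      (\<forall>z>0. (\<integral>x. exp (- z * x) \<partial>D) = \<phi> z) \<and>
      (\<forall>x. measure D {x} = 0 \<longrightarrow> (\<lambda>n. cdf (scaled_law (T n)) x) \<longlonglongrightarrow> cdf D x)"
    if T: "filterlim T at_top sequentially" for T :: "nat \<Rightarrow> real"
  proof -
    have "(\<lambda>n. \<integral>x. exp (- z * x) \<partial>scaled_law (T n)) \<longlonglongrightarrow> \<phi> z" if "0 < z" for z
      by (rule filterlim_compose[OF laplace[OF that] T])
    from laplace_continuity[OF real_distribution_scaled_law scaled_law_nonneg this \<phi>_1]
    obtain D where "real_distribution D" "AE x in D. 0 \<le> x"
      "\<And>z. 0 < z \<Longrightarrow> (\<integral>x. exp (- z * x) \<partial>D) = \<phi> z"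
      "\<And>x. measure D {x} = 0 \<Longrightarrow> (\<lambda>n. cdf (scaled_law (T n)) x) \<longlonglongrightarrow> cdf D x"
      by blast
    then show ?thesis by (intro exI[of _ D]) blast
  qed
  obtain D where D: "real_distribution D" "AE x in D. 0 \<le> x" "\<And>z. 0 < z \<Longrightarrow> (\<integral>x. exp (- z * x) \<partial>D) = \<phi> z"
    using seq_limit[OF filterlim_real_sequentially] by blast
  interpret D: real_distribution D by (rule D)
  have atomless: "measure D {x} = 0" for x
    by (rule linnik_atomless[OF D(1,2) alpha]) (simp only: D(3) \<phi>_def)
  have "((\<lambda>t. cdf (scaled_law t) x) \<longlongrightarrow> cdf D x) at_top" for x
  proof (rule tendsto_at_topI_sequentially)
    fix T :: "nat \<Rightarrow> real" assume T: "filterlim T at_top sequentially"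
    obtain D' where D': "real_distribution D'" "AE x in D'. 0 \<le> x"
      "\<And>z. 0 < z \<Longrightarrow> (\<integral>x. exp (- z * x) \<partial>D') = \<phi> z"
      "\<And>x. measure D' {x} = 0 \<Longrightarrow> (\<lambda>n. cdf (scaled_law (T n)) x) \<longlonglongrightarrow> cdf D' x"
      using seq_limit[OF T] by blast
    have "D' = D" by (rule laplace_determines_law[OF D'(1) D(1) D'(2) D(2)]) (simp only: D'(3) D(3))
    with D'(4) atomless show "(\<lambda>n. cdf (scaled_law (T n)) x) \<longlonglongrightarrow> cdf D x" by simp
  qed
  moreover have "\<forall>\<^sub>F t in at_top. cdf (scaled_law t) x = \<P>(\<omega> in M. real (Y t \<omega>) / W (\<mu> * t) \<le> x \<bar> 0 < Y t \<omega>)" for x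
    using alive by eventually_elim (simp add: scaled_law_cdf)
  ultimately have conv: "((\<lambda>t. \<P>(\<omega> in M. real (Y t \<omega>) / W (\<mu> * t) \<le> x \<bar> 0 < Y t \<omega>)) \<longlongrightarrow> cdf D x) at_top" for x
    by (rule Lim_transform_eventually)
  have neg: "measure D {..<0} = 0"
  proof -
    have "AE x in D. x \<notin> {..<0}" using D(2) by eventually_elim simp
    then show ?thesis using D.prob_eq_0[of "{..<0}"] by simp
  qed
  have "1 - z powr \<alpha> / (1 + z powr \<gamma>) powr (\<alpha> / \<gamma>) = \<phi> z" if z: "0 < z" for z
  proof -
    have pos: "0 < z powr \<gamma>" using z by simp
    then have "(1 + z powr \<gamma>) powr 1 = 1 + z powr \<gamma>" by simp
    with complement[OF pos] show ?thesis unfolding a unfolding \<alpha>\<gamma> \<phi>_def by (simp only:)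
  qed
  with D conv neg show ?thesis by (intro exI[of _ D]) simp
qed

end

theorem theorem5p2:
  fixes M :: "'a measure" and r :: "real \<Rightarrow> real" and \<nu> :: "real \<Rightarrow> 'a \<Rightarrow> nat"
    and \<mu> \<gamma> \<alpha> \<theta> :: real and p h :: "nat pmf"
    and I :: "nat \<Rightarrow> 'a \<Rightarrow> nat" and G :: "nat \<Rightarrow> nat \<Rightarrow> 'a \<Rightarrow> genealogy"
    and L l L\<^sub>R :: "real \<Rightarrow> real"
  defines "Y \<equiv> total_population \<nu> I G"
  assumes model: "branching_immigration M r \<nu> \<mu> p h I G"
    and critical: "measure_pmf.expectation p real = 1"
    and gamma: "0 < \<gamma>" "\<gamma> \<le> 1"
    and alpha: "0 < \<alpha>" "\<alpha> \<le> 1"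
    and theta: "0 < \<theta>"
    and slow: "slowly_varying L" "slowly_varying l" "slowly_varying L\<^sub>R"
    and offspring: "\<And>s. 0 \<le> s \<Longrightarrow> s < 1 \<Longrightarrow>
      pgf p s = s + (1 - s) powr (\<gamma> + 1) * L (1 / (1 - s))"
    and immigrants: "\<And>s. 0 \<le> s \<Longrightarrow> s < 1 \<Longrightarrow>
      pgf h s = 1 - (1 - s) powr \<alpha> * l (1 / (1 - s))"
    and intensity: "\<And>t. 0 < t \<Longrightarrow> r t = t powr (- \<theta>) * L\<^sub>R t"
  shows
    "(\<theta> = 1 \<and> filterlim (mean_measure r) at_top at_top \<and> 1 < \<alpha> / \<gamma> \<longrightarrow>
        (\<forall>s\<in>{0..<1}.
          ((\<lambda>t. \<integral>\<omega>. s ^ Y t \<omega> \<partial>uniform_measure M {\<omega>\<in>space M. 0 < Y t \<omega>})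
            \<longlongrightarrow> 1 - Delta \<mu> p h s / Q_total \<mu> p h) at_top)) \<and>
     (1 < \<theta> \<and> \<alpha> / \<gamma> = 1 \<and> filterlim (Q_fun \<mu> p h) at_top at_top \<longrightarrow>
        (\<exists>D. real_distribution D \<and> measure D {..<0} = 0 \<and>
          (\<forall>z>0. (\<integral>x. exp (- z * x) \<partial>D) =
                   1 - z powr \<alpha> / (1 + z powr \<gamma>) powr (\<alpha> / \<gamma>)) \<and>
          (\<forall>x\<ge>0. ((\<lambda>t. \<P>(\<omega> in M. real (Y t \<omega>) / W_fun (pgf p) (\<mu> * t) \<le> x
                                  \<bar> 0 < Y t \<omega>))
                    \<longlongrightarrow> cdf D x) at_top)))"
proof -
  interpret model: branching_immigration M r \<nu> \<mu> p h I G by (rule model)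
  interpret decaying_immigration M r \<nu> \<mu> p h I G \<gamma> L \<alpha> l \<theta> L\<^sub>R
  proof unfold_locales
    show "set_integrable lborel {0..t} r" for t
      using model.intensity_integrable[of t] by (cases "0 \<le> t") auto
  qed (use model.rate_pos model.intensity_nonneg critical gamma alpha slow offspring immigrants intensity in auto)
  show ?thesis
    unfolding Y_def using conditional_pgf_harmonic conditional_limit_law by auto
qed

end
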